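(* (i) Let $\epsilon>0$ and set $$\chi_1(x_1)=\int_0^{x_1}\epsilon\,\big|\log|s/4|\big|^{\alpha}\,ds,\qquad 0<\alpha<1/2 .$$ There is $\Psi_1\in H^2(\mathbb{R}^3)$ such that $$\Psi_1(x)=\chi_1(x_1)\quad\text{in } B_0=\{x\in\mathbb{R}^3:(x_1-1)^2+x_2^2+x_3^2<1\}$$ and $$\|\Psi_1\|_{\dot H^2}\le C_\alpha\,\epsilon,$$ $\operatorname{supp}\Psi_1\subset\{x:|x|\le 2\}$ and $\operatorname{sing\,supp}\Psi_1=\{0\}$. (ii) Let $$\chi_2(x_1)=2\int_0^{x_1}\chi_1'(s)^2\,ds=2\int_0^{x_1}\epsilon^2\big|\log|s/4|\big|^{2\alpha}\,ds,\qquad 1/4<\alpha<1/2 .$$ There is $\Psi_{2t}\in\dot H^1(\mathbb{R}^3)$ such that $$\Psi_{2t}(x)=\chi_2(x_1-t)\quad\text{in } B_t=\{x\in\mathbb{R}^3:(x_1-1)^2+x_2^2+x_3^2<(1-t)^2\}.$$ For $0\le t<1$ we have $$\|\Psi_{2t}\|_{\dot H^2(B_t)}=\infty .$$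
   Context: $\dot H^k$ denotes the homogeneous Sobolev (semi)norm, i.e. the $L^2$ norm of the derivatives of order $k$, over $\mathbb{R}^3$ or over the indicated set. $C_\alpha$ is a constant depending on $\alpha$. $\operatorname{sing\,supp}$ denotes the singular support: the complement of the largest open set on which the function is smooth.
   Formalization: The support claim supp Ψ₁ ⊂ {|x| ≤ 2} is impossible, since Ψ₁ would be discontinuous at (2,0,0); it is replaced by supp Ψ₁ ⊂ {|x| ≤ R} for every R > 2, with the constant C depending on both α and R. *)

theory Defs
  imports "HOL-Analysis.Analysis"
begin

section \<open>Smooth functions, supports and singular supports\<close>

definition partial :: "'n \<Rightarrow> (real ^ 'n \<Rightarrow> real) \<Rightarrow> real ^ 'n \<Rightarrow> real" where
  "partial i f x = frechet_derivative f (at x) (axis i 1)"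

fun iter_partial :: "'n list \<Rightarrow> (real ^ 'n \<Rightarrow> real) \<Rightarrow> real ^ 'n \<Rightarrow> real" where
  "iter_partial [] f = f"
| "iter_partial (i # is) f = partial i (iter_partial is f)"

text \<open>The class \<open>C\<^sup>k(U)\<close> and the class of smooth functions, meant for open \<open>U\<close>.\<close>

fun Ck_on :: "nat \<Rightarrow> (real ^ 'n) set \<Rightarrow> (real ^ 'n \<Rightarrow> real) \<Rightarrow> bool" where
  "Ck_on 0 U f \<longleftrightarrow> continuous_on U f"
| "Ck_on (Suc k) U f \<longleftrightarrow> (\<forall>x\<in>U. f differentiable (at x)) \<and> (\<forall>i. Ck_on k U (partial i f))"

definition smooth_on :: "(real ^ 'n) set \<Rightarrow> (real ^ 'n \<Rightarrow> real) \<Rightarrow> bool" where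
  "smooth_on U f \<longleftrightarrow> (\<forall>k. Ck_on k U f)"

definition supp :: "(real ^ 'n \<Rightarrow> real) \<Rightarrow> (real ^ 'n) set" where
  "supp f = closure {x. f x \<noteq> 0}"

definition sing_supp :: "(real ^ 'n \<Rightarrow> real) \<Rightarrow> (real ^ 'n) set" where
  "sing_supp f = - \<Union>{U. open U \<and> smooth_on U f}"

section \<open>Weak derivatives and Sobolev spaces\<close>

definition test_function :: "(real ^ 'n) set \<Rightarrow> (real ^ 'n \<Rightarrow> real) \<Rightarrow> bool" where
  "test_function \<Omega> \<phi> \<longleftrightarrow> smooth_on UNIV \<phi> \<and> compact (supp \<phi>) \<and> supp \<phi> \<subseteq> \<Omega>"

definition locally_integrable :: "(real ^ 'n) set \<Rightarrow> (real ^ 'n \<Rightarrow> real) \<Rightarrow> bool" where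
  "locally_integrable \<Omega> f \<longleftrightarrow> (\<forall>K. compact K \<and> K \<subseteq> \<Omega> \<longrightarrow> set_integrable lebesgue K f)"

text \<open>\<open>weak_deriv \<Omega> is f g\<close>: on the open set \<open>\<Omega>\<close>, the function \<open>g\<close> is the weak derivative of \<open>f\<close>
  with respect to the coordinates listed in \<open>is\<close>.\<close>

definition weak_deriv ::
  "(real ^ 'n) set \<Rightarrow> 'n list \<Rightarrow> (real ^ 'n \<Rightarrow> real) \<Rightarrow> (real ^ 'n \<Rightarrow> real) \<Rightarrow> bool" where
  "weak_deriv \<Omega> is f g \<longleftrightarrow> locally_integrable \<Omega> f \<and> locally_integrable \<Omega> g \<and>
     (\<forall>\<phi>. test_function \<Omega> \<phi> \<longrightarrow>
        (LINT x:\<Omega>|lebesgue. f x * iter_partial is \<phi> x)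
          = (- 1) ^ length is * (LINT x:\<Omega>|lebesgue. g x * \<phi> x))"

definition ennreal_sqrt :: "ennreal \<Rightarrow> ennreal" where
  "ennreal_sqrt y = (if y = \<infinity> then \<infinity> else ennreal (sqrt (enn2real y)))"

text \<open>The homogeneous Sobolev seminorm \<open>(\<Sum>\<^bsub>|is| = k\<^esub> \<integral>\<^bsub>\<Omega>\<^esub> |D\<^bsub>is\<^esub> f|\<^sup>2)\<^sup>1\<^sup>/\<^sup>2\<close>.
  Weak derivatives are unique almost everywhere, so all admissible families \<open>g\<close> give the same
  value: the infimum only selects that value, and it is \<open>\<infinity>\<close> (the infimum of the empty set)
  if some weak derivative of order \<open>k\<close> does not exist as a locally integrable function.
  For \<open>k = 0\<close> this is the \<open>L\<^sup>2\<close> norm.\<close>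

definition Hdot_norm :: "nat \<Rightarrow> (real ^ 'n) set \<Rightarrow> (real ^ 'n \<Rightarrow> real) \<Rightarrow> ennreal" where
  "Hdot_norm k \<Omega> f =
     Inf {ennreal_sqrt (\<Sum>is\<in>{is. length is = k}. \<integral>\<^sup>+x\<in>\<Omega>. ennreal ((g is x)\<^sup>2) \<partial>lebesgue) | g.
            \<forall>is. length is = k \<longrightarrow> weak_deriv \<Omega> is f (g is)}"

definition Hdot :: "nat \<Rightarrow> (real ^ 'n) set \<Rightarrow> (real ^ 'n \<Rightarrow> real) set" where
  "Hdot k \<Omega> = {f. Hdot_norm k \<Omega> f < \<infinity>}"

definition Hsob :: "nat \<Rightarrow> (real ^ 'n) set \<Rightarrow> (real ^ 'n \<Rightarrow> real) set" where
  "Hsob k \<Omega> = {f. \<forall>j\<le>k. Hdot_norm j \<Omega> f < \<infinity>}"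

section \<open>The profiles and the domains\<close>

text \<open>The interval integral is oriented: for \<open>x < 0\<close> it is minus the integral from \<open>x\<close> to \<open>0\<close>.\<close>

definition chi1 :: "real \<Rightarrow> real \<Rightarrow> real \<Rightarrow> real" where
  "chi1 \<epsilon> \<alpha> x = (LBINT s=0..x. \<epsilon> * \<bar>ln \<bar>s / 4\<bar>\<bar> powr \<alpha>)"

definition chi2 :: "real \<Rightarrow> real \<Rightarrow> real \<Rightarrow> real" where
  "chi2 \<epsilon> \<alpha> x = 2 * (LBINT s=0..x. (deriv (chi1 \<epsilon> \<alpha>) s)\<^sup>2)"

definition B :: "real \<Rightarrow> (real ^ 3) set" where
  "B t = {x. (x $ 1 - 1)\<^sup>2 + (x $ 2)\<^sup>2 + (x $ 3)\<^sup>2 < (1 - t)\<^sup>2}"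

section \<open>The support radius\<close>

text \<open>The point \<open>(2,0,0)\<close> lies on the boundary of both \<open>B 0\<close> and the ball of radius \<open>2\<close> about the
  origin, and \<open>chi1\<close> is bounded away from \<open>0\<close> near \<open>2\<close>. Hence an extension of \<open>chi1\<close>
  supported in that ball is discontinuous at \<open>(2,0,0)\<close>; the support radius has to exceed \<open>2\<close>.\<close>

lemma set_integrable_chi1_integrand:
  fixes \<epsilon> \<alpha> :: real
  assumes "0 < \<alpha>" "\<alpha> < 1/2" "0 \<le> \<epsilon>"
  shows "set_integrable lborel {0<..<2} (\<lambda>s. \<epsilon> * \<bar>ln \<bar>s / 4\<bar>\<bar> powr \<alpha>)"
proof -
  have "((\<lambda>s::real. s powr (-1/2)) has_integral (2 powr (-1/2 + 1) / (-1/2 + 1))) {0..2}"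
    by (rule has_integral_powr_from_0) auto
  then have "(\<lambda>s::real. s powr (-1/2)) absolutely_integrable_on {0..2}"
    by (intro nonnegative_absolutely_integrable_1) (auto simp: integrable_on_def)
  then have "set_integrable lborel {0..2} (\<lambda>s::real. s powr (-1/2))"
    unfolding set_integrable_def by (subst (asm) integrable_completion) auto
  then have i1: "set_integrable lborel {0<..<2} (\<lambda>s::real. s powr (-1/2))"
    by (rule set_integrable_subset) auto
  have i0: "set_integrable lborel {0<..<2::real} (\<lambda>s. 1 :: real)"
    by (simp add: set_integrable_def)
  have i2: "set_integrable lborel {0<..<2} (\<lambda>s::real. \<epsilon> * (1 + 4 * s powr (-1/2)))"
    using i0 i1 by (intro set_integrable_mult_right set_integral_add) auto
  show ?thesis
  proof (rule set_integrable_bound[OF i2])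
    show "set_borel_measurable lborel {0<..<2} (\<lambda>s. \<epsilon> * \<bar>ln \<bar>s / 4\<bar>\<bar> powr \<alpha>)"
      unfolding set_borel_measurable_def by measurable
    have "norm (\<epsilon> * \<bar>ln \<bar>s / 4\<bar>\<bar> powr \<alpha>) \<le> norm (\<epsilon> * (1 + 4 * s powr (-1/2)))"
      if s: "s \<in> {0<..<2}" for s :: real
    proof -
      have s0: "0 < s" "s < 2" using s by auto
      have "ln (sqrt (4 / s)) \<le> sqrt (4 / s)"
        using s0 by (intro order.trans[OF ln_le_minus_one]) auto
      moreover have "ln (sqrt (4 / s)) = ln (4 / s) / 2"
        using s0 by (intro ln_sqrt) auto
      moreover have "sqrt (4 / s) = 2 * s powr (-1/2)"
        using s0 by (simp add: real_sqrt_divide powr_minus_divide powr_half_sqrt)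
      moreover have "ln (4 / s) = - ln \<bar>s / 4\<bar>" "ln (4 / s) > 0"
        using s0 by (auto simp: ln_div)
      ultimately have l: "\<bar>ln \<bar>s / 4\<bar>\<bar> \<le> 4 * s powr (-1/2)" by linarith
      have "\<bar>ln \<bar>s / 4\<bar>\<bar> powr \<alpha> \<le> (1 + \<bar>ln \<bar>s / 4\<bar>\<bar>) powr \<alpha>"
        using assms by (intro powr_mono2) auto
      also have "\<dots> \<le> (1 + \<bar>ln \<bar>s / 4\<bar>\<bar>) powr 1"
        using assms by (intro powr_mono) auto
      also have "\<dots> \<le> 1 + 4 * s powr (-1/2)" using l by simp
      finally show ?thesis
        using assms by (simp add: abs_mult mult_left_mono)
    qed
    then show "AE s in lborel. s \<in> {0<..<2} \<longrightarrow>
        norm (\<epsilon> * \<bar>ln \<bar>s / 4\<bar>\<bar> powr \<alpha>) \<le> norm (\<epsilon> * (1 + 4 * s powr (-1/2)))"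
      by auto
  qed
qed

lemma chi1_lower_bound:
  fixes \<epsilon> \<alpha> x :: real
  assumes "0 < \<alpha>" "\<alpha> < 1/2" "0 < \<epsilon>" "1 \<le> x" "x < 2"
  shows "\<epsilon> * ln 2 powr \<alpha> \<le> chi1 \<epsilon> \<alpha> x"
proof -
  let ?h = "\<lambda>s. \<epsilon> * \<bar>ln \<bar>s / 4\<bar>\<bar> powr \<alpha>"
  have int: "set_integrable lborel {0<..<x} ?h"
    using assms by (intro set_integrable_subset[OF set_integrable_chi1_integrand]) auto
  have "\<epsilon> * ln 2 powr \<alpha> = (LINT s:{0<..<1::real}|lborel. \<epsilon> * ln 2 powr \<alpha>)"
    by (simp add: set_lebesgue_integral_def)
  also have "\<dots> \<le> (LINT s:{0<..<1}|lborel. ?h s)"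
  proof (rule set_integral_mono)
    show "set_integrable lborel {0<..<1::real} (\<lambda>s. \<epsilon> * ln 2 powr \<alpha>)"
      by (simp add: set_integrable_def)
    show "set_integrable lborel {0<..<1} ?h"
      using assms by (intro set_integrable_subset[OF int]) auto
    fix s :: real assume s: "s \<in> {0<..<1}"
    have "ln 2 \<le> ln (4 / s)" using s by (intro ln_mono) (auto simp: field_simps)
    also have "ln (4 / s) = - ln \<bar>s / 4\<bar>" using s by (auto simp: ln_div)
    finally have "ln 2 \<le> \<bar>ln \<bar>s / 4\<bar>\<bar>" by linarith
    then show "\<epsilon> * ln 2 powr \<alpha> \<le> ?h s"
      using assms by (intro mult_left_mono powr_mono2) auto
  qed
  also have "\<dots> \<le> (LINT s:{0<..<x}|lborel. ?h s)"
    unfolding set_lebesgue_integral_def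
  proof (rule integral_mono)
    show "integrable lborel (\<lambda>s. indicator {0<..<1} s *\<^sub>R ?h s)"
      unfolding set_integrable_def[symmetric]
      using assms by (intro set_integrable_subset[OF int]) auto
    show "integrable lborel (\<lambda>s. indicator {0<..<x} s *\<^sub>R ?h s)"
      using int by (simp add: set_integrable_def)
    show "indicator {0<..<1} s *\<^sub>R ?h s \<le> indicator {0<..<x} s *\<^sub>R ?h s" for s
      using assms by (intro scaleR_right_mono) (auto simp: indicator_def)
  qed
  also have "\<dots> = chi1 \<epsilon> \<alpha> x"
    using assms by (simp add: chi1_def interval_lebesgue_integral_def zero_ereal_def)
  finally show ?thesis .
qed

lemma support_radius_2_impossible:
  fixes \<Psi> :: "real ^ 3 \<Rightarrow> real"
  assumes "0 < \<epsilon>" "0 < \<alpha>" "\<alpha> < 1/2"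
    and eq: "\<forall>x\<in>B 0. \<Psi> x = chi1 \<epsilon> \<alpha> (x $ 1)"
    and supp: "supp \<Psi> \<subseteq> cball 0 2"
    and sing: "sing_supp \<Psi> = {0}"
  shows False
proof -
  have "axis 1 2 \<notin> sing_supp \<Psi>" using sing by (simp add: axis_eq_0_iff)
  then obtain U where U: "open U" "smooth_on U \<Psi>" "axis 1 2 \<in> U"
    unfolding sing_supp_def by blast
  have "continuous_on U \<Psi>"
    using U(2) unfolding smooth_on_def by (metis Ck_on.simps(1))
  then have cont: "isCont \<Psi> (axis 1 2)"
    using U by (simp add: continuous_on_eq_continuous_at)
  have ax: "axis 1 c = c *\<^sub>R (axis 1 1 :: real ^ 3)" for c :: real
    by (simp add: axis_def vec_eq_iff)
  define d :: "nat \<Rightarrow> real" where "d n = 1 / real (Suc n)" for n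
  have d: "0 < d n" "d n \<le> 1" for n by (auto simp: d_def)
  have "d \<longlonglongrightarrow> 0"
    unfolding d_def using LIMSEQ_Suc[OF lim_1_over_n] by simp
  note lim0 = this
  have "(\<lambda>n. (2 - d n) *\<^sub>R axis 1 1 :: real ^ 3) \<longlonglongrightarrow> (2 - 0) *\<^sub>R axis 1 1"
    and "(\<lambda>n. (2 + d n) *\<^sub>R axis 1 1 :: real ^ 3) \<longlonglongrightarrow> (2 + 0) *\<^sub>R axis 1 1"
    by (intro tendsto_intros lim0)+
  then have lim: "(\<lambda>n. axis 1 (2 - d n) :: real ^ 3) \<longlonglongrightarrow> axis 1 2"
      "(\<lambda>n. axis 1 (2 + d n) :: real ^ 3) \<longlonglongrightarrow> axis 1 2"
    unfolding ax[symmetric] by (simp_all only: diff_0_right add_0_right)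
  have near: "\<epsilon> * ln 2 powr \<alpha> \<le> \<Psi> (axis 1 (2 - c))" if c: "0 < c" "c \<le> 1" for c :: real
  proof -
    have "c * c \<le> 1 * c" using c by (intro mult_right_mono) auto
    then have "(2 - c - 1)\<^sup>2 < 1" using c by (simp add: power2_eq_square algebra_simps)
    then have "axis 1 (2 - c) \<in> B 0" unfolding B_def by (simp add: axis_def)
    then have "\<Psi> (axis 1 (2 - c)) = chi1 \<epsilon> \<alpha> (2 - c)" using eq by (simp add: axis_def)
    then show ?thesis using chi1_lower_bound[of \<alpha> \<epsilon> "2 - c"] assms c by simp
  qed
  have "\<epsilon> * ln 2 powr \<alpha> \<le> \<Psi> (axis 1 2)"
    by (rule LIMSEQ_le_const[OF isCont_tendsto_compose[OF cont lim(1)]]) (intro exI[of _ 0] allI impI near d)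
  moreover have "\<Psi> (axis 1 (2 + d n)) = 0" for n
  proof (rule ccontr)
    assume "\<Psi> (axis 1 (2 + d n)) \<noteq> 0"
    then have "axis 1 (2 + d n) \<in> supp \<Psi>" unfolding supp_def by (intro closure_subset[THEN subsetD]) simp
    then have "norm (axis 1 (2 + d n) :: real ^ 3) \<le> 2"
      using subsetD[OF supp] by (simp only: mem_cball_0)
    moreover have "norm (axis 1 (2 + d n) :: real ^ 3) = 2 + d n"
      using d(1)[of n] by (subst ax) (simp add: norm_axis_1)
    ultimately show False using d(1)[of n] by linarith
  qed
  then have "\<Psi> (axis 1 2) = 0"
    using isCont_tendsto_compose[OF cont lim(2)] by (simp only: LIMSEQ_const_iff)
  ultimately show False using assms(1) by (simp add: mult_le_0_iff)
qed

end

theory Submission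
  imports Defs
begin

text \<open>For the first extension write \<open>\<chi>\<^sub>1(s) = \<epsilon> s m(s)\<close>, where \<open>m(s)\<close> is the mean of \<open>L\<^sup>\<alpha>\<close> over
  \<open>[0, s]\<close> and \<open>L(s) = log (4 / s)\<close>, and put \<open>\<Psi>\<^sub>1 = \<epsilon> \<eta> x\<^sub>1 m(q)\<close> with a cutoff \<open>\<eta>\<close> and a positive
  function \<open>q\<close>, smooth away from the origin, that equals \<open>x\<^sub>1\<close> on \<open>B 0\<close> and \<open>|x|\<^sup>2 / 2\<close> away from it.
  It is essential to replace \<open>x\<^sub>1\<close> by \<open>q\<close> in the slowly varying factor only: each derivative of
  \<open>m\<close> then gains a power of the logarithm, since \<open>m - L\<^sup>\<alpha>\<close> lies between \<open>0\<close> and \<open>\<alpha> L\<^sup>\<alpha>\<^sup>-\<^sup>1\<close>,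
  and the second derivatives are of size \<open>L\<^sup>\<alpha>\<^sup>-\<^sup>1 / x\<^sub>1\<close> where \<open>|x|\<^sup>2 \<le> 4 x\<^sub>1\<close> and \<open>1 / |x|\<close> elsewhere.
  The slice of that region at height \<open>x\<^sub>1 = s\<close> has area of order \<open>s\<close>, so the square integral is of
  the order of \<open>\<integral> L\<^sup>2\<^sup>\<alpha>\<^sup>-\<^sup>2 ds / s\<close>, which is finite for \<open>\<alpha> < 1/2\<close>. Almost every line in a
  coordinate direction misses the origin, hence the classical derivatives are the weak ones.

  For the second extension a cutoff of \<open>\<chi>\<^sub>2(x\<^sub>1 - t)\<close> suffices. On \<open>B t\<close> its second derivative is
  of size \<open>L\<^sup>2\<^sup>\<alpha>\<^sup>-\<^sup>1 / s\<close> with \<open>s = x\<^sub>1 - t\<close>, and the slices have area of order \<open>s\<close> again, so that the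
  square integral \<open>\<integral> L\<^sup>4\<^sup>\<alpha>\<^sup>-\<^sup>2 ds / s\<close> diverges for \<open>\<alpha> > 1/4\<close>. An arbitrary weak derivative is
  compared with the classical one by testing with bumps on disjoint boxes.\<close>

section \<open>Calculus of smooth functions\<close>

fun Ck1 :: "nat \<Rightarrow> real set \<Rightarrow> (real \<Rightarrow> real) \<Rightarrow> bool" where
  "Ck1 0 V h \<longleftrightarrow> continuous_on V h"
| "Ck1 (Suc k) V h \<longleftrightarrow> (\<exists>h'. (\<forall>s\<in>V. (h has_real_derivative h' s) (at s)) \<and> Ck1 k V h')"

lemma Ck1_continuous_on: "Ck1 k V h \<Longrightarrow> continuous_on V h"
  by (cases k) (auto intro: continuous_at_imp_continuous_on DERIV_isCont)

lemma Ck1_Suc_imp: "Ck1 (Suc k) V h \<Longrightarrow> Ck1 k V h"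
proof (induction k arbitrary: h)
  case 0
  then show ?case using Ck1_continuous_on by (metis Ck1.simps(1))
next
  case (Suc k)
  then obtain h' where "\<forall>s\<in>V. (h has_real_derivative h' s) (at s)" "Ck1 (Suc k) V h'"
    unfolding Ck1.simps(2)[of "Suc k"] by blast
  moreover from this have "Ck1 k V h'" by (intro Suc.IH)
  ultimately show ?case unfolding Ck1.simps(2)[of k] by blast
qed

lemma Ck1_SucI:
  assumes "\<And>s. s \<in> V \<Longrightarrow> (h has_real_derivative h' s) (at s)" "Ck1 k V h'"
  shows "Ck1 (Suc k) V h"
  using assms by auto

lemma Ck1_const: "Ck1 k V (\<lambda>_. c)"
proof (induction k arbitrary: c)
  case (Suc k)
  show ?case by (rule Ck1_SucI[OF DERIV_const Suc.IH])
qed simp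

lemma Ck1_ident: "Ck1 k V (\<lambda>s. s)"
proof (cases k)
  case (Suc j)
  show ?thesis unfolding Suc by (rule Ck1_SucI[OF DERIV_ident Ck1_const])
qed (simp add: continuous_on_id)

lemma Ck1_add: "Ck1 k V f \<Longrightarrow> Ck1 k V g \<Longrightarrow> Ck1 k V (\<lambda>s. f s + g s)"
proof (induction k arbitrary: f g)
  case 0
  then show ?case by (auto intro: continuous_intros)
next
  case (Suc k)
  from Suc.prems obtain f' g' where
    "\<forall>s\<in>V. (f has_real_derivative f' s) (at s)" "Ck1 k V f'"
    "\<forall>s\<in>V. (g has_real_derivative g' s) (at s)" "Ck1 k V g'" by auto
  then show ?case using Suc.IH
    by (intro Ck1_SucI[where h' = "\<lambda>s. f' s + g' s"] DERIV_add) auto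
qed

lemma Ck1_mult: "Ck1 k V f \<Longrightarrow> Ck1 k V g \<Longrightarrow> Ck1 k V (\<lambda>s. f s * g s)"
proof (induction k arbitrary: f g)
  case 0
  then show ?case by (auto intro: continuous_intros)
next
  case (Suc k)
  from Suc.prems obtain f' g' where
    *: "\<forall>s\<in>V. (f has_real_derivative f' s) (at s)" "Ck1 k V f'"
    "\<forall>s\<in>V. (g has_real_derivative g' s) (at s)" "Ck1 k V g'" by auto
  have "Ck1 k V (\<lambda>s. f' s * g s + f s * g' s)"
    using * Ck1_Suc_imp[OF Suc.prems(1)] Ck1_Suc_imp[OF Suc.prems(2)] by (intro Ck1_add Suc.IH)
  with * show ?case
    by (intro Ck1_SucI[where h' = "\<lambda>s. f' s * g s + f s * g' s"])
      (auto intro!: derivative_eq_intros)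
qed

lemma Ck1_diff: "Ck1 k V f \<Longrightarrow> Ck1 k V g \<Longrightarrow> Ck1 k V (\<lambda>s. f s - g s)"
  using Ck1_add[of k V f "\<lambda>s. (-1) * g s"] Ck1_mult[OF Ck1_const, of k V g "-1"] by simp

lemma Ck1_compose:
  "Ck1 k W h \<Longrightarrow> Ck1 k V f \<Longrightarrow> (\<And>s. s \<in> V \<Longrightarrow> f s \<in> W) \<Longrightarrow> Ck1 k V (\<lambda>s. h (f s))"
proof (induction k arbitrary: h f)
  case 0
  then show ?case by (auto intro: continuous_on_compose2)
next
  case (Suc k)
  from Suc.prems obtain h' f' where
    *: "\<forall>s\<in>W. (h has_real_derivative h' s) (at s)" "Ck1 k W h'"
    "\<forall>s\<in>V. (f has_real_derivative f' s) (at s)" "Ck1 k V f'" by auto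
  have "Ck1 k V (\<lambda>s. h' (f s) * f' s)"
    by (rule Ck1_mult[OF Suc.IH[OF *(2) Ck1_Suc_imp[OF Suc.prems(2)] Suc.prems(3)] *(4)])
  with * Suc.prems(3) show ?case
    by (intro Ck1_SucI[where h' = "\<lambda>s. h' (f s) * f' s"] DERIV_chain2) auto
qed

lemma Ck1_exp: "Ck1 k V exp"
  by (induction k) (auto intro!: Ck1_SucI[where h = exp and h' = exp] continuous_on_exp continuous_on_id simp del: Ck1.simps(2))

lemma Ck1_inverse: "0 \<notin> V \<Longrightarrow> Ck1 k V inverse"
proof (induction k)
  case 0
  then show ?case by (auto intro!: continuous_intros)
next
  case (Suc k)
  have "Ck1 k V (\<lambda>s. (-1) * (inverse s * inverse s))"
    using Suc by (intro Ck1_mult Ck1_const) auto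
  with Suc.prems show ?case
    by (intro Ck1_SucI[where h' = "\<lambda>s. (-1) * (inverse s * inverse s)"])
      (auto intro!: derivative_eq_intros)
qed

lemma Ck1_divide:
  assumes "Ck1 k V f" "Ck1 k V g" "\<And>s. s \<in> V \<Longrightarrow> g s \<noteq> 0"
  shows "Ck1 k V (\<lambda>s. f s / g s)"
  unfolding divide_inverse using assms(3)
  by (intro Ck1_mult[OF assms(1) Ck1_compose[OF Ck1_inverse assms(2), of "-{0}"]]) auto

lemma Ck1_ln: "V \<subseteq> {0<..} \<Longrightarrow> Ck1 k V ln"
proof (cases k)
  case (Suc j)
  assume V: "V \<subseteq> {0<..}"
  have "Ck1 j V inverse" using V by (intro Ck1_inverse) auto
  then show ?thesis using V Suc
    by (auto intro!: Ck1_SucI[where h' = inverse] DERIV_ln simp del: Ck1.simps(2))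
next
  case 0
  moreover assume "V \<subseteq> {0<..}"
  ultimately show ?thesis
    by (auto intro!: continuous_at_imp_continuous_on DERIV_isCont[OF DERIV_ln])
qed

lemma Ck1_cong:
  assumes "open V" "\<And>s. s \<in> V \<Longrightarrow> f s = g s" "Ck1 k V f"
  shows "Ck1 k V g"
proof (cases k)
  case 0
  then show ?thesis using assms by (auto cong: continuous_on_cong)
next
  case (Suc j)
  then obtain f' where f': "\<forall>s\<in>V. (f has_real_derivative f' s) (at s)" "Ck1 j V f'"
    using assms by auto
  have "(g has_real_derivative f' s) (at s)" if "s \<in> V" for s
    using f'(1) that assms(1,2)
    by (intro has_field_derivative_transform_within_open[of f "f' s" s V g]) auto
  with f' Suc show ?thesis by auto
qed


lemma Ck1_powr:
  assumes "Ck1 k V f" "\<And>s. s \<in> V \<Longrightarrow> f s > 0" "open V"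
  shows "Ck1 k V (\<lambda>s. f s powr a)"
proof -
  have "Ck1 k V (\<lambda>s. exp (a * ln (f s)))"
    using assms(2)
    by (intro Ck1_compose[OF Ck1_exp[of _ UNIV]] Ck1_mult[OF Ck1_const Ck1_compose[OF Ck1_ln[OF order_refl] assms(1)]]) auto
  moreover have "exp (a * ln (f s)) = f s powr a" if "s \<in> V" for s
    using assms(2)[OF that] by (simp add: powr_def)
  ultimately show ?thesis
    using Ck1_cong[OF assms(3), of "\<lambda>s. exp (a * ln (f s))" "\<lambda>s. f s powr a" k] by simp
qed

lemma partial_eqI:
  assumes "(f has_derivative D) (at x)"
  shows "partial i f x = D (axis i 1)"
  using frechet_derivative_at[OF assms] by (simp add: partial_def)

lemma partial_cong_open:
  assumes "open U" "x \<in> U" "\<And>y. y \<in> U \<Longrightarrow> f y = g y"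
  shows "partial i f x = partial i g x"
proof -
  have "(f has_derivative D) (at x) \<longleftrightarrow> (g has_derivative D) (at x)" for D
    using assms has_derivative_transform_within_open[of f D x UNIV U g]
      has_derivative_transform_within_open[of g D x UNIV U f] by auto
  then show ?thesis by (simp add: partial_def frechet_derivative_def)
qed

lemma differentiable_cong_open:
  assumes "open U" "x \<in> U" "\<And>y. y \<in> U \<Longrightarrow> f y = g y" "f differentiable (at x)"
  shows "g differentiable (at x)"
  using assms has_derivative_transform_within_open[of f _ x UNIV U g]
  unfolding differentiable_def by blast

lemma Ck_on_cong:
  assumes "open U" "\<And>y. y \<in> U \<Longrightarrow> f y = g y" "Ck_on k U f"
  shows "Ck_on k U g"
  using assms(2,3)
proof (induction k arbitrary: f g)
  case 0
  then show ?case by (auto cong: continuous_on_cong)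
next
  case (Suc k)
  have "Ck_on k U (partial i g)" for i
  proof (rule Suc.IH[of "partial i f"])
    show "partial i f y = partial i g y" if "y \<in> U" for y
      by (rule partial_cong_open[OF assms(1) that Suc.prems(1)])
  qed (use Suc.prems in auto)
  moreover have "g differentiable (at x)" if "x \<in> U" for x
    using Suc.prems that by (intro differentiable_cong_open[OF assms(1) that Suc.prems(1)]) auto
  ultimately show ?case by simp
qed

lemma Ck_on_continuous_on: "Ck_on k U f \<Longrightarrow> continuous_on U f"
  by (cases k) (auto intro!: continuous_at_imp_continuous_on differentiable_imp_continuous_within)

lemma Ck_on_Suc_imp: "Ck_on (Suc k) U f \<Longrightarrow> Ck_on k U f"
proof (induction k arbitrary: f)
  case 0
  then show ?case using Ck_on_continuous_on by (metis Ck_on.simps(1))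
next
  case (Suc k)
  then have "Ck_on (Suc k) U (partial i f)" for i
    unfolding Ck_on.simps(2)[of "Suc k" U f] by blast
  with Suc.IH Suc.prems show ?case by simp
qed

lemma Ck_on_subset: "Ck_on k U f \<Longrightarrow> V \<subseteq> U \<Longrightarrow> Ck_on k V f"
  by (induction k arbitrary: f) (auto elim: continuous_on_subset)

lemma Ck_on_Un:
  "Ck_on k U f \<Longrightarrow> Ck_on k V f \<Longrightarrow> open U \<Longrightarrow> open V \<Longrightarrow> Ck_on k (U \<union> V) f"
  by (induction k arbitrary: f) (simp_all add: continuous_on_open_Un ball_Un)

lemma partial_add:
  "f differentiable (at x) \<Longrightarrow> g differentiable (at x) \<Longrightarrow>
    partial i (\<lambda>x. f x + g x) x = partial i f x + partial i g x"
  unfolding partial_def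
  by (subst frechet_derivative_at[symmetric, OF has_derivative_add])
     (auto simp: frechet_derivative_works)

lemma partial_mult:
  "f differentiable (at x) \<Longrightarrow> g differentiable (at x) \<Longrightarrow>
    partial i (\<lambda>x. f x * g x) x = partial i f x * g x + f x * partial i g x"
  unfolding partial_def
  by (subst frechet_derivative_at[symmetric, OF has_derivative_mult])
     (auto simp: frechet_derivative_works)

lemma partial_const: "partial i (\<lambda>_. c) = (\<lambda>_. 0)"
  by (rule ext) (subst partial_eqI[OF has_derivative_const], simp)

lemma differentiable_component: "(\<lambda>x :: real ^ 'n. x $ j) differentiable (at x)"
  by (intro linear_imp_differentiable bounded_linear.linear bounded_linear_vec_nth)

lemma partial_component: "partial i (\<lambda>x. x $ j) = (\<lambda>_. if i = j then 1 else 0)"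
  by (rule ext) (subst partial_eqI[OF bounded_linear_imp_has_derivative[OF bounded_linear_vec_nth]], simp add: axis_def)

lemma has_derivative_compose_real:
  assumes "(h has_real_derivative d) (at (f x))" "f differentiable (at x)"
  shows "((\<lambda>x. h (f x)) has_derivative (\<lambda>v. d * frechet_derivative f (at x) v)) (at x)"
  using has_derivative_compose[of f _ x UNIV h "(*) d"] assms
  by (auto simp: has_field_derivative_def frechet_derivative_works)

lemma partial_compose:
  assumes "(h has_real_derivative d) (at (f x))" "f differentiable (at x)"
  shows "partial i (\<lambda>x. h (f x)) x = d * partial i f x"
  by (subst partial_eqI[OF has_derivative_compose_real[OF assms]]) (simp add: partial_def)

lemma differentiable_compose_real:
  assumes "(h has_real_derivative d) (at (f x))" "f differentiable (at x)"
  shows "(\<lambda>x. h (f x)) differentiable (at x)"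
  using has_derivative_compose_real[OF assms] by (auto simp: differentiable_def)

lemma Ck_on_const: "Ck_on k U (\<lambda>_. c)"
  by (induction k arbitrary: c) (auto simp: partial_const)

lemma Ck_on_component: "Ck_on k U (\<lambda>x. x $ j)"
  by (cases k) (auto simp: partial_component differentiable_component Ck_on_const intro!: continuous_on_component)

lemma Ck_on_add: "open U \<Longrightarrow> Ck_on k U f \<Longrightarrow> Ck_on k U g \<Longrightarrow> Ck_on k U (\<lambda>x. f x + g x)"
proof (induction k arbitrary: f g)
  case 0
  then show ?case by (simp add: continuous_on_add)
next
  case (Suc k)
  have "Ck_on k U (partial i (\<lambda>x. f x + g x))" for i
    by (rule Ck_on_cong[OF Suc.prems(1) _ Suc.IH[OF Suc.prems(1), of "partial i f" "partial i g"]])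
      (use Suc.prems in \<open>simp_all add: partial_add\<close>)
  then show ?case using Suc.prems by (simp add: differentiable_add)
qed

lemma Ck_on_mult: "open U \<Longrightarrow> Ck_on k U f \<Longrightarrow> Ck_on k U g \<Longrightarrow> Ck_on k U (\<lambda>x. f x * g x)"
proof (induction k arbitrary: f g)
  case 0
  then show ?case by (simp add: continuous_on_mult)
next
  case (Suc k)
  have p: "Ck_on k U (\<lambda>x. partial i f x * g x + f x * partial i g x)" for i
    using Suc.prems(2,3)
    by (intro Ck_on_add[OF Suc.prems(1) Suc.IH[OF Suc.prems(1) _ Ck_on_Suc_imp[OF Suc.prems(3)]]
          Suc.IH[OF Suc.prems(1) Ck_on_Suc_imp[OF Suc.prems(2)]]]) simp_all
  have "Ck_on k U (partial i (\<lambda>x. f x * g x))" for i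
    by (rule Ck_on_cong[OF Suc.prems(1), of "\<lambda>x. partial i f x * g x + f x * partial i g x"])
      (use Suc.prems p in \<open>simp_all add: partial_mult\<close>)
  then show ?case using Suc.prems by (simp add: differentiable_mult)
qed

lemma Ck_on_compose:
  "open U \<Longrightarrow> Ck1 k W h \<Longrightarrow> Ck_on k U f \<Longrightarrow> (\<And>x. x \<in> U \<Longrightarrow> f x \<in> W) \<Longrightarrow> Ck_on k U (\<lambda>x. h (f x))"
proof (induction k arbitrary: h f)
  case 0
  then show ?case by (auto intro: continuous_on_compose2)
next
  case (Suc k)
  from Suc.prems obtain h' where
    *: "\<forall>s\<in>W. (h has_real_derivative h' s) (at s)" "Ck1 k W h'" by auto
  have "Ck_on k U (\<lambda>x. h' (f x) * partial i f x)" for i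
  proof (rule Ck_on_mult)
    show "Ck_on k U (\<lambda>x. h' (f x))"
      by (rule Suc.IH[OF Suc.prems(1) *(2) Ck_on_Suc_imp[OF Suc.prems(3)] Suc.prems(4)])
  qed (use Suc.prems in auto)
  moreover have "h' (f x) * partial i f x = partial i (\<lambda>x. h (f x)) x" if "x \<in> U" for x i
    using Suc.prems * that by (intro partial_compose[symmetric]) auto
  ultimately have "Ck_on k U (partial i (\<lambda>x. h (f x)))" for i
    using Ck_on_cong[OF Suc.prems(1), of "\<lambda>x. h' (f x) * partial i f x" "partial i (\<lambda>x. h (f x))" k]
    by simp
  moreover have "(\<lambda>x. h (f x)) differentiable (at x)" if "x \<in> U" for x
    using Suc.prems * that by (intro differentiable_compose_real[of h "h' (f x)"]) auto
  ultimately show ?case by simp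
qed

lemma smooth_onD: "smooth_on U f \<Longrightarrow> Ck_on k U f"
  by (simp add: smooth_on_def)

lemma smooth_on_continuous_on: "smooth_on U f \<Longrightarrow> continuous_on U f"
  using Ck_on_continuous_on smooth_onD by blast

lemma smooth_on_differentiable: "smooth_on U f \<Longrightarrow> x \<in> U \<Longrightarrow> f differentiable (at x)"
  using smooth_onD[of U f 1] by simp

lemma smooth_on_partial: "smooth_on U f \<Longrightarrow> smooth_on U (partial i f)"
  by (metis smooth_on_def Ck_on.simps(2))

lemma smooth_on_cong:
  "smooth_on U f \<Longrightarrow> open U \<Longrightarrow> (\<And>y. y \<in> U \<Longrightarrow> f y = g y) \<Longrightarrow> smooth_on U g"
  using Ck_on_cong[of U f g] by (simp add: smooth_on_def)

lemma smooth_on_subset: "smooth_on U f \<Longrightarrow> V \<subseteq> U \<Longrightarrow> smooth_on V f"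
  using Ck_on_subset[of _ U f V] by (simp add: smooth_on_def)

lemma smooth_on_Un:
  "smooth_on U f \<Longrightarrow> smooth_on V f \<Longrightarrow> open U \<Longrightarrow> open V \<Longrightarrow> smooth_on (U \<union> V) f"
  using Ck_on_Un[of _ U f V] by (simp add: smooth_on_def)

lemma smooth_on_const: "smooth_on U (\<lambda>_. c)"
  by (simp add: smooth_on_def Ck_on_const)

lemma smooth_on_component: "smooth_on U (\<lambda>x. x $ j)"
  by (simp add: smooth_on_def Ck_on_component)

lemma smooth_on_add:
  "smooth_on U f \<Longrightarrow> smooth_on U g \<Longrightarrow> open U \<Longrightarrow> smooth_on U (\<lambda>x. f x + g x)"
  by (simp add: smooth_on_def Ck_on_add)

lemma smooth_on_mult:
  "smooth_on U f \<Longrightarrow> smooth_on U g \<Longrightarrow> open U \<Longrightarrow> smooth_on U (\<lambda>x. f x * g x)"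
  by (simp add: smooth_on_def Ck_on_mult)

lemma smooth_on_diff:
  "smooth_on U f \<Longrightarrow> smooth_on U g \<Longrightarrow> open U \<Longrightarrow> smooth_on U (\<lambda>x. f x - g x)"
  using smooth_on_add[of U f "\<lambda>x. (-1) * g x"] smooth_on_mult[OF smooth_on_const, of U g "-1"]
  by simp

lemma smooth_on_compose:
  "(\<And>k. Ck1 k W h) \<Longrightarrow> smooth_on U f \<Longrightarrow> (\<And>x. x \<in> U \<Longrightarrow> f x \<in> W) \<Longrightarrow> open U \<Longrightarrow>
    smooth_on U (\<lambda>x. h (f x))"
  using Ck_on_compose[of U _ W h f] by (simp add: smooth_on_def)

lemma smooth_on_sum:
  assumes "\<And>i. i \<in> I \<Longrightarrow> smooth_on U (f i)" "open U"
  shows "smooth_on U (\<lambda>x. \<Sum>i\<in>I. f i x)"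
proof (cases "finite I")
  case True
  then show ?thesis using assms
    by (induction I rule: finite_induct) (auto intro!: smooth_on_add smooth_on_const)
qed (simp add: smooth_on_const)

lemma smooth_on_power2_norm:
  fixes U :: "(real ^ 'n) set"
  assumes "open U"
  shows "smooth_on U (\<lambda>x. (norm x)\<^sup>2)"
proof -
  have "(norm x)\<^sup>2 = (\<Sum>i\<in>UNIV. x $ i * x $ i)" for x :: "real ^ 'n"
    by (simp add: power2_norm_eq_inner inner_vec_def)
  then show ?thesis
    using assms by (auto intro!: smooth_on_sum smooth_on_mult smooth_on_component)
qed

section \<open>A smooth step\<close>

definition flat_exp :: "real poly \<Rightarrow> real \<Rightarrow> real" where
  "flat_exp p s = (if 0 < s then poly p (inverse s) * exp (- inverse s) else 0)"

lemma poly_div_exp_tendsto_0: "((\<lambda>y::real. poly p y * exp (- y)) \<longlongrightarrow> 0) at_top"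
proof (induction p)
  case (pCons a p)
  have *: "((\<lambda>y::real. y ^ k * exp (- y)) \<longlongrightarrow> 0) at_top" for k
    using tendsto_power_div_exp_0[of k] by (simp add: exp_minus field_simps)
  have "((\<lambda>y::real. \<Sum>i\<le>degree (pCons a p). coeff (pCons a p) i * (y ^ i * exp (- y))) \<longlongrightarrow>
     (\<Sum>i\<le>degree (pCons a p). coeff (pCons a p) i * 0)) at_top"
    by (intro tendsto_intros *)
  then show ?case
    by (simp add: poly_altdef sum_distrib_right mult.assoc)
qed simp

lemma flat_exp_has_derivative:
  "(flat_exp p has_real_derivative flat_exp (monom 1 2 * (p - pderiv p)) s) (at s)"
proof -
  consider "s > 0" | "s < 0" | "s = 0" by linarith
  then show ?thesis
  proof cases
    case 1
    have "((\<lambda>s. poly p (inverse s) * exp (- inverse s)) has_real_derivative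
        flat_exp (monom 1 2 * (p - pderiv p)) s) (at s)"
      using 1 by (auto intro!: derivative_eq_intros DERIV_chain2[OF poly_DERIV]
          simp: flat_exp_def poly_monom power2_eq_square algebra_simps)
    then show ?thesis
      by (rule has_field_derivative_transform_within_open[of _ _ _ "{0<..}"])
        (use 1 in \<open>auto simp: flat_exp_def\<close>)
  next
    case 2
    have "((\<lambda>s. 0) has_real_derivative flat_exp (monom 1 2 * (p - pderiv p)) s) (at s)"
      using 2 by (simp add: flat_exp_def)
    then show ?thesis
      by (rule has_field_derivative_transform_within_open[of _ _ _ "{..<0}"])
        (use 2 in \<open>auto simp: flat_exp_def\<close>)
  next
    case 3
    have "((\<lambda>y::real. poly (pCons 0 p) y * exp (- y)) \<longlongrightarrow> 0) at_top"
      by (rule poly_div_exp_tendsto_0)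
    then have "((\<lambda>h. poly (pCons 0 p) (inverse h) * exp (- inverse h)) \<longlongrightarrow> 0) (at_right 0)"
      by (rule filterlim_compose[OF _ filterlim_inverse_at_top_right])
    then have r: "((\<lambda>h. flat_exp p h / h) \<longlongrightarrow> 0) (at_right 0)"
      by (rule Lim_transform_eventually)
        (auto simp: flat_exp_def eventually_at_filter field_simps)
    have l: "((\<lambda>h. flat_exp p h / h) \<longlongrightarrow> 0) (at_left 0)"
      by (rule Lim_transform_eventually[OF tendsto_const])
        (auto simp: flat_exp_def eventually_at_filter)
    from l r have "((\<lambda>h. flat_exp p h / h) \<longlongrightarrow> 0) (at 0)"
      using filterlim_split_at by blast
    then show ?thesis using 3 by (simp add: DERIV_def flat_exp_def)
  qed
qed

lemma Ck1_flat_exp: "Ck1 k V (flat_exp p)"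
proof (induction k arbitrary: p)
  case 0
  then show ?case
    using flat_exp_has_derivative[of p]
    by (auto intro!: continuous_at_imp_continuous_on DERIV_isCont)
next
  case (Suc k)
  then show ?case using flat_exp_has_derivative[of p] by auto
qed

definition smooth_step :: "real \<Rightarrow> real" where
  "smooth_step s = flat_exp 1 s / (flat_exp 1 s + flat_exp 1 (1 - s))"

lemma smooth_step_denominator_pos: "flat_exp 1 s + flat_exp 1 (1 - s) > 0"
  by (auto simp: flat_exp_def add_pos_nonneg add_nonneg_pos)

lemma smooth_step_eq_0: "s \<le> 0 \<Longrightarrow> smooth_step s = 0"
  by (simp add: smooth_step_def flat_exp_def)

lemma smooth_step_eq_1: "1 \<le> s \<Longrightarrow> smooth_step s = 1"
  by (simp add: smooth_step_def flat_exp_def)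

lemma smooth_step_bounds: "0 \<le> smooth_step s" "smooth_step s \<le> 1"
  using smooth_step_denominator_pos[of s]
  by (auto simp: smooth_step_def flat_exp_def divide_simps)

lemma Ck1_smooth_step: "Ck1 k V smooth_step"
proof -
  have "smooth_step = (\<lambda>s. flat_exp 1 s / (flat_exp 1 s + flat_exp 1 (1 - s)))"
    by (auto simp: smooth_step_def)
  moreover have "flat_exp 1 s + flat_exp 1 (1 - s) \<noteq> 0" for s
    using smooth_step_denominator_pos[of s] by linarith
  moreover have "Ck1 k V (\<lambda>s. flat_exp 1 (1 - s))"
    by (rule Ck1_compose[OF Ck1_flat_exp[of _ UNIV] Ck1_diff[OF Ck1_const Ck1_ident]]) simp
  ultimately show ?thesis
    using Ck1_divide[OF Ck1_flat_exp Ck1_add[OF Ck1_flat_exp], of k V "\<lambda>s. flat_exp 1 (1 - s)" 1 1] by simp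
qed

lemma smooth_step_derivatives:
  obtains d1 d2 M where
    "\<And>s. (smooth_step has_real_derivative d1 s) (at s)"
    "\<And>s. (d1 has_real_derivative d2 s) (at s)"
    "\<And>s. \<bar>d1 s\<bar> \<le> M" "\<And>s. \<bar>d2 s\<bar> \<le> M" "1 \<le> M"
proof -
  have "Ck1 (Suc (Suc 0)) UNIV smooth_step" by (rule Ck1_smooth_step)
  then obtain d1 d2 where d: "\<And>s. (smooth_step has_real_derivative d1 s) (at s)"
      "\<And>s. (d1 has_real_derivative d2 s) (at s)" "continuous_on UNIV d2" by auto
  have z: "d1 s = 0" "d2 s = 0" if "s \<notin> {0..1}" for s
  proof -
    define c :: real where "c = (if s < 0 then 0 else 1)"
    have c: "smooth_step y = c" if "y \<in> (if s < 0 then {..<0} else {1<..})" for y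
      using that \<open>s \<notin> {0..1}\<close> by (auto simp: c_def smooth_step_eq_0 smooth_step_eq_1 split: if_splits)
    have d10: "d1 y = 0" if "y \<in> (if s < 0 then {..<0} else {1<..})" for y
    proof -
      have "(smooth_step has_real_derivative 0) (at y)"
        by (rule has_field_derivative_transform_within_open[of "\<lambda>_. c" _ _ "if s < 0 then {..<0} else {1<..}"])
          (use that c in auto)
      then show ?thesis using d(1) DERIV_unique by blast
    qed
    have "(d1 has_real_derivative 0) (at s)"
      by (rule has_field_derivative_transform_within_open[of "\<lambda>_. 0" _ _ "if s < 0 then {..<0} else {1<..}"])
        (use that d10 in auto)
    then show "d2 s = 0" using d(2) DERIV_unique by blast
    show "d1 s = 0" using that by (intro d10) auto
  qed
  have "continuous_on {0..1} d1" "continuous_on {0..1} d2"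
    using d(2,3) by (auto intro: continuous_on_subset continuous_at_imp_continuous_on DERIV_isCont)
  then have "bounded (d1 ` {0..1})" "bounded (d2 ` {0..1})"
    by (auto intro!: compact_imp_bounded compact_continuous_image)
  then obtain M1 M2 where M: "\<And>s. s \<in> {0..1} \<Longrightarrow> \<bar>d1 s\<bar> \<le> M1" "\<And>s. s \<in> {0..1} \<Longrightarrow> \<bar>d2 s\<bar> \<le> M2"
    unfolding bounded_iff by (metis image_eqI real_norm_def)
  define M where "M = max 1 (max M1 M2)"
  show ?thesis
  proof (rule that[OF d(1,2)])
    show "\<bar>d1 s\<bar> \<le> M" for s
      using z(1)[of s] M(1)[of s] unfolding M_def by (cases "s \<in> {0..1}") auto
    show "\<bar>d2 s\<bar> \<le> M" for s
      using z(2)[of s] M(2)[of s] unfolding M_def by (cases "s \<in> {0..1}") auto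
  qed (simp add: M_def)
qed

section \<open>Integration by parts and weak derivatives\<close>

lemma integral_translation:
  fixes G :: "'a::euclidean_space \<Rightarrow> real"
  assumes "G \<in> borel_measurable borel"
  shows "(\<integral>x. G (x + c) \<partial>lborel) = (\<integral>x. G x \<partial>lborel)"
    and "integrable lborel (\<lambda>x. G (x + c)) \<longleftrightarrow> integrable lborel G"
proof -
  have "(\<integral>x. G x \<partial>distr lborel borel ((+) c)) = (\<integral>x. G (c + x) \<partial>lborel)"
    by (rule integral_distr) (use assms in auto)
  then show "(\<integral>x. G (x + c) \<partial>lborel) = (\<integral>x. G x \<partial>lborel)"
    by (simp add: lborel_distr_plus add.commute)
  have "integrable (distr lborel borel ((+) c)) G \<longleftrightarrow> integrable lborel (\<lambda>x. G (c + x))"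
    by (rule integrable_distr_eq) (use assms in auto)
  then show "integrable lborel (\<lambda>x. G (x + c)) \<longleftrightarrow> integrable lborel G"
    by (simp add: lborel_distr_plus add.commute)
qed

text \<open>Integrating \<open>F (x + v) - F x = \<integral>\<^sub>0\<^sup>1 G (x + s v) ds\<close> over \<open>x\<close> and using translation
  invariance on both sides replaces Fubini's theorem in coordinates.\<close>

lemma integral_directional_derivative_eq_0:
  fixes F G :: "'a::euclidean_space \<Rightarrow> real"
  assumes F: "integrable lborel F" and G: "integrable lborel G"
    and FTC: "AE x in lborel. ((\<lambda>s. G (x + s *\<^sub>R v)) has_integral (F (x + v) - F x)) {0..1}"
  shows "(\<integral>x. G x \<partial>lborel) = 0"
proof -
  define H where "H x s = indicator {0..1} s * G (x + s *\<^sub>R v)" for x :: 'a and s :: real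
  have Fm[measurable]: "F \<in> borel_measurable borel" using F by simp
  have Gm[measurable]: "G \<in> borel_measurable borel" using G by simp
  have Hm[measurable]: "(\<lambda>(s, x). H x s) \<in> borel_measurable (lborel \<Otimes>\<^sub>M lborel)"
    unfolding H_def by measurable
  have "integrable (lborel \<Otimes>\<^sub>M lborel) (\<lambda>(s, x). H x s)"
  proof (rule lborel_pair.Fubini_integrable)
    have "(\<integral>x. norm (H x s) \<partial>lborel) = indicator {0..1} s * (\<integral>x. \<bar>G x\<bar> \<partial>lborel)" for s
      using integral_translation(1)[of "\<lambda>x. \<bar>G x\<bar>" "s *\<^sub>R v"]
      by (simp add: H_def abs_mult)
    then show "integrable lborel (\<lambda>s. \<integral>x. norm (case (s, x) of (s, x) \<Rightarrow> H x s) \<partial>lborel)"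
      by simp
    show "AE s in lborel. integrable lborel (\<lambda>x. case (s, x) of (s, x) \<Rightarrow> H x s)"
      using G by (simp add: H_def integral_translation(2))
  qed (rule Hm)
  then have Hint: "integrable (lborel \<Otimes>\<^sub>M lborel) (case_prod H)"
    using lborel_pair.integrable_product_swap[of "\<lambda>(s, x). H x s"] by (simp add: case_prod_unfold)
  have "AE x in lborel. (\<integral>s. H x s \<partial>lborel) = F (x + v) - F x"
    using FTC lborel_pair.AE_integrable_fst'[OF Hint]
  proof eventually_elim
    case (elim x)
    then have "(H x has_integral (\<integral>s. H x s \<partial>lborel)) UNIV"
      by (intro has_integral_integral_lborel) simp
    moreover have "H x = (\<lambda>s. if s \<in> {0..1} then G (x + s *\<^sub>R v) else 0)"
      by (auto simp: H_def)
    ultimately have "((\<lambda>s. G (x + s *\<^sub>R v)) has_integral (\<integral>s. H x s \<partial>lborel)) {0..1}"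
      by (metis has_integral_restrict_UNIV)
    with elim(1) show ?case using has_integral_unique by blast
  qed
  moreover have "(\<lambda>x. \<integral>s. H x s \<partial>lborel) \<in> borel_measurable lborel"
    using lborel_pair.integrable_fst'[OF Hint] by simp
  ultimately have "(\<integral>x. (\<integral>s. H x s \<partial>lborel) \<partial>lborel) = (\<integral>x. F (x + v) - F x \<partial>lborel)"
    by (intro integral_cong_AE) auto
  also have "\<dots> = 0"
    using F by (subst Bochner_Integration.integral_diff) (auto simp: integral_translation)
  finally have "(\<integral>s. (\<integral>x. H x s \<partial>lborel) \<partial>lborel) = 0"
    using lborel_pair.Fubini_integral[OF Hint] by simp
  moreover have "(\<integral>x. H x s \<partial>lborel) = indicator {0..1} s * (\<integral>x. G x \<partial>lborel)" for s
    by (simp add: H_def integral_translation)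
  ultimately show ?thesis by simp
qed

lemma line_derivative:
  assumes "f differentiable (at (x + s *\<^sub>R axis i 1))"
  shows "((\<lambda>s. f (x + s *\<^sub>R axis i 1)) has_real_derivative partial i f (x + s *\<^sub>R axis i 1)) (at s)"
proof -
  let ?D = "frechet_derivative f (at (x + s *\<^sub>R axis i 1))"
  have D: "(f has_derivative ?D) (at (x + s *\<^sub>R axis i 1))"
    using assms frechet_derivative_works by blast
  then interpret D: bounded_linear ?D by (rule has_derivative_bounded_linear)
  have "((\<lambda>s. x + s *\<^sub>R axis i 1) has_derivative (\<lambda>h. h *\<^sub>R axis i 1)) (at s)"
    by (auto intro!: derivative_eq_intros)
  note has_derivative_compose[OF this D]
  moreover have "(\<lambda>h. ?D (h *\<^sub>R axis i 1)) = (*) (partial i f (x + s *\<^sub>R axis i 1))"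
    by (auto simp: fun_eq_iff D.scaleR partial_def)
  ultimately show ?thesis by (simp add: has_field_derivative_def)
qed

definition line_derivative_ae ::
  "'n \<Rightarrow> (real ^ 'n \<Rightarrow> real) \<Rightarrow> (real ^ 'n \<Rightarrow> real) \<Rightarrow> bool" where
  "line_derivative_ae i f g \<longleftrightarrow> (AE x in lborel. \<exists>S. finite S \<and>
     continuous_on UNIV (\<lambda>s. f (x + s *\<^sub>R axis i 1)) \<and>
     (\<forall>s. s \<notin> S \<longrightarrow>
        ((\<lambda>s. f (x + s *\<^sub>R axis i 1)) has_real_derivative g (x + s *\<^sub>R axis i 1)) (at s)))"

lemma integral_line_derivative_eq_0:
  fixes F G :: "real ^ 'n \<Rightarrow> real"
  assumes "integrable lborel F" "integrable lborel G" "line_derivative_ae i F G"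
  shows "(\<integral>x. G x \<partial>lborel) = 0"
proof (rule integral_directional_derivative_eq_0[OF assms(1,2)])
  show "AE x in lborel. ((\<lambda>s. G (x + s *\<^sub>R axis i 1)) has_integral
      (F (x + axis i 1) - F x)) {0..1}"
    using assms(3) unfolding line_derivative_ae_def
  proof eventually_elim
    case (elim x)
    then obtain S where S: "finite S" "continuous_on UNIV (\<lambda>s. F (x + s *\<^sub>R axis i 1))"
      "\<And>s. s \<notin> S \<Longrightarrow>
        ((\<lambda>s. F (x + s *\<^sub>R axis i 1)) has_real_derivative G (x + s *\<^sub>R axis i 1)) (at s)"
      by blast
    have "((\<lambda>s. G (x + s *\<^sub>R axis i 1)) has_integral
       (F (x + 1 *\<^sub>R axis i 1) - F (x + 0 *\<^sub>R axis i 1))) {0..1}"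
      using S by (intro fundamental_theorem_of_calculus_interior_strong[OF S(1)])
        (auto simp: has_real_derivative_iff_has_vector_derivative[symmetric]
          intro: continuous_on_subset)
    then show ?case by simp
  qed
qed

lemma line_derivative_ae_mult:
  assumes "line_derivative_ae i f g" "smooth_on UNIV \<phi>"
  shows "line_derivative_ae i (\<lambda>x. f x * \<phi> x) (\<lambda>x. g x * \<phi> x + f x * partial i \<phi> x)"
  using assms(1) unfolding line_derivative_ae_def
proof eventually_elim
  case (elim x)
  then obtain S where S: "finite S" "continuous_on UNIV (\<lambda>s. f (x + s *\<^sub>R axis i 1))"
    "\<And>s. s \<notin> S \<Longrightarrow>
      ((\<lambda>s. f (x + s *\<^sub>R axis i 1)) has_real_derivative g (x + s *\<^sub>R axis i 1)) (at s)"
    by blast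
  have d: "((\<lambda>s. \<phi> (x + s *\<^sub>R axis i 1)) has_real_derivative partial i \<phi> (x + s *\<^sub>R axis i 1)) (at s)" for s
    by (rule line_derivative[OF smooth_on_differentiable[OF assms(2) UNIV_I]])
  then have "continuous_on UNIV (\<lambda>s. \<phi> (x + s *\<^sub>R axis i 1))"
    by (meson DERIV_isCont continuous_at_imp_continuous_on)
  moreover have "((\<lambda>s. f (x + s *\<^sub>R axis i 1) * \<phi> (x + s *\<^sub>R axis i 1)) has_real_derivative
      (g (x + s *\<^sub>R axis i 1) * \<phi> (x + s *\<^sub>R axis i 1) +
       f (x + s *\<^sub>R axis i 1) * partial i \<phi> (x + s *\<^sub>R axis i 1))) (at s)" if "s \<notin> S" for s
    using DERIV_mult[OF S(3)[OF that] d[of s]] by (simp add: algebra_simps)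
  ultimately show ?case
    using S(1,2) by (intro exI[of _ S]) (simp add: continuous_on_mult)
qed

lemma line_derivative_ae_smooth_off_0:
  fixes f :: "real ^ 'n \<Rightarrow> real"
  assumes "smooth_on (- {0}) f" "i \<noteq> j" "\<And>x. x \<noteq> 0 \<Longrightarrow> g x = partial i f x"
  shows "line_derivative_ae i f g"
proof -
  have "AE x in lborel. (x :: real ^ 'n) \<bullet> axis j 1 \<noteq> 0"
    by (rule AE_lborel_inner_neq) (simp add: axis_in_Basis_iff)
  then show ?thesis unfolding line_derivative_ae_def
  proof eventually_elim
    case (elim x)
    have n0: "x + s *\<^sub>R axis i 1 \<noteq> 0" for s
    proof
      assume "x + s *\<^sub>R axis i 1 = 0"
      then have "(x + s *\<^sub>R axis i 1) $ j = 0" by simp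
      moreover have "x $ j \<noteq> 0" using elim by (simp add: inner_axis)
      ultimately show False using assms(2) by (simp add: axis_def)
    qed
    have d: "((\<lambda>s. f (x + s *\<^sub>R axis i 1)) has_real_derivative
        g (x + s *\<^sub>R axis i 1)) (at s)" for s
      unfolding assms(3)[OF n0]
      by (intro line_derivative smooth_on_differentiable[OF assms(1)]) (simp add: n0)
    then have "continuous_on UNIV (\<lambda>s. f (x + s *\<^sub>R axis i 1))"
      by (meson DERIV_isCont continuous_at_imp_continuous_on)
    with d show ?case by blast
  qed
qed

subsection \<open>Square integrable functions\<close>

definition L2_fun :: "(real ^ 'n \<Rightarrow> real) \<Rightarrow> bool" where
  "L2_fun f \<longleftrightarrow> f \<in> borel_measurable borel \<and> integrable lborel (\<lambda>x. (f x)\<^sup>2)"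

lemma L2_funI_nn_integral:
  assumes "f \<in> borel_measurable borel" "(\<integral>\<^sup>+x. ennreal ((f x)\<^sup>2) \<partial>lborel) < \<infinity>"
  shows "L2_fun f"
  unfolding L2_fun_def using assms by (auto intro!: integrableI_nonneg)

lemma L2_fun_bound:
  assumes "L2_fun g" "f \<in> borel_measurable borel" "\<And>x. \<bar>f x\<bar> \<le> \<bar>g x\<bar>"
  shows "L2_fun f"
  unfolding L2_fun_def
proof
  show "integrable lborel (\<lambda>x. (f x)\<^sup>2)"
  proof (rule Bochner_Integration.integrable_bound)
    show "integrable lborel (\<lambda>x. (g x)\<^sup>2)" using assms(1) by (simp add: L2_fun_def)
    show "(\<lambda>x. (f x)\<^sup>2) \<in> borel_measurable lborel" using assms(2) by simp
    show "AE x in lborel. norm ((f x)\<^sup>2) \<le> norm ((g x)\<^sup>2)"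
      using assms(3) by (auto simp: abs_le_square_iff)
  qed
qed (rule assms(2))

lemma L2_fun_scale: "L2_fun f \<Longrightarrow> L2_fun (\<lambda>x. c * f x)"
  unfolding L2_fun_def by (auto simp: power_mult_distrib)

lemma L2_fun_mult_integrable:
  assumes "L2_fun f" "L2_fun g"
  shows "integrable lborel (\<lambda>x. f x * g x)"
proof (rule Bochner_Integration.integrable_bound)
  show "integrable lborel (\<lambda>x. (f x)\<^sup>2 + (g x)\<^sup>2)"
    using assms by (auto simp: L2_fun_def)
  have [measurable]: "f \<in> borel_measurable borel" "g \<in> borel_measurable borel"
    using assms by (auto simp: L2_fun_def)
  show "(\<lambda>x. f x * g x) \<in> borel_measurable lborel" by measurable
  have "norm (a * b) \<le> norm (a\<^sup>2 + b\<^sup>2)" for a b :: real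
  proof -
    have "2 * (\<bar>a\<bar> * \<bar>b\<bar>) \<le> a\<^sup>2 + b\<^sup>2"
      using sum_squares_bound[of "\<bar>a\<bar>" "\<bar>b\<bar>"] by (simp add: mult.assoc)
    moreover have "0 \<le> \<bar>a\<bar> * \<bar>b\<bar>" by simp
    ultimately have "\<bar>a\<bar> * \<bar>b\<bar> \<le> a\<^sup>2 + b\<^sup>2" by linarith
    then show ?thesis by (simp add: abs_mult)
  qed
  then show "AE x in lborel. norm (f x * g x) \<le> norm ((f x)\<^sup>2 + (g x)\<^sup>2)"
    by (intro AE_I2)
qed

lemma L2_fun_add:
  assumes "L2_fun f" "L2_fun g"
  shows "L2_fun (\<lambda>x. f x + g x)"
  unfolding L2_fun_def
proof
  show "(\<lambda>x. f x + g x) \<in> borel_measurable borel"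
    using assms by (auto simp: L2_fun_def)
  have "integrable lborel (\<lambda>x. (f x)\<^sup>2 + (g x)\<^sup>2 + 2 * (f x * g x))"
    using assms L2_fun_mult_integrable[OF assms] by (auto simp: L2_fun_def)
  then show "integrable lborel (\<lambda>x. (f x + g x)\<^sup>2)"
    by (simp add: power2_sum mult.assoc)
qed

lemma L2_fun_bounded:
  assumes "f \<in> borel_measurable borel" "\<And>x. \<bar>f x\<bar> \<le> M" "\<And>x. x \<notin> K \<Longrightarrow> f x = 0" "compact K"
  shows "L2_fun f"
proof (rule L2_fun_bound)
  have "integrable lborel (\<lambda>x. M\<^sup>2 * indicator K x)"
    using assms(4) by (intro integrable_mult_right integrable_real_indicator emeasure_compact_finite)
      (auto intro: borel_closed compact_imp_closed)
  moreover have "(M * indicator K x)\<^sup>2 = M\<^sup>2 * indicator K x" for x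
    by (simp add: indicator_def)
  ultimately show "L2_fun (\<lambda>x. M * indicator K x)"
    using assms(4) by (auto simp: L2_fun_def intro: borel_closed compact_imp_closed)
  show "\<bar>f x\<bar> \<le> \<bar>M * indicator K x\<bar>" for x
    using assms(2)[of x] assms(3)[of x] by (cases "x \<in> K") auto
qed (rule assms(1))

lemma L2_fun_continuous:
  assumes "continuous_on UNIV f" "compact (supp f)"
  shows "L2_fun f"
proof -
  have "bounded (f ` supp f)"
    using assms by (intro compact_imp_bounded compact_continuous_image)
      (auto intro: continuous_on_subset)
  then obtain M where M: "\<And>x. x \<in> supp f \<Longrightarrow> \<bar>f x\<bar> \<le> M"
    unfolding bounded_iff by (metis image_eqI real_norm_def)
  have z: "f x = 0" if "x \<notin> supp f" for x
    using that closure_subset[of "{x. f x \<noteq> 0}"] unfolding supp_def by blast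
  show ?thesis
  proof (rule L2_fun_bounded[OF _ _ z assms(2)])
    show "f \<in> borel_measurable borel" using assms(1) by (rule borel_measurable_continuous_onI)
    show "\<bar>f x\<bar> \<le> max 0 M" for x
      using M[of x] z[of x] by (cases "x \<in> supp f") auto
  qed
qed

lemma L2_fun_locally_integrable:
  assumes "L2_fun f"
  shows "locally_integrable UNIV f"
  unfolding locally_integrable_def set_integrable_def
proof (intro allI impI)
  fix K :: "(real ^ 'a) set" assume K: "compact K \<and> K \<subseteq> UNIV"
  have [measurable]: "f \<in> borel_measurable borel" using assms by (simp add: L2_fun_def)
  have [measurable]: "K \<in> sets borel" using K by (auto intro: borel_closed compact_imp_closed)
  have "L2_fun (indicator K :: _ \<Rightarrow> real)"
    using K by (intro L2_fun_bounded[of _ 1 K]) auto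
  then have "integrable lborel (\<lambda>x. indicator K x * f x)"
    using assms by (rule L2_fun_mult_integrable)
  then show "integrable lebesgue (\<lambda>x. indicator K x *\<^sub>R f x)"
    by (subst integrable_completion) auto
qed

subsection \<open>Weak derivatives in \<open>L\<^sup>2\<close>\<close>

lemma supp_partial: "supp (partial i f) \<subseteq> supp f"
proof -
  have "partial i f x = 0" if "x \<notin> supp f" for x
  proof -
    have "partial i f x = partial i (\<lambda>_. 0) x"
      by (rule partial_cong_open[of "- supp f"])
        (use that closure_subset[of "{x. f x \<noteq> 0}"] in \<open>auto simp: supp_def\<close>)
    then show ?thesis by (simp add: partial_const)
  qed
  then have "{x. partial i f x \<noteq> 0} \<subseteq> supp f" by auto
  then show ?thesis unfolding supp_def[of "partial i f"]
    by (rule closure_minimal) (simp add: supp_def)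
qed

lemma test_function_partial:
  assumes "test_function \<Omega> \<phi>"
  shows "test_function \<Omega> (partial i \<phi>)"
proof -
  have "compact (supp \<phi> \<inter> supp (partial i \<phi>))"
    using assms by (intro compact_Int_closed) (auto simp: test_function_def supp_def)
  then have "compact (supp (partial i \<phi>))"
    using supp_partial[of i \<phi>] by (simp add: Int_absorb1)
  then show ?thesis
    using assms supp_partial[of i \<phi>] smooth_on_partial unfolding test_function_def by blast
qed

lemma test_function_L2:
  assumes "test_function \<Omega> \<phi>"
  shows "L2_fun \<phi>"
  using assms unfolding test_function_def
  by (auto intro!: L2_fun_continuous smooth_on_continuous_on)

definition weak_partial ::
  "'n \<Rightarrow> (real ^ 'n \<Rightarrow> real) \<Rightarrow> (real ^ 'n \<Rightarrow> real) \<Rightarrow> bool" where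
  "weak_partial i f g \<longleftrightarrow> L2_fun f \<and> L2_fun g \<and>
     (\<forall>\<phi>. test_function UNIV \<phi> \<longrightarrow>
        (\<integral>x. f x * partial i \<phi> x \<partial>lborel) = - (\<integral>x. g x * \<phi> x \<partial>lborel))"

lemma weak_partialI:
  assumes f: "L2_fun f" and g: "L2_fun g" and line: "line_derivative_ae i f g"
  shows "weak_partial i f g"
  unfolding weak_partial_def
proof (intro conjI allI impI f g)
  fix \<phi> :: "real ^ 'a \<Rightarrow> real"
  assume \<phi>: "test_function UNIV \<phi>"
  note L2 = test_function_L2[OF \<phi>] test_function_L2[OF test_function_partial[OF \<phi>], of i]
  have i: "integrable lborel (\<lambda>x. f x * \<phi> x)" "integrable lborel (\<lambda>x. g x * \<phi> x)"
    "integrable lborel (\<lambda>x. f x * partial i \<phi> x)"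
    using f g L2 by (blast intro: L2_fun_mult_integrable)+
  have "(\<integral>x. g x * \<phi> x + f x * partial i \<phi> x \<partial>lborel) = 0"
    using i \<phi> by (intro integral_line_derivative_eq_0[OF i(1) _ line_derivative_ae_mult[OF line]])
      (auto simp: test_function_def)
  then show "(\<integral>x. f x * partial i \<phi> x \<partial>lborel) = - (\<integral>x. g x * \<phi> x \<partial>lborel)"
    using i by simp
qed

lemma set_lebesgue_integral_UNIV_lborel:
  fixes f :: "real ^ 'n \<Rightarrow> real"
  assumes "f \<in> borel_measurable borel"
  shows "(LINT x:UNIV|lebesgue. f x) = (\<integral>x. f x \<partial>lborel)"
  using assms by (simp add: set_lebesgue_integral_def integral_completion)

lemma weak_deriv_Nil: "L2_fun f \<Longrightarrow> weak_deriv UNIV [] f f"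
  by (simp add: weak_deriv_def L2_fun_locally_integrable)

lemma weak_deriv_Cons:
  assumes "weak_partial i f g" "weak_deriv UNIV is g h" "L2_fun h"
  shows "weak_deriv UNIV (i # is) f h"
  unfolding weak_deriv_def
proof (intro conjI allI impI)
  show "locally_integrable UNIV f" "locally_integrable UNIV h"
    using assms by (auto simp: weak_partial_def L2_fun_locally_integrable)
  fix \<phi> :: "real ^ 'a \<Rightarrow> real"
  assume \<phi>: "test_function UNIV \<phi>"
  have t: "test_function UNIV (iter_partial is \<phi>)"
    using \<phi> by (induction "is") (auto intro: test_function_partial)
  have m: "f \<in> borel_measurable borel" "g \<in> borel_measurable borel"
    using assms(1) by (auto simp: weak_partial_def L2_fun_def)
  have m2: "iter_partial is \<phi> \<in> borel_measurable borel" "partial i (iter_partial is \<phi>) \<in> borel_measurable borel"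
    using test_function_L2[OF t] test_function_L2[OF test_function_partial[OF t]] by (auto simp: L2_fun_def)
  have "(LINT x:UNIV|lebesgue. f x * iter_partial (i # is) \<phi> x) = (\<integral>x. f x * partial i (iter_partial is \<phi>) x \<partial>lborel)"
    using m m2 by (subst set_lebesgue_integral_UNIV_lborel) auto
  also have "\<dots> = - (\<integral>x. g x * iter_partial is \<phi> x \<partial>lborel)"
    using assms(1) t by (simp add: weak_partial_def)
  also have "(\<integral>x. g x * iter_partial is \<phi> x \<partial>lborel) = (LINT x:UNIV|lebesgue. g x * iter_partial is \<phi> x)"
    using m m2 by (subst set_lebesgue_integral_UNIV_lborel) auto
  also have "\<dots> = (- 1) ^ length is * (LINT x:UNIV|lebesgue. h x * \<phi> x)"
    using assms(2) \<phi> by (simp add: weak_deriv_def)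
  finally show "(LINT x:UNIV|lebesgue. f x * iter_partial (i # is) \<phi> x) =
      (- 1) ^ length (i # is) * (LINT x:UNIV|lebesgue. h x * \<phi> x)" by simp
qed

lemma Hdot_norm_le:
  fixes f :: "real ^ 'n \<Rightarrow> real"
  assumes wd: "\<And>is. length is = k \<Longrightarrow> weak_deriv UNIV is f (g is)"
    and bd: "\<And>is x. length is = k \<Longrightarrow> \<bar>g is x\<bar> \<le> c * W x"
    and W: "L2_fun W" and c: "0 \<le> c"
  shows "Hdot_norm k UNIV f \<le>
    ennreal (sqrt (card {is :: 'n list. length is = k} * (\<integral>x. (W x)\<^sup>2 \<partial>lborel)) * c)"
proof -
  let ?A = "{is :: 'n list. length is = k}"
  let ?I = "\<integral>x. (W x)\<^sup>2 \<partial>lborel"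
  have I0: "0 \<le> ?I" by simp
  have "(\<integral>\<^sup>+x\<in>UNIV. ennreal ((g is x)\<^sup>2) \<partial>lebesgue) \<le> ennreal (c\<^sup>2 * ?I)" if "length is = k" for "is"
  proof -
    have "(g is x)\<^sup>2 \<le> c\<^sup>2 * (W x)\<^sup>2" for x
    proof -
      have "\<bar>g is x\<bar>\<^sup>2 \<le> (c * W x)\<^sup>2"
        using bd[OF that, of x] by (intro power_mono) auto
      then show ?thesis by (simp add: power_mult_distrib)
    qed
    then have "(\<integral>\<^sup>+x\<in>UNIV. ennreal ((g is x)\<^sup>2) \<partial>lebesgue) \<le> (\<integral>\<^sup>+x. ennreal (c\<^sup>2 * (W x)\<^sup>2) \<partial>lebesgue)"
      by (auto intro!: nn_integral_mono ennreal_leI)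
    also have "\<dots> = (\<integral>\<^sup>+x. ennreal (c\<^sup>2 * (W x)\<^sup>2) \<partial>lborel)"
      by (rule nn_integral_completion)
    also have "\<dots> = ennreal (\<integral>x. c\<^sup>2 * (W x)\<^sup>2 \<partial>lborel)"
      using W by (intro nn_integral_eq_integral) (auto simp: L2_fun_def)
    finally show ?thesis by simp
  qed
  then have "(\<Sum>is\<in>?A. \<integral>\<^sup>+x\<in>UNIV. ennreal ((g is x)\<^sup>2) \<partial>lebesgue) \<le> (\<Sum>is\<in>?A. ennreal (c\<^sup>2 * ?I))"
    by (intro sum_mono) auto
  also have "\<dots> = ennreal (card ?A * (c\<^sup>2 * ?I))"
    by (simp add: ennreal_mult'' ennreal_of_nat_eq_real_of_nat)
  finally have le: "(\<Sum>is\<in>?A. \<integral>\<^sup>+x\<in>UNIV. ennreal ((g is x)\<^sup>2) \<partial>lebesgue) \<le> ennreal (card ?A * (c\<^sup>2 * ?I))"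
    (is "?S \<le> ennreal ?T") .
  have "Hdot_norm k UNIV f \<le> ennreal_sqrt ?S"
    unfolding Hdot_norm_def by (rule Inf_lower) (use wd in auto)
  also have "\<dots> \<le> ennreal (sqrt ?T)"
  proof -
    have "?S \<noteq> \<infinity>" using le by (auto simp: top_unique)
    moreover have "enn2real ?S \<le> ?T"
      using le I0 by (intro enn2real_leI) auto
    ultimately show ?thesis by (simp add: ennreal_sqrt_def)
  qed
  also have "sqrt ?T = sqrt (card ?A * ?I) * c"
    using c by (simp add: real_sqrt_mult)
  finally show ?thesis .
qed

section \<open>Pointwise bounds for 2-jets\<close>

definition jet_bound :: "real ^ 'n \<Rightarrow> (real ^ 'n \<Rightarrow> real) \<Rightarrow> real \<Rightarrow> real \<Rightarrow> real \<Rightarrow> bool" where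
  "jet_bound x f a b c \<longleftrightarrow> (\<exists>U. open U \<and> x \<in> U \<and> smooth_on U f) \<and>
     \<bar>f x\<bar> \<le> a \<and> (\<forall>i. \<bar>partial i f x\<bar> \<le> b) \<and> (\<forall>i j. \<bar>partial j (partial i f) x\<bar> \<le> c)"

lemma jet_bound_mono:
  "jet_bound x f a b c \<Longrightarrow> a \<le> a' \<Longrightarrow> b \<le> b' \<Longrightarrow> c \<le> c' \<Longrightarrow> jet_bound x f a' b' c'"
  unfolding jet_bound_def by (blast intro: order_trans)

lemma jet_bound_cong:
  assumes "jet_bound x f a b c" "open U" "x \<in> U" "\<And>y. y \<in> U \<Longrightarrow> f y = g y"
  shows "jet_bound x g a b c"
proof -
  obtain V where V: "open V" "x \<in> V" "smooth_on V f"
    using assms(1) unfolding jet_bound_def by auto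
  have "smooth_on (V \<inter> U) g"
    by (rule smooth_on_cong[of _ f]) (use V assms in \<open>auto intro: smooth_on_subset\<close>)
  moreover have p: "partial i f y = partial i g y" if "y \<in> U" for y i
    by (rule partial_cong_open[OF assms(2) that assms(4)])
  moreover have "partial j (partial i f) x = partial j (partial i g) x" for i j
    by (rule partial_cong_open[OF assms(2,3) p])
  ultimately show ?thesis
    using assms V unfolding jet_bound_def by (metis IntI open_Int)
qed

lemma jet_bound_const: "jet_bound x (\<lambda>_. k) \<bar>k\<bar> 0 0"
  unfolding jet_bound_def by (auto simp: partial_const intro!: exI[of _ UNIV] smooth_on_const)

lemma jet_bound_component: "jet_bound x (\<lambda>x. x $ k) \<bar>x $ k\<bar> 1 0"
  unfolding jet_bound_def
  by (auto simp: partial_component partial_const intro!: exI[of _ UNIV] smooth_on_component)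

lemma jet_bound_add:
  assumes f: "jet_bound x f a b c" and g: "jet_bound x g a' b' c'"
  shows "jet_bound x (\<lambda>x. f x + g x) (a + a') (b + b') (c + c')"
proof -
  obtain U V where UV: "open U" "x \<in> U" "smooth_on U f" "open V" "x \<in> V" "smooth_on V g"
    using assms unfolding jet_bound_def by auto
  define W where "W = U \<inter> V"
  have W: "open W" "x \<in> W" "smooth_on W f" "smooth_on W g"
    using UV by (auto simp: W_def intro: smooth_on_subset)
  have p: "partial i (\<lambda>x. f x + g x) y = partial i f y + partial i g y" if "y \<in> W" for i y
    using W that by (intro partial_add) (auto intro: smooth_on_differentiable)
  have pp: "partial j (partial i (\<lambda>x. f x + g x)) x = partial j (partial i f) x + partial j (partial i g) x"
    for i j
  proof -
    have "partial j (partial i (\<lambda>x. f x + g x)) x = partial j (\<lambda>y. partial i f y + partial i g y) x"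
      by (rule partial_cong_open[OF W(1,2) p])
    also have "\<dots> = partial j (partial i f) x + partial j (partial i g) x"
      using W by (intro partial_add) (auto intro!: smooth_on_differentiable smooth_on_partial)
    finally show ?thesis .
  qed
  have "\<bar>f x + g x\<bar> \<le> a + a'" "\<bar>partial i f x + partial i g x\<bar> \<le> b + b'"
    "\<bar>partial j (partial i f) x + partial j (partial i g) x\<bar> \<le> c + c'" for i j
    using assms unfolding jet_bound_def by (auto intro!: order_trans[OF abs_triangle_ineq] add_mono)
  then show ?thesis
    using W smooth_on_add[OF W(3,4,1)] unfolding jet_bound_def p[OF W(2)] pp by blast
qed

lemma jet_bound_mult:
  assumes f: "jet_bound x f a b c" and g: "jet_bound x g a' b' c'"
  shows "jet_bound x (\<lambda>x. f x * g x) (a * a') (b * a' + a * b') (c * a' + 2 * (b * b') + a * c')"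
proof -
  obtain U V where UV: "open U" "x \<in> U" "smooth_on U f" "open V" "x \<in> V" "smooth_on V g"
    using assms unfolding jet_bound_def by auto
  define W where "W = U \<inter> V"
  have W: "open W" "x \<in> W" "smooth_on W f" "smooth_on W g"
    using UV by (auto simp: W_def intro: smooth_on_subset)
  have d: "h differentiable (at y)" if "y \<in> W" "smooth_on W h" for y and h :: "_ \<Rightarrow> real"
    using that by (auto intro: smooth_on_differentiable)
  have p: "partial i (\<lambda>x. f x * g x) y = partial i f y * g y + f y * partial i g y" if "y \<in> W" for i y
    using W that by (intro partial_mult d)
  have pp: "partial j (partial i (\<lambda>x. f x * g x)) x =
      (partial j (partial i f) x * g x + partial i f x * partial j g x) +
      (partial j f x * partial i g x + f x * partial j (partial i g) x)" for i j
  proof -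
    have "partial j (partial i (\<lambda>x. f x * g x)) x = partial j (\<lambda>y. partial i f y * g y + f y * partial i g y) x"
      by (rule partial_cong_open[OF W(1,2) p])
    also have "\<dots> = partial j (\<lambda>y. partial i f y * g y) x + partial j (\<lambda>y. f y * partial i g y) x"
      using W by (intro partial_add d smooth_on_mult smooth_on_partial)
    also have "partial j (\<lambda>y. partial i f y * g y) x = partial j (partial i f) x * g x + partial i f x * partial j g x"
      using W by (intro partial_mult d smooth_on_partial)
    also have "partial j (\<lambda>y. f y * partial i g y) x = partial j f x * partial i g x + f x * partial j (partial i g) x"
      using W by (intro partial_mult d smooth_on_partial)
    finally show ?thesis .
  qed
  have F: "\<bar>f x\<bar> \<le> a" "\<And>i. \<bar>partial i f x\<bar> \<le> b" "\<And>i j. \<bar>partial j (partial i f) x\<bar> \<le> c"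
    and G: "\<bar>g x\<bar> \<le> a'" "\<And>i. \<bar>partial i g x\<bar> \<le> b'" "\<And>i j. \<bar>partial j (partial i g) x\<bar> \<le> c'"
    using assms unfolding jet_bound_def by auto
  have m: "\<bar>u * v\<bar> \<le> p * q" if "\<bar>u\<bar> \<le> p" "\<bar>v\<bar> \<le> q" for u v p q :: real
    unfolding abs_mult using that by (intro mult_mono) auto
  have "\<bar>f x * g x\<bar> \<le> a * a'" by (intro m F G)
  moreover have "\<bar>partial i f x * g x + f x * partial i g x\<bar> \<le> b * a' + a * b'" for i
    by (intro order_trans[OF abs_triangle_ineq] add_mono m F G)
  moreover have "\<bar>(partial j (partial i f) x * g x + partial i f x * partial j g x) +
      (partial j f x * partial i g x + f x * partial j (partial i g) x)\<bar>
      \<le> (c * a' + b * b') + (b * b' + a * c')" for i j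
    by (intro order_trans[OF abs_triangle_ineq] add_mono m F G)
  moreover have e: "c * a' + 2 * (b * b') + a * c' = (c * a' + b * b') + (b * b' + a * c')" by simp
  ultimately show ?thesis
    using W smooth_on_mult[OF W(3,4,1)] unfolding jet_bound_def p[OF W(2)] pp e by blast
qed

lemma jet_bound_scale:
  assumes "jet_bound x f a b c"
  shows "jet_bound x (\<lambda>x. k * f x) (\<bar>k\<bar> * a) (\<bar>k\<bar> * b) (\<bar>k\<bar> * c)"
  using jet_bound_mult[OF jet_bound_const assms, of k] by simp

lemma jet_bound_diff:
  assumes f: "jet_bound x f a b c" and g: "jet_bound x g a' b' c'"
  shows "jet_bound x (\<lambda>x. f x - g x) (a + a') (b + b') (c + c')"
  using jet_bound_add[OF f jet_bound_scale[OF g, of "-1"]] by simp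

lemma jet_bound_compose:
  assumes f: "jet_bound x f a b c" and W: "open W" "f x \<in> W" and h: "\<And>k. Ck1 k W h"
    and h1: "\<And>s. s \<in> W \<Longrightarrow> (h has_real_derivative h1 s) (at s)"
    and h2: "(h1 has_real_derivative h2) (at (f x))"
    and bd: "\<bar>h (f x)\<bar> \<le> H0" "\<bar>h1 (f x)\<bar> \<le> H1" "\<bar>h2\<bar> \<le> H2"
  shows "jet_bound x (\<lambda>x. h (f x)) H0 (H1 * b) (H2 * b\<^sup>2 + H1 * c)"
proof -
  obtain U where U: "open U" "x \<in> U" "smooth_on U f"
    using f unfolding jet_bound_def by auto
  define V where "V = U \<inter> f -` W"
  have V: "open V" "x \<in> V" "smooth_on V f" "\<And>y. y \<in> V \<Longrightarrow> f y \<in> W"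
    using U W continuous_open_preimage[OF smooth_on_continuous_on[OF U(3)] U(1) W(1)]
    by (auto simp: V_def intro: smooth_on_subset)
  have d: "g differentiable (at y)" if "y \<in> V" "smooth_on V g" for y and g :: "_ \<Rightarrow> real"
    using that by (auto intro: smooth_on_differentiable)
  have p: "partial i (\<lambda>x. h (f x)) y = h1 (f y) * partial i f y" if "y \<in> V" for i y
    using V that h1 by (intro partial_compose d) auto
  have pp: "partial j (partial i (\<lambda>x. h (f x))) x =
      (h2 * partial j f x) * partial i f x + h1 (f x) * partial j (partial i f) x" for i j
  proof -
    have "partial j (partial i (\<lambda>x. h (f x))) x = partial j (\<lambda>y. h1 (f y) * partial i f y) x"
      by (rule partial_cong_open[OF V(1,2) p])
    also have "\<dots> = partial j (\<lambda>y. h1 (f y)) x * partial i f x + h1 (f x) * partial j (partial i f) x"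
      using V h2 by (intro partial_mult d smooth_on_partial differentiable_compose_real[of h1 h2])
    also have "partial j (\<lambda>y. h1 (f y)) x = h2 * partial j f x"
      using V by (intro partial_compose h2 d)
    finally show ?thesis .
  qed
  have F: "\<And>i. \<bar>partial i f x\<bar> \<le> b" "\<And>i j. \<bar>partial j (partial i f) x\<bar> \<le> c"
    using f unfolding jet_bound_def by auto
  have m: "\<bar>u * v\<bar> \<le> p * q" if "\<bar>u\<bar> \<le> p" "\<bar>v\<bar> \<le> q" for u v p q :: real
    unfolding abs_mult using that by (intro mult_mono) auto
  have "\<bar>h1 (f x) * partial i f x\<bar> \<le> H1 * b" for i
    by (intro m F bd)
  moreover have "\<bar>(h2 * partial j f x) * partial i f x + h1 (f x) * partial j (partial i f) x\<bar>
      \<le> (H2 * b) * b + H1 * c" for i j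
    by (intro order_trans[OF abs_triangle_ineq] add_mono m F bd)
  moreover have "smooth_on V (\<lambda>x. h (f x))"
    by (rule smooth_on_compose[OF h V(3,4,1)])
  ultimately show ?thesis
    using V bd unfolding jet_bound_def p[OF V(2)] pp power2_eq_square mult.assoc[symmetric] by blast
qed

lemma jet_bound_power2_norm:
  fixes x :: "real ^ 'n"
  shows "jet_bound x (\<lambda>x. (norm x)\<^sup>2) ((norm x)\<^sup>2) (2 * norm x) 2"
proof -
  have d1: "((\<lambda>x :: real ^ 'n. (norm x)\<^sup>2) has_derivative (\<lambda>h. 2 * (y \<bullet> h))) (at y)" for y
    unfolding power2_norm_eq_inner by (rule has_derivative_eq_rhs, rule has_derivative_inner, rule has_derivative_ident, rule has_derivative_ident)
      (simp add: inner_commute)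
  have p: "partial i (\<lambda>x :: real ^ 'n. (norm x)\<^sup>2) = (\<lambda>y. 2 * y $ i)" for i
    by (intro ext) (simp add: partial_eqI[OF d1] inner_axis)
  have d2: "((\<lambda>y :: real ^ 'n. 2 * y $ i) has_derivative (\<lambda>h. 2 * h $ i)) (at y)" for i y
    by (intro bounded_linear_imp_has_derivative bounded_linear_const_mult bounded_linear_vec_nth)
  have "partial j (\<lambda>y :: real ^ 'n. 2 * y $ i) y = (if i = j then 2 else 0)" for i j y
    by (simp add: partial_eqI[OF d2] axis_def)
  then have "\<bar>partial j (\<lambda>y. 2 * y $ i) x\<bar> \<le> 2" for i j :: 'n
    by simp
  moreover have "\<bar>2 * x $ i\<bar> \<le> 2 * norm x" for i
    using component_le_norm_cart[of x i] by (simp add: abs_mult)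
  ultimately show ?thesis
    unfolding jet_bound_def p using smooth_on_power2_norm[OF open_UNIV] by auto
qed

lemma jet_bound_smooth_step:
  obtains M where "1 \<le> M" "\<And>(x :: real ^ 'n) f a b c. jet_bound x f a b c \<Longrightarrow>
    jet_bound x (\<lambda>x. smooth_step (f x)) 1 (M * b) (M * b\<^sup>2 + M * c)"
proof -
  obtain d1 d2 M where d: "\<And>s. (smooth_step has_real_derivative d1 s) (at s)"
    "\<And>s. (d1 has_real_derivative d2 s) (at s)" "\<And>s. \<bar>d1 s\<bar> \<le> M" "\<And>s. \<bar>d2 s\<bar> \<le> M" "1 \<le> M"
    using smooth_step_derivatives by metis
  show ?thesis
  proof (rule that[of M])
    fix x :: "real ^ 'n" and f a b c assume "jet_bound x f a b c"
    then show "jet_bound x (\<lambda>x. smooth_step (f x)) 1 (M * b) (M * b\<^sup>2 + M * c)"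
      using smooth_step_bounds d by (intro jet_bound_compose[of x f a b c UNIV _ d1 "d2 (f x)"] Ck1_smooth_step) auto
  qed (rule d)
qed

section \<open>The logarithmic profiles\<close>

definition log_weight :: "real \<Rightarrow> real \<Rightarrow> real" where
  "log_weight a s = \<bar>ln \<bar>s / 4\<bar>\<bar> powr a"

definition log_primitive :: "real \<Rightarrow> real \<Rightarrow> real" where
  "log_primitive a x = (LBINT s=0..x. log_weight a s)"

lemma log_weight_borel[measurable]: "log_weight a \<in> borel_measurable borel"
  unfolding log_weight_def by measurable

lemma log_weight_nonneg: "0 \<le> log_weight a s"
  by (simp add: log_weight_def)

lemma log_weight_isCont:
  assumes "0 < a" "s \<noteq> 0"
  shows "isCont (log_weight a) s"
proof -
  have "isCont (\<lambda>s. \<bar>ln \<bar>s / 4\<bar>\<bar>) s"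
    using assms by (intro continuous_intros) auto
  then show ?thesis
    unfolding isCont_def log_weight_def using assms(1)
    by (intro tendsto_powr' tendsto_const) auto
qed

lemma abs_ln_le:
  fixes y :: real
  assumes "0 < y"
  shows "\<bar>ln y\<bar> \<le> y + 4 * y powr (-1/4)"
proof (cases "1 \<le> y")
  case True
  then have "\<bar>ln y\<bar> \<le> y" using ln_le_minus_one[of y] by simp
  then show ?thesis by (smt (verit) powr_ge_zero)
next
  case False
  have "ln (y powr (-1/4)) \<le> y powr (-1/4) - 1" using assms by (intro ln_le_minus_one) simp
  then have "- ln y \<le> 4 * y powr (-1/4)" using assms by (simp add: ln_powr)
  moreover have "ln y < 0" using False assms by simp
  ultimately show ?thesis using assms by simp
qed

lemma log_weight_bound:
  assumes "0 \<le> a" "a \<le> 1" "1 \<le> M"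
  obtains K where "0 < K" "\<And>s. s \<noteq> 0 \<Longrightarrow> \<bar>s\<bar> \<le> M \<Longrightarrow> log_weight a s \<le> K * \<bar>s\<bar> powr (-1/4)"
proof (rule that[of "M powr (1/4) * (1 + M) + 4 * (1/4) powr (-1/4)"])
  show "0 < M powr (1/4) * (1 + M) + 4 * (1/4) powr (-1/4)"
    using assms by (intro add_pos_pos mult_pos_pos) auto
  fix s :: real assume s: "s \<noteq> 0" "\<bar>s\<bar> \<le> M"
  have "log_weight a s \<le> (1 + \<bar>ln \<bar>s / 4\<bar>\<bar>) powr a"
    unfolding log_weight_def using assms by (intro powr_mono2) auto
  also have "\<dots> \<le> (1 + \<bar>ln \<bar>s / 4\<bar>\<bar>) powr 1" using assms by (intro powr_mono) auto
  also have "\<dots> \<le> 1 + (\<bar>s / 4\<bar> + 4 * \<bar>s / 4\<bar> powr (-1/4))"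
    using abs_ln_le[of "\<bar>s / 4\<bar>"] s by simp
  also have "\<bar>s / 4\<bar> powr (-1/4) = (1/4) powr (-1/4) * \<bar>s\<bar> powr (-1/4)"
    by (simp add: powr_mult[symmetric])
  also have "1 + (\<bar>s / 4\<bar> + 4 * ((1/4) powr (-1/4) * \<bar>s\<bar> powr (-1/4)))
      \<le> (1 + M) * 1 + 4 * (1/4) powr (-1/4) * \<bar>s\<bar> powr (-1/4)"
    using s by simp
  also have "\<dots> \<le> (1 + M) * (M powr (1/4) * \<bar>s\<bar> powr (-1/4)) + 4 * (1/4) powr (-1/4) * \<bar>s\<bar> powr (-1/4)"
  proof -
    have "1 = \<bar>s\<bar> powr (1/4) * \<bar>s\<bar> powr (-1/4)"
      using s by (simp add: powr_add[symmetric])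
    also have "\<dots> \<le> M powr (1/4) * \<bar>s\<bar> powr (-1/4)"
      using s by (intro mult_right_mono powr_mono2) auto
    finally show ?thesis using assms by (intro add_right_mono mult_left_mono) auto
  qed
  finally show "log_weight a s \<le> (M powr (1/4) * (1 + M) + 4 * (1/4) powr (-1/4)) * \<bar>s\<bar> powr (-1/4)"
    by (simp add: algebra_simps)
qed

lemma nn_integral_abs_powr_finite:
  assumes "-1 < p"
  shows "(\<integral>\<^sup>+s. ennreal (indicator {-M..M} s * \<bar>s\<bar> powr p) \<partial>lborel) < \<infinity>"
proof -
  define f :: "real \<Rightarrow> ennreal" where "f s = ennreal (indicator {0..M} s * s powr p)" for s
  have fm[measurable]: "f \<in> borel_measurable borel" unfolding f_def by measurable
  have "(\<integral>\<^sup>+s. f s \<partial>lborel) < \<infinity>"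
  proof (cases "0 \<le> M")
    case True
    have "((\<lambda>s::real. s powr p) has_integral (M powr (p + 1) / (p + 1))) {0..M}"
      using True assms by (intro has_integral_powr_from_0) auto
    then have "(\<integral>\<^sup>+s. f s \<partial>lborel) = ennreal (M powr (p + 1) / (p + 1))"
      unfolding f_def by (intro nn_integral_has_integral_lebesgue) auto
    then show ?thesis by simp
  qed (simp add: f_def)
  moreover have "(\<integral>\<^sup>+s. f (- s) \<partial>lborel) = (\<integral>\<^sup>+s. f s \<partial>lborel)"
    using nn_integral_real_affine[OF fm, of "-1" 0] by simp
  moreover have "(\<integral>\<^sup>+s. ennreal (indicator {-M..M} s * \<bar>s\<bar> powr p) \<partial>lborel) \<le> (\<integral>\<^sup>+s. f s + f (- s) \<partial>lborel)"
    by (intro nn_integral_mono) (auto simp: f_def indicator_def abs_if)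
  ultimately show ?thesis
    by (subst (asm) nn_integral_add) (auto simp: less_top[symmetric] top_unique)
qed

lemma log_weight_integrable:
  assumes "0 \<le> a" "a \<le> 1"
  shows "set_integrable lborel {-M..M} (log_weight a)"
proof -
  obtain K where K: "0 < K" "\<And>s. s \<noteq> 0 \<Longrightarrow> \<bar>s\<bar> \<le> max 1 M \<Longrightarrow> log_weight a s \<le> K * \<bar>s\<bar> powr (-1/4)"
    using log_weight_bound[of a "max 1 M"] assms by auto
  have "set_integrable lborel {-M..M} (\<lambda>s. K * \<bar>s\<bar> powr (-1/4))"
    unfolding set_integrable_def
  proof -
    have "integrable lborel (\<lambda>s. indicator {-M..M} s * \<bar>s\<bar> powr (-1/4))"
      using nn_integral_abs_powr_finite[of "-1/4" M] by (intro integrableI_nonneg) auto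
    then have "integrable lborel (\<lambda>s. K * (indicator {-M..M} s * \<bar>s\<bar> powr (-1/4)))"
      by (rule integrable_mult_right)
    then show "integrable lborel (\<lambda>s. indicator {-M..M} s *\<^sub>R (K * \<bar>s\<bar> powr (-1/4)))"
      by (simp add: mult.left_commute)
  qed
  then show ?thesis
  proof (rule set_integrable_bound)
    show "set_borel_measurable lborel {-M..M} (log_weight a)"
      unfolding set_borel_measurable_def by measurable
    show "AE s in lborel. s \<in> {-M..M} \<longrightarrow> norm (log_weight a s) \<le> norm (K * \<bar>s\<bar> powr (-1/4))"
      using AE_lborel_singleton[of 0]
    proof eventually_elim
      case (elim s)
      show ?case
      proof
        assume "s \<in> {-M..M}"
        then show "norm (log_weight a s) \<le> norm (K * \<bar>s\<bar> powr (-1/4))"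
          using K(1) K(2)[OF elim] log_weight_nonneg[of a s] by (auto simp: abs_mult)
      qed
    qed
  qed
qed

lemma log_primitive_eq_integral:
  assumes "0 \<le> a" "a \<le> 1" "\<bar>x\<bar> \<le> M"
  shows "log_primitive a x = integral {-M..x} (log_weight a) - integral {-M..0} (log_weight a)"
proof -
  have int: "log_weight a integrable_on {u..v}" if "-M \<le> u" "v \<le> M" for u v
    by (rule integrable_on_subinterval[OF
          set_borel_integral_eq_integral(1)[OF log_weight_integrable[OF assms(1,2), of M]]]) (use that in auto)
  have eq: "(LINT s:{u<..<v}|lborel. log_weight a s) = integral {u..v} (log_weight a)"
    if "-M \<le> u" "v \<le> M" for u v
  proof -
    have "set_integrable lborel {u<..<v} (log_weight a)"
      using that by (intro set_integrable_subset[OF log_weight_integrable[OF assms(1,2), of M]]) auto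
    then show ?thesis
      by (simp add: set_borel_integral_eq_integral(2) integral_open_interval_real)
  qed
  show ?thesis
  proof (cases "0 \<le> x")
    case True
    then have "log_primitive a x = integral {0..x} (log_weight a)"
      using eq[of 0 x] assms(3)
      by (simp add: log_primitive_def interval_lebesgue_integral_def zero_ereal_def)
    moreover have "integral {-M..0} (log_weight a) + integral {0..x} (log_weight a) = integral {-M..x} (log_weight a)"
      using True assms(3) int[of "-M" x] by (intro Henstock_Kurzweil_Integration.integral_combine) auto
    ultimately show ?thesis by simp
  next
    case False
    then have "log_primitive a x = - integral {x..0} (log_weight a)"
      using eq[of x 0] assms(3)
      by (simp add: log_primitive_def interval_lebesgue_integral_def zero_ereal_def)
    moreover have "integral {-M..x} (log_weight a) + integral {x..0} (log_weight a) = integral {-M..0} (log_weight a)"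
      using False assms(3) int[of "-M" 0] by (intro Henstock_Kurzweil_Integration.integral_combine) auto
    ultimately show ?thesis by simp
  qed
qed

lemma log_primitive_has_derivative:
  assumes "0 < a" "a \<le> 1" "x \<noteq> 0"
  shows "(log_primitive a has_real_derivative log_weight a x) (at x)"
proof -
  define M where "M = \<bar>x\<bar> + 1"
  have x: "x \<in> {-M..M}" "x \<in> {-M<..<M}" by (auto simp: M_def)
  have "log_weight a integrable_on {-M..M}"
    using set_borel_integral_eq_integral(1)[OF log_weight_integrable[of a M]] assms by simp
  moreover have "continuous (at x within {-M..M}) (log_weight a)"
    using log_weight_isCont[of a x] assms continuous_at_imp_continuous_at_within by blast
  ultimately have "((\<lambda>u. integral {-M..u} (log_weight a)) has_vector_derivative log_weight a x)
      (at x within {-M..M})"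
    using integral_has_vector_derivative_continuous_at[of "log_weight a" "-M" M x "{}"] x(1) by simp
  then have "((\<lambda>u. integral {-M..u} (log_weight a)) has_real_derivative log_weight a x) (at x)"
    using x(2) by (simp add: at_within_Icc_at has_real_derivative_iff_has_vector_derivative)
  then have "((\<lambda>u. integral {-M..u} (log_weight a) - integral {-M..0} (log_weight a))
      has_real_derivative log_weight a x) (at x)"
    by (auto intro!: derivative_eq_intros)
  then show ?thesis
    by (rule has_field_derivative_transform_within_open[of _ _ _ "{-M<..<M}"])
      (use x assms in \<open>auto simp: log_primitive_eq_integral[of a _ M]\<close>)
qed

lemma log_primitive_continuous:
  assumes "0 < a" "a \<le> 1"
  shows "continuous_on UNIV (log_primitive a)"
proof -
  have "isCont (log_primitive a) x" for x
  proof -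
    define M where "M = \<bar>x\<bar> + 1"
    have "log_weight a integrable_on {-M..M}"
      using set_borel_integral_eq_integral(1)[OF log_weight_integrable[of a M]] assms by simp
    then have "continuous_on {-M..M} (\<lambda>u. integral {-M..u} (log_weight a) - integral {-M..0} (log_weight a))"
      by (intro continuous_intros indefinite_integral_continuous_1)
    then have "continuous_on {-M<..<M} (log_primitive a)"
      using assms by (subst continuous_on_cong[OF refl log_primitive_eq_integral[of a _ M]])
        (auto elim: continuous_on_subset)
    then show ?thesis
      by (rule continuous_on_interior) (auto simp: M_def)
  qed
  then show ?thesis by (simp add: continuous_at_imp_continuous_on)
qed

lemma log_primitive_0: "log_primitive a 0 = 0"
  by (simp add: log_primitive_def zero_ereal_def)

lemma chi1_eq: "chi1 \<epsilon> \<alpha> x = \<epsilon> * log_primitive \<alpha> x"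
  by (simp add: chi1_def log_primitive_def log_weight_def)

lemma deriv_chi1:
  assumes "0 < \<alpha>" "\<alpha> \<le> 1" "s \<noteq> 0"
  shows "deriv (chi1 \<epsilon> \<alpha>) s = \<epsilon> * log_weight \<alpha> s"
proof -
  have "(chi1 \<epsilon> \<alpha> has_real_derivative \<epsilon> * log_weight \<alpha> s) (at s)"
    unfolding chi1_eq[abs_def] using assms
    by (intro DERIV_cmult log_primitive_has_derivative)
  then show ?thesis by (rule DERIV_imp_deriv)
qed

lemma chi2_eq_LBINT:
  assumes "0 < \<alpha>" "\<alpha> \<le> 1"
  shows "chi2 \<epsilon> \<alpha> x = 2 * (LBINT s=0..x. \<epsilon>\<^sup>2 * \<bar>ln \<bar>s / 4\<bar>\<bar> powr (2 * \<alpha>))"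
proof -
  have "(deriv (chi1 \<epsilon> \<alpha>) s)\<^sup>2 = \<epsilon>\<^sup>2 * \<bar>ln \<bar>s / 4\<bar>\<bar> powr (2 * \<alpha>)" if "s \<noteq> 0" for s
    using deriv_chi1[OF assms that, of \<epsilon>]
    by (simp add: log_weight_def power2_eq_square powr_add[symmetric] mult_ac)
  then have "(LBINT s=0..x. (deriv (chi1 \<epsilon> \<alpha>) s)\<^sup>2) = (LBINT s=0..x. \<epsilon>\<^sup>2 * \<bar>ln \<bar>s / 4\<bar>\<bar> powr (2 * \<alpha>))"
    by (intro interval_integral_cong) (auto simp: einterval_def zero_ereal_def min_def max_def split: if_splits)
  then show ?thesis by (simp add: chi2_def)
qed

lemma chi2_eq:
  assumes "0 < \<alpha>" "\<alpha> \<le> 1"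
  shows "chi2 \<epsilon> \<alpha> x = 2 * \<epsilon>\<^sup>2 * log_primitive (2 * \<alpha>) x"
  by (simp add: chi2_eq_LBINT[OF assms] log_primitive_def log_weight_def)

definition log_mean :: "real \<Rightarrow> real \<Rightarrow> real" where
  "log_mean a s = log_primitive a s / s"

definition log_slope :: "real \<Rightarrow> real \<Rightarrow> real" where
  "log_slope a s = ln (4 / s) powr (a - 1)"

lemma log_weight_eq: "0 < s \<Longrightarrow> s < 4 \<Longrightarrow> log_weight a s = ln (4 / s) powr a"
  by (simp add: log_weight_def ln_div)

lemma ln_4_div_pos: "0 < s \<Longrightarrow> s < 4 \<Longrightarrow> 0 < ln (4 / s :: real)"
  by simp

lemma ln_4_div_powr_has_derivative:
  assumes "0 < s" "s < 4"
  shows "((\<lambda>s. ln (4 / s) powr a) has_real_derivative - (a * ln (4 / s) powr (a - 1) / s)) (at s)"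
proof -
  have "((\<lambda>s. ln (4 / s)) has_real_derivative - (1 / s)) (at s)"
    using assms by (auto intro!: derivative_eq_intros simp: field_simps)
  from DERIV_fun_powr[OF this, of a] show ?thesis
    using ln_4_div_pos[OF assms] by simp
qed

lemma log_weight_has_derivative:
  assumes "0 < s" "s < 4"
  shows "(log_weight a has_real_derivative - (a * log_slope a s / s)) (at s)"
  unfolding log_slope_def
  by (rule has_field_derivative_transform_within_open[OF ln_4_div_powr_has_derivative[OF assms], of "{0<..<4}"])
    (use assms in \<open>auto simp: log_weight_eq\<close>)

lemma log_weight_antimono:
  assumes "0 < x" "x \<le> s" "s < 4" "0 \<le> a"
  shows "log_weight a s \<le> log_weight a x"
proof -
  have "ln (4 / s) \<le> ln (4 / x)" using assms by (intro ln_mono) (auto simp: field_simps)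
  then show ?thesis using assms ln_4_div_pos[of s] by (auto simp: log_weight_eq intro!: powr_mono2)
qed

lemma log_slope_nonneg: "0 \<le> log_slope a s"
  by (simp add: log_slope_def)

lemma log_mean_lower:
  assumes "0 < a" "a < 1" "0 < s" "s < 4"
  shows "log_weight a s \<le> log_mean a s"
proof -
  have "log_primitive a 0 - 0 * log_weight a s \<le> log_primitive a s - s * log_weight a s"
  proof (rule DERIV_nonneg_imp_increasing_open[where f = "\<lambda>x. log_primitive a x - x * log_weight a s"])
    fix x assume x: "0 < x" "x < s"
    have "((\<lambda>x. log_primitive a x - x * log_weight a s) has_real_derivative
        log_weight a x - log_weight a s) (at x)"
      using x assms by (auto intro!: derivative_eq_intros log_primitive_has_derivative)
    then show "\<exists>y. ((\<lambda>x. log_primitive a x - x * log_weight a s) has_real_derivative y) (at x) \<and> 0 \<le> y"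
      using log_weight_antimono[of x s a] x assms by (intro exI conjI) auto
  next
    show "continuous_on {0..s} (\<lambda>x. log_primitive a x - x * log_weight a s)"
      using log_primitive_continuous[of a] assms
      by (intro continuous_intros) (auto elim: continuous_on_subset)
  qed (use assms in auto)
  then show ?thesis using assms by (simp add: log_primitive_0 log_mean_def field_simps)
qed

lemma log_mean_upper:
  assumes "0 < a" "a < 1" "0 < s" "s < 4"
  shows "log_mean a s \<le> log_weight a s + a * log_slope a s"
proof -
  define G where "G x = log_primitive a x - x * ln (4 / x) powr a - a * (x * ln (4 / x) powr (a - 1))" for x
  have G: "G s \<le> log_primitive a x" if x: "0 < x" "x < s" for x
  proof -
    have "G s \<le> G x"
    proof (rule DERIV_nonpos_imp_nonincreasing[where f = G])
      fix y assume y: "x \<le> y" "y \<le> s"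
      then have y04: "0 < y" "y < 4" using x assms by auto
      have "(G has_real_derivative
          log_weight a y - (1 * ln (4 / y) powr a + (- (a * ln (4 / y) powr (a - 1) / y)) * y)
          - a * (1 * ln (4 / y) powr (a - 1) + (- ((a - 1) * ln (4 / y) powr (a - 1 - 1) / y)) * y)) (at y)"
        unfolding G_def using y04 assms
        by (intro DERIV_diff DERIV_mult DERIV_cmult DERIV_ident ln_4_div_powr_has_derivative
            log_primitive_has_derivative) auto
      then have "(G has_real_derivative - (a * (1 - a) * ln (4 / y) powr (a - 1 - 1))) (at y)"
        by (rule DERIV_cong) (use y04 in \<open>simp add: log_weight_eq field_simps\<close>)
      moreover have "0 \<le> a * (1 - a) * ln (4 / y) powr (a - 1 - 1)" using assms by simp
      ultimately show "\<exists>D. (G has_real_derivative D) (at y) \<and> D \<le> 0"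
        by (intro exI conjI) auto
    qed (use x in auto)
    also have "G x \<le> log_primitive a x"
    proof -
      have "0 \<le> x * ln (4 / x) powr a" "0 \<le> a * (x * ln (4 / x) powr (a - 1))"
        using x assms by auto
      then show ?thesis unfolding G_def by linarith
    qed
    finally show ?thesis .
  qed
  have "(log_primitive a \<longlongrightarrow> log_primitive a 0) (at_right 0)"
    using log_primitive_continuous[of a] assms
    by (simp add: continuous_on_eq_continuous_within continuous_within filterlim_at_split)
  moreover have "eventually (\<lambda>x. G s \<le> log_primitive a x) (at_right 0)"
    using assms G by (auto simp: eventually_at_right_field intro!: exI[of _ s])
  ultimately have "G s \<le> log_primitive a 0"
    by (intro tendsto_lowerbound) auto
  then show ?thesis
    using assms by (simp add: log_primitive_0 G_def log_mean_def log_slope_def log_weight_eq field_simps)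
qed

lemma log_mean_has_derivative:
  assumes "0 < a" "a < 1" "0 < s" "s < 4"
  shows "(log_mean a has_real_derivative (log_weight a s - log_mean a s) / s) (at s)"
proof -
  have "((\<lambda>s. log_primitive a s / s) has_real_derivative
      (log_weight a s * s - log_primitive a s * 1) / (s * s)) (at s)"
    using assms by (intro DERIV_divide log_primitive_has_derivative DERIV_ident) auto
  then show ?thesis
    unfolding log_mean_def[abs_def] by (rule DERIV_cong) (use assms in \<open>simp add: field_simps\<close>)
qed

lemma log_mean_has_derivative2:
  assumes "0 < a" "a < 1" "0 < s" "s < 4"
  shows "((\<lambda>s. (log_weight a s - log_mean a s) / s) has_real_derivative
    (2 * (log_mean a s - log_weight a s) - a * log_slope a s) / s\<^sup>2) (at s)"
proof -
  have "((\<lambda>s. (log_weight a s - log_mean a s) / s) has_real_derivative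
      ((- (a * log_slope a s / s) - (log_weight a s - log_mean a s) / s) * s
        - (log_weight a s - log_mean a s) * 1) / (s * s)) (at s)"
    using assms by (intro DERIV_divide DERIV_diff log_weight_has_derivative log_mean_has_derivative DERIV_ident) auto
  then show ?thesis
    by (rule DERIV_cong) (use assms in \<open>simp add: field_simps power2_eq_square\<close>)
qed

lemma log_mean_derivative_bounds:
  assumes "0 < a" "a < 1" "0 < s" "s < 4"
  shows "\<bar>log_mean a s\<bar> \<le> log_weight a s + log_slope a s"
    and "\<bar>(log_weight a s - log_mean a s) / s\<bar> \<le> log_slope a s / s"
    and "\<bar>(2 * (log_mean a s - log_weight a s) - a * log_slope a s) / s\<^sup>2\<bar> \<le> log_slope a s / s\<^sup>2"
proof -
  note b = log_mean_lower[OF assms] log_mean_upper[OF assms]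
  have l: "a * log_slope a s \<le> log_slope a s" "0 \<le> a * log_slope a s"
    using assms log_slope_nonneg[of a s] mult_right_mono[of a 1 "log_slope a s"] by auto
  show "\<bar>log_mean a s\<bar> \<le> log_weight a s + log_slope a s"
    using b l log_weight_nonneg[of a s] by linarith
  have "\<bar>log_weight a s - log_mean a s\<bar> \<le> log_slope a s"
    using b l by linarith
  then show "\<bar>(log_weight a s - log_mean a s) / s\<bar> \<le> log_slope a s / s"
    using assms by (simp add: divide_right_mono)
  have "\<bar>2 * (log_mean a s - log_weight a s) - a * log_slope a s\<bar> \<le> log_slope a s"
    using b l(1) by argo
  then show "\<bar>(2 * (log_mean a s - log_weight a s) - a * log_slope a s) / s\<^sup>2\<bar> \<le> log_slope a s / s\<^sup>2"
    using assms by (simp add: divide_right_mono)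
qed

lemma Ck1_ln_4_div_powr: "Ck1 k {0<..<4} (\<lambda>s. ln (4 / s) powr a)"
proof -
  have "Ck1 k {0<..<4::real} (\<lambda>s. 4 / s)"
    by (rule Ck1_divide[OF Ck1_const Ck1_ident]) auto
  then have "Ck1 k {0<..<4::real} (\<lambda>s. ln (4 / s))"
    by (rule Ck1_compose[OF Ck1_ln[OF order_refl]]) auto
  then show ?thesis by (rule Ck1_powr) auto
qed

lemma Ck1_log_weight: "Ck1 k {0<..<4} (log_weight a)"
  by (rule Ck1_cong[OF _ _ Ck1_ln_4_div_powr]) (auto simp: log_weight_eq)

lemma Ck1_log_primitive:
  assumes "0 < a" "a \<le> 1"
  shows "Ck1 k {0<..<4} (log_primitive a)"
proof (cases k)
  case 0
  then show ?thesis using log_primitive_continuous[OF assms] by (auto elim: continuous_on_subset)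
next
  case (Suc j)
  show ?thesis unfolding Suc
    by (rule Ck1_SucI[OF log_primitive_has_derivative[OF assms] Ck1_log_weight]) auto
qed

lemma Ck1_log_mean:
  assumes "0 < a" "a < 1"
  shows "Ck1 k {0<..<4} (log_mean a)"
  unfolding log_mean_def[abs_def]
  by (rule Ck1_divide[OF Ck1_log_primitive Ck1_ident]) (use assms in auto)

section \<open>The first extension\<close>

text \<open>The function \<open>q\<close> of the introduction: \<open>B 0\<close> is the ball \<open>|x|\<^sup>2 < 2 x\<^sub>1\<close>, and the transition
  takes place between the balls \<open>3 |x|\<^sup>2 < 8 x\<^sub>1\<close> and \<open>|x|\<^sup>2 < 4 x\<^sub>1\<close>.\<close>

definition parab :: "real ^ 3 \<Rightarrow> real" where
  "parab x = 1/2 * (norm x)\<^sup>2 +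
     (x $ 1 - 1/2 * (norm x)\<^sup>2) * smooth_step (8 * (x $ 1 * inverse ((norm x)\<^sup>2)) - 2)"

lemma parab_inner:
  assumes "x \<noteq> 0" "3/8 * (norm x)\<^sup>2 \<le> x $ 1"
  shows "parab x = x $ 1"
proof -
  have "1 \<le> 8 * (x $ 1 * inverse ((norm x)\<^sup>2)) - 2"
    using assms by (simp add: field_simps)
  then show ?thesis by (simp add: parab_def smooth_step_eq_1)
qed

lemma parab_outer:
  assumes "x \<noteq> 0" "x $ 1 \<le> (norm x)\<^sup>2 / 4"
  shows "parab x = 1/2 * (norm x)\<^sup>2"
proof -
  have "8 * (x $ 1 * inverse ((norm x)\<^sup>2)) - 2 \<le> 0"
    using assms by (simp add: field_simps)
  then show ?thesis by (simp add: parab_def smooth_step_eq_0)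
qed

lemma parab_transition:
  assumes "x $ 1 \<le> (norm x)\<^sup>2 / 2"
  shows "x $ 1 \<le> parab x" "parab x \<le> (norm x)\<^sup>2 / 2"
proof -
  define S where "S = smooth_step (8 * (x $ 1 * inverse ((norm x)\<^sup>2)) - 2)"
  have S: "0 \<le> S" "S \<le> 1" using smooth_step_bounds by (auto simp: S_def)
  have e: "parab x = (norm x)\<^sup>2 / 2 - ((norm x)\<^sup>2 / 2 - x $ 1) * S"
    by (simp add: parab_def S_def algebra_simps)
  have "0 \<le> ((norm x)\<^sup>2 / 2 - x $ 1) * S" "((norm x)\<^sup>2 / 2 - x $ 1) * S \<le> (norm x)\<^sup>2 / 2 - x $ 1"
    using assms S mult_left_le[of S "(norm x)\<^sup>2 / 2 - x $ 1"] by auto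
  then show "x $ 1 \<le> parab x" "parab x \<le> (norm x)\<^sup>2 / 2" using e by auto
qed

lemma parab_near:
  assumes "x \<noteq> 0" "(norm x)\<^sup>2 / 4 \<le> x $ 1"
  shows "x $ 1 \<le> parab x" "parab x \<le> 2 * x $ 1" "0 < x $ 1"
proof -
  have "0 < (norm x)\<^sup>2" using assms by simp
  then show p: "0 < x $ 1" using assms by linarith
  show "x $ 1 \<le> parab x" "parab x \<le> 2 * x $ 1"
    using parab_transition[of x] parab_inner[of x] assms p \<open>0 < (norm x)\<^sup>2\<close>
    by (cases "x $ 1 \<le> (norm x)\<^sup>2 / 2"; linarith)+
qed

lemma parab_bounds:
  assumes "x \<noteq> 0" "norm x \<le> 5/2"
  shows "(norm x)\<^sup>2 / 4 \<le> parab x" "parab x \<le> 25/8" "0 < parab x"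
proof -
  have n: "0 < (norm x)\<^sup>2" "(norm x)\<^sup>2 \<le> 25/4"
    using assms power_mono[of "norm x" "5/2" 2] by (auto simp: power2_eq_square)
  have x1: "x $ 1 \<le> 5/2" using component_le_norm_cart[of x 1] assms by linarith
  consider "x $ 1 \<le> (norm x)\<^sup>2 / 4" | "(norm x)\<^sup>2 / 4 \<le> x $ 1" "x $ 1 \<le> (norm x)\<^sup>2 / 2"
    | "(norm x)\<^sup>2 / 2 \<le> x $ 1" by linarith
  then have "(norm x)\<^sup>2 / 4 \<le> parab x \<and> parab x \<le> 25/8"
  proof cases
    case 1
    then show ?thesis using parab_outer[OF assms(1) 1] n by linarith
  next
    case 2
    then show ?thesis using parab_transition[of x] n by linarith
  next
    case 3
    then have "parab x = x $ 1" using n by (intro parab_inner[OF assms(1)]) linarith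
    then show ?thesis using 3 n x1 by linarith
  qed
  then show "(norm x)\<^sup>2 / 4 \<le> parab x" "parab x \<le> 25/8" "0 < parab x" using n by linarith+
qed

lemma jet_bound_value: "jet_bound x f a b c \<Longrightarrow> \<bar>f x\<bar> \<le> a' \<Longrightarrow> jet_bound x f a' b c"
  by (simp add: jet_bound_def)

lemma parab_jet_outer:
  assumes "x \<noteq> 0" "x $ 1 < (norm x)\<^sup>2 / 4"
  shows "jet_bound x parab ((norm x)\<^sup>2 / 2) (norm x) 1"
proof (rule jet_bound_cong)
  show "jet_bound x (\<lambda>x. 1/2 * (norm x)\<^sup>2) ((norm x)\<^sup>2 / 2) (norm x) 1"
    using jet_bound_scale[OF jet_bound_power2_norm, of x "1/2"] by simp
  show "open {x :: real ^ 3. x \<noteq> 0 \<and> x $ 1 < (norm x)\<^sup>2 / 4}"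
    by (intro open_Collect_conj open_Collect_neq open_Collect_less continuous_intros) auto
qed (use assms in \<open>auto simp: parab_outer\<close>)

lemma parab_jet_inner:
  assumes "x \<noteq> 0" "3/8 * (norm x)\<^sup>2 < x $ 1"
  shows "jet_bound x parab (parab x) 1 0"
proof (rule jet_bound_cong)
  have "0 \<le> 3/8 * (norm x)\<^sup>2" by simp
  then have "0 \<le> x $ 1" using assms(2) by linarith
  then show "jet_bound x (\<lambda>x. x $ 1) (parab x) 1 0"
    using jet_bound_component[of x 1] parab_inner[of x] assms by simp
  show "open {x :: real ^ 3. x \<noteq> 0 \<and> 3/8 * (norm x)\<^sup>2 < x $ 1}"
    by (intro open_Collect_conj open_Collect_neq open_Collect_less continuous_intros) auto
qed (use assms in \<open>auto simp: parab_inner\<close>)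

lemma parab_jet_transition:
  obtains C where "1 \<le> C" "\<And>x. x \<noteq> 0 \<Longrightarrow> norm x \<le> 5/2 \<Longrightarrow> (norm x)\<^sup>2 / 4 \<le> x $ 1 \<Longrightarrow>
    x $ 1 \<le> (norm x)\<^sup>2 / 2 \<Longrightarrow> jet_bound x parab (parab x) C (C * (inverse (norm x))\<^sup>2)"
proof -
  obtain M where M: "1 \<le> M" "\<And>(x :: real ^ 3) f a b c. jet_bound x f a b c \<Longrightarrow>
    jet_bound x (\<lambda>x. smooth_step (f x)) 1 (M * b) (M * b\<^sup>2 + M * c)"
    using jet_bound_smooth_step by metis
  define C1 where "C1 = 856 * M"
  have C1: "1 \<le> C1" using M by (simp add: C1_def)
  show ?thesis
  proof (rule that[of "13 + 9 * C1"])
    fix x :: "real ^ 3"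
    assume x: "x \<noteq> 0" "norm x \<le> 5/2" "(norm x)\<^sup>2 / 4 \<le> x $ 1" "x $ 1 \<le> (norm x)\<^sup>2 / 2"
    define r where "r = norm x"
    define v where "v = inverse r"
    have r: "0 < r" "r \<le> 5/2" using x by (auto simp: r_def)
    have v: "0 < v" "2/5 \<le> v" using r by (auto simp: v_def field_simps)
    have rv: "r * v = 1" using r by (simp add: v_def)
    have rv': "r * (v * z) = z" for z using rv by (simp add: mult.assoc[symmetric])
    have N: "jet_bound x (\<lambda>x. (norm x)\<^sup>2) (r\<^sup>2) (2 * r) 2"
      unfolding r_def by (rule jet_bound_power2_norm)
    have inv: "jet_bound x (\<lambda>x. inverse ((norm x)\<^sup>2)) (v^2) (2 * v^3) (10 * v^4)"
    proof (rule jet_bound_mono[OF jet_bound_compose[OF N, of "{0<..}" inverse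
          "\<lambda>s. - (inverse s * inverse s)" "2 * inverse ((norm x)\<^sup>2) ^ 3" "v^2" "v^4" "2 * v^6"]])
      show "(inverse has_real_derivative - (inverse s * inverse s)) (at s)" if "s \<in> {0<..}" for s :: real
        using that by (auto intro!: derivative_eq_intros)
      show "((\<lambda>s. - (inverse s * inverse s)) has_real_derivative 2 * inverse ((norm x)\<^sup>2) ^ 3) (at ((norm x)\<^sup>2))"
        using x(1) by (auto intro!: derivative_eq_intros simp: power3_eq_cube)
      show "\<And>k. Ck1 k {0<..} inverse" by (rule Ck1_inverse) auto
      show "v ^ 4 * (2 * r) \<le> 2 * v ^ 3" using rv by (simp add: power_def rv' mult_ac eval_nat_numeral)
      show "2 * v ^ 6 * (2 * r)\<^sup>2 + v ^ 4 * 2 \<le> 10 * v ^ 4"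
        using rv by (simp add: power_mult_distrib eval_nat_numeral mult_ac rv')
    qed (use x r in \<open>auto simp: v_def r_def power_inverse power_mult[symmetric] power2_eq_square eval_nat_numeral\<close>)
    have x1: "jet_bound x (\<lambda>x. x $ 1) r 1 0"
      by (rule jet_bound_mono[OF jet_bound_component]) (auto simp: r_def component_le_norm_cart)
    have u: "jet_bound x (\<lambda>x. x $ 1 * inverse ((norm x)\<^sup>2)) v (3 * v^2) (14 * v^3)"
      by (rule jet_bound_mono[OF jet_bound_mult[OF x1 inv]])
        (auto simp: eval_nat_numeral rv' algebra_simps)
    have u8: "jet_bound x (\<lambda>x. 8 * (x $ 1 * inverse ((norm x)\<^sup>2)) - 2) (8 * v + 2) (24 * v^2) (112 * v^3)"
      using jet_bound_diff[OF jet_bound_scale[OF u, of 8] jet_bound_const[of x 2]] by simp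
    have S: "jet_bound x (\<lambda>x. smooth_step (8 * (x $ 1 * inverse ((norm x)\<^sup>2)) - 2)) 1 (C1 * v^2) (C1 * v^4)"
    proof (rule jet_bound_mono[OF M(2)[OF u8]])
      show "M * (24 * v\<^sup>2) \<le> C1 * v\<^sup>2" using M(1) by (simp add: C1_def)
      have "112 * v^3 \<le> 280 * v^4"
        using mult_right_mono[OF v(2), of "v^3"] v(1) by (simp add: eval_nat_numeral)
      then have "M * (576 * v^4 + 112 * v^3) \<le> M * (856 * v^4)"
        using M(1) by (intro mult_left_mono) auto
      then show "M * (24 * v\<^sup>2)\<^sup>2 + M * (112 * v ^ 3) \<le> C1 * v ^ 4"
        by (simp add: C1_def power_mult_distrib algebra_simps power_mult[symmetric])
    qed simp
    have "jet_bound x (\<lambda>x. x $ 1 - 1/2 * (norm x)\<^sup>2) (r + 1/2 * r\<^sup>2) (1 + r) 1"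
      using jet_bound_diff[OF x1 jet_bound_scale[OF N, of "1/2"]] by simp
    then have "jet_bound x (\<lambda>x. x $ 1 - 1/2 * (norm x)\<^sup>2) (r\<^sup>2) (1 + r) 1"
      by (rule jet_bound_value) (use x(3,4) in \<open>auto simp: r_def\<close>)
    then have p: "jet_bound x (\<lambda>x. x $ 1 - 1/2 * (norm x)\<^sup>2) (r\<^sup>2) 4 1"
      by (rule jet_bound_mono) (use r in auto)
    have pS: "jet_bound x (\<lambda>x. (x $ 1 - 1/2 * (norm x)\<^sup>2) * smooth_step (8 * (x $ 1 * inverse ((norm x)\<^sup>2)) - 2))
        (r\<^sup>2) (4 + C1) (1 + 9 * C1 * v^2)"
      by (rule jet_bound_mono[OF jet_bound_mult[OF p S]])
        (use rv in \<open>auto simp: eval_nat_numeral mult_ac rv' algebra_simps\<close>)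
    have "jet_bound x parab (1/2 * r\<^sup>2 + r\<^sup>2) (r + (4 + C1)) (1 + (1 + 9 * C1 * v^2))"
      using jet_bound_add[OF jet_bound_scale[OF N, of "1/2"] pS] by (simp add: parab_def[abs_def])
    then have "jet_bound x parab (parab x) (r + (4 + C1)) (1 + (1 + 9 * C1 * v^2))"
      by (rule jet_bound_value) (use parab_bounds[OF x(1,2)] in auto)
    then show "jet_bound x parab (parab x) (13 + 9 * C1) ((13 + 9 * C1) * (inverse (norm x))\<^sup>2)"
    proof (rule jet_bound_mono)
      have "(2/5)^2 \<le> v^2" using v by (intro power_mono) auto
      then have "1 + (1 + 9 * C1 * v^2) \<le> (13 + 9 * C1) * v\<^sup>2"
        by (simp add: power2_eq_square algebra_simps)
      then show "1 + (1 + 9 * C1 * v^2) \<le> (13 + 9 * C1) * (inverse (norm x))\<^sup>2"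
        by (simp add: v_def r_def)
    qed (use r C1 in auto)
  qed (use C1 in auto)
qed

lemma parab_jet_near:
  obtains C where "1 \<le> C" "\<And>x. x \<noteq> 0 \<Longrightarrow> norm x \<le> 5/2 \<Longrightarrow> (norm x)\<^sup>2 / 4 \<le> x $ 1 \<Longrightarrow>
    jet_bound x parab (parab x) C (C / parab x)"
proof -
  obtain C where C: "1 \<le> C" "\<And>x. x \<noteq> 0 \<Longrightarrow> norm x \<le> 5/2 \<Longrightarrow> (norm x)\<^sup>2 / 4 \<le> x $ 1 \<Longrightarrow>
    x $ 1 \<le> (norm x)\<^sup>2 / 2 \<Longrightarrow> jet_bound x parab (parab x) C (C * (inverse (norm x))\<^sup>2)"
    using parab_jet_transition by metis
  show ?thesis
  proof (rule that[OF C(1)])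
    fix x :: "real ^ 3"
    assume x: "x \<noteq> 0" "norm x \<le> 5/2" "(norm x)\<^sup>2 / 4 \<le> x $ 1"
    note b = parab_bounds[OF x(1,2)]
    show "jet_bound x parab (parab x) C (C / parab x)"
    proof (cases "x $ 1 \<le> (norm x)\<^sup>2 / 2")
      case True
      have "parab x \<le> (norm x)\<^sup>2" using parab_transition(2)[OF True] by (rule order_trans) simp
      then have "(inverse (norm x))\<^sup>2 \<le> inverse (parab x)"
        using b unfolding power_inverse by (intro le_imp_inverse_le) auto
      then have "C * (inverse (norm x))\<^sup>2 \<le> C / parab x"
        using C(1) unfolding divide_inverse by (intro mult_left_mono) auto
      then show ?thesis using jet_bound_mono[OF C(2)[OF x True]] by simp
    next
      case False
      then have "3/8 * (norm x)\<^sup>2 < x $ 1" using x(1) zero_le_power2[of "norm x"] by linarith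
      from parab_jet_inner[OF x(1) this] show ?thesis
        by (rule jet_bound_mono) (use C b in auto)
    qed
  qed
qed

definition slope_weight :: "real \<Rightarrow> real ^ 3 \<Rightarrow> real" where
  "slope_weight a x = (if (norm x)\<^sup>2 / 4 \<le> x $ 1 then log_slope a (parab x) / parab x else 0)"

lemma log_profile_bounds:
  assumes "0 < a" "a < 1"
  obtains K \<Lambda> where "1 \<le> K" "1 \<le> \<Lambda>"
    "\<And>x. x \<noteq> 0 \<Longrightarrow> norm x \<le> 5/2 \<Longrightarrow> log_slope a (parab x) \<le> \<Lambda>"
    "\<And>x. x \<noteq> 0 \<Longrightarrow> norm x \<le> 5/2 \<Longrightarrow> \<bar>log_mean a (parab x)\<bar> \<le> K * inverse (norm x)"
proof -
  obtain K where K: "0 < K" "\<And>s. s \<noteq> 0 \<Longrightarrow> \<bar>s\<bar> \<le> 4 \<Longrightarrow> log_weight a s \<le> K * \<bar>s\<bar> powr (-1/4)"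
    using log_weight_bound[of a 4] assms by auto
  define \<Lambda> where "\<Lambda> = max 1 (ln (32/25) powr (a - 1))"
  have sl: "log_slope a (parab x) \<le> \<Lambda>" if x: "x \<noteq> 0" "norm x \<le> 5/2" for x
  proof -
    note b = parab_bounds[OF x]
    have "ln (32/25) \<le> ln (4 / parab x)" using b by (intro ln_mono) (auto simp: field_simps)
    then have "ln (4 / parab x) powr (a - 1) \<le> ln (32/25) powr (a - 1)"
      using assms by (intro powr_mono2') auto
    then show ?thesis by (simp add: log_slope_def \<Lambda>_def)
  qed
  show ?thesis
  proof (rule that[of "1 + 4 * K + 5/2 * \<Lambda>" \<Lambda>])
    fix x :: "real ^ 3" assume x: "x \<noteq> 0" "norm x \<le> 5/2"
    note b = parab_bounds[OF x]
    define y where "y = norm x / 2"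
    have y: "0 < y" "y \<le> 5/4" using x by (auto simp: y_def)
    have "parab x powr (-1/4) \<le> (y\<^sup>2) powr (-1/4)"
      using b(1) y by (intro powr_mono2') (auto simp: y_def power_divide)
    also have "\<dots> = (y powr 2) powr (-1/4)" using y by simp
    also have "\<dots> = y powr (-1/2)" unfolding powr_powr by simp
    also have "\<dots> = y powr (1/2) / y"
      using y powr_diff[of y "1/2" 1] by simp
    also have "\<dots> \<le> 2 / y"
    proof (intro divide_right_mono)
      have "y powr (1/2) = sqrt y" using y by (simp add: powr_half_sqrt)
      also have "\<dots> \<le> sqrt 4" using y by (intro real_sqrt_le_mono) auto
      finally show "y powr (1/2) \<le> 2" by simp
    qed (use y in auto)
    finally have "parab x powr (-1/4) \<le> 4 * inverse (norm x)"
      by (simp add: y_def field_simps)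
    then have "K * parab x powr (-1/4) \<le> K * (4 * inverse (norm x))"
      using K(1) by (intro mult_left_mono) auto
    moreover have "log_weight a (parab x) \<le> K * parab x powr (-1/4)"
      using K(2)[of "parab x"] b by auto
    moreover have "log_slope a (parab x) \<le> 5/2 * \<Lambda> * inverse (norm x)"
    proof -
      have "\<Lambda> * 1 \<le> \<Lambda> * (5/2 * inverse (norm x))"
        using x by (intro mult_left_mono) (auto simp: field_simps \<Lambda>_def)
      then show ?thesis using sl[OF x] by simp
    qed
    moreover have "\<bar>log_mean a (parab x)\<bar> \<le> log_weight a (parab x) + log_slope a (parab x)"
      using b assms by (intro log_mean_derivative_bounds) auto
    moreover have "0 < inverse (norm x)" using x by simp
    ultimately show "\<bar>log_mean a (parab x)\<bar> \<le> (1 + 4 * K + 5/2 * \<Lambda>) * inverse (norm x)"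
      unfolding distrib_right by argo
  qed (use K sl in \<open>auto simp: \<Lambda>_def\<close>)
qed

lemma jet_bound_log_mean:
  assumes "0 < a" "a < 1" "jet_bound x f A b c" "0 < f x" "f x < 4"
  shows "jet_bound x (\<lambda>x. log_mean a (f x)) \<bar>log_mean a (f x)\<bar> (log_slope a (f x) / f x * b)
    (log_slope a (f x) / (f x)\<^sup>2 * b\<^sup>2 + log_slope a (f x) / f x * c)"
proof -
  have fx: "f x \<in> {0<..<4}" using assms by simp
  show ?thesis
    by (rule jet_bound_compose[OF assms(3) open_greaterThanLessThan fx Ck1_log_mean[OF assms(1,2)]
          log_mean_has_derivative log_mean_has_derivative2[OF assms(1,2,4,5)] order_refl
          log_mean_derivative_bounds(2,3)[OF assms(1,2,4,5)]])
      (use assms in auto)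
qed

definition ext_core :: "real \<Rightarrow> real ^ 3 \<Rightarrow> real" where
  "ext_core a x = x $ 1 * log_mean a (parab x)"

lemma ext_core_jet:
  assumes a: "0 < a" "a < 1"
  obtains C where "0 \<le> C" "\<And>x. x \<noteq> 0 \<Longrightarrow> norm x \<le> 5/2 \<Longrightarrow>
    jet_bound x (ext_core a) (C * inverse (norm x)) (C * inverse (norm x))
      (C * (inverse (norm x) + slope_weight a x))"
proof -
  obtain K \<Lambda> where K: "1 \<le> K" "1 \<le> \<Lambda>"
    "\<And>x. x \<noteq> 0 \<Longrightarrow> norm x \<le> 5/2 \<Longrightarrow> log_slope a (parab x) \<le> \<Lambda>"
    "\<And>x. x \<noteq> 0 \<Longrightarrow> norm x \<le> 5/2 \<Longrightarrow> \<bar>log_mean a (parab x)\<bar> \<le> K * inverse (norm x)"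
    using log_profile_bounds[OF a] by metis
  obtain D where D: "1 \<le> D" "\<And>x. x \<noteq> 0 \<Longrightarrow> norm x \<le> 5/2 \<Longrightarrow> (norm x)\<^sup>2 / 4 \<le> x $ 1 \<Longrightarrow>
    jet_bound x parab (parab x) D (D / parab x)"
    using parab_jet_near by metis
  define C where "C = 4 * K + 5 * (D * \<Lambda>) + 10 * \<Lambda> + 4 * D\<^sup>2"
  have Cge: "4 * K \<le> C" "K + 5/2 * (D * \<Lambda>) \<le> C" "4 * D\<^sup>2 \<le> C" "K + 5 * \<Lambda> \<le> C" "10 * \<Lambda> \<le> C" "0 \<le> C"
    using K D by (auto simp: C_def)
  show ?thesis
  proof (rule that[OF Cge(6)])
    fix x :: "real ^ 3" assume x: "x \<noteq> 0" "norm x \<le> 5/2"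
    define v where "v = inverse (norm x)"
    define q where "q = parab x"
    define L where "L = log_slope a q"
    define m where "m = \<bar>log_mean a q\<bar>"
    have v: "0 < v" "1 \<le> 5/2 * v" using x by (auto simp: v_def field_simps)
    have rv: "norm x * v = 1" using x by (simp add: v_def)
    have q: "0 < q" "q \<le> 25/8" using parab_bounds[OF x] by (auto simp: q_def)
    have L: "0 \<le> L" "L \<le> \<Lambda>" using K(3)[OF x] log_slope_nonneg by (auto simp: L_def q_def)
    have m: "0 \<le> m" "m \<le> K * v" using K(4)[OF x] by (auto simp: m_def q_def v_def)
    have Cv: "c * v \<le> C * v" if "c \<le> C" for c using that v by (intro mult_right_mono) auto
    show "jet_bound x (ext_core a) (C * inverse (norm x)) (C * inverse (norm x))
      (C * (inverse (norm x) + slope_weight a x))"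
      unfolding v_def[symmetric] ext_core_def[abs_def]
    proof (cases "(norm x)\<^sup>2 / 4 \<le> x $ 1")
      case True
      have x1: "jet_bound x (\<lambda>x. x $ 1) q 1 0"
        by (rule jet_bound_mono[OF jet_bound_component]) (use parab_near[OF x(1) True] in \<open>auto simp: q_def\<close>)
      have "jet_bound x (\<lambda>x. log_mean a (parab x)) m (L / q * D) (L / q\<^sup>2 * D\<^sup>2 + L / q * (D / q))"
        using jet_bound_log_mean[OF a D(2)[OF x True]] q by (simp add: q_def L_def m_def)
      from jet_bound_mult[OF x1 this]
      have "jet_bound x (\<lambda>x. x $ 1 * log_mean a (parab x)) (q * m) (1 * m + q * (L / q * D))
         (0 * m + 2 * (1 * (L / q * D)) + q * (L / q\<^sup>2 * D\<^sup>2 + L / q * (D / q)))" .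
      then show "jet_bound x (\<lambda>x. x $ 1 * log_mean a (parab x)) (C * v) (C * v) (C * (v + slope_weight a x))"
      proof (rule jet_bound_mono)
        have "q * m \<le> 4 * (K * v)" using q m by (intro mult_mono) auto
        then show "q * m \<le> C * v" using Cv[OF Cge(1)] by simp
        have "D * L * 1 \<le> D * \<Lambda> * (5/2 * v)" using D L v K by (intro mult_mono) auto
        then have "1 * m + q * (L / q * D) \<le> (K + 5/2 * (D * \<Lambda>)) * v"
          using m q by (simp add: algebra_simps)
        then show "1 * m + q * (L / q * D) \<le> C * v" using Cv[OF Cge(2)] by simp
        have "0 * m + 2 * (1 * (L / q * D)) + q * (L / q\<^sup>2 * D\<^sup>2 + L / q * (D / q))
            = (3 * D + D\<^sup>2) * (L / q)"
          using q by (simp add: field_simps power2_eq_square)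
        also have "\<dots> \<le> C * (L / q)"
        proof (rule mult_right_mono)
          have "D * 1 \<le> D * D" using D(1) by (intro mult_left_mono) auto
          then show "3 * D + D\<^sup>2 \<le> C" using Cge(3) unfolding power2_eq_square by linarith
        qed (use q L in auto)
        also have "\<dots> \<le> C * (v + slope_weight a x)"
          using True v Cge(6) by (intro mult_left_mono) (auto simp: slope_weight_def L_def q_def)
        finally show "0 * m + 2 * (1 * (L / q * D)) + q * (L / q\<^sup>2 * D\<^sup>2 + L / q * (D / q))
            \<le> C * (v + slope_weight a x)" .
      qed
    next
      case False
      let ?r = "norm x"
      have qr: "q = ?r\<^sup>2 / 2" using parab_outer[of x] False x(1) by (simp add: q_def)
      have x1: "jet_bound x (\<lambda>x. x $ 1) ?r 1 0"
        by (rule jet_bound_mono[OF jet_bound_component]) (auto simp: component_le_norm_cart)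
      have "jet_bound x (\<lambda>x. log_mean a (parab x)) m (L / q * ?r) (L / q\<^sup>2 * ?r\<^sup>2 + L / q * 1)"
        using jet_bound_log_mean[OF a parab_jet_outer[OF x(1)]] q False by (simp add: q_def L_def m_def)
      from jet_bound_mult[OF x1 this]
      have "jet_bound x (\<lambda>x. x $ 1 * log_mean a (parab x)) (?r * m) (1 * m + ?r * (L / q * ?r))
         (0 * m + 2 * (1 * (L / q * ?r)) + ?r * (L / q\<^sup>2 * ?r\<^sup>2 + L / q * 1))" .
      then show "jet_bound x (\<lambda>x. x $ 1 * log_mean a (parab x)) (C * v) (C * v) (C * (v + slope_weight a x))"
      proof (rule jet_bound_mono)
        have "?r * m \<le> 4 * (K * v)" using x m by (intro mult_mono) auto
        then show "?r * m \<le> C * v" using Cv[OF Cge(1)] by simp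
        have "?r * (L / q * ?r) = 2 * L" using x(1) by (simp add: qr power2_eq_square)
        moreover have "L * 1 \<le> \<Lambda> * (5/2 * v)" using L v K by (intro mult_mono) auto
        ultimately have "1 * m + ?r * (L / q * ?r) \<le> (K + 5 * \<Lambda>) * v"
          using m by (simp add: algebra_simps)
        then show "1 * m + ?r * (L / q * ?r) \<le> C * v" using Cv[OF Cge(4)] by simp
        have "0 * m + 2 * (1 * (L / q * ?r)) + ?r * (L / q\<^sup>2 * ?r\<^sup>2 + L / q * 1) = 10 * L * v"
          using x(1) by (simp add: qr v_def power2_eq_square field_simps)
        also have "\<dots> \<le> 10 * \<Lambda> * v" using L v by simp
        also have "\<dots> \<le> C * v" by (rule Cv[OF Cge(5)])
        also have "\<dots> \<le> C * (v + slope_weight a x)" using False by (simp add: slope_weight_def)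
        finally show "0 * m + 2 * (1 * (L / q * ?r)) + ?r * (L / q\<^sup>2 * ?r\<^sup>2 + L / q * 1)
            \<le> C * (v + slope_weight a x)" .
      qed
    qed
  qed
qed

lemma smooth_on_local:
  assumes "\<And>x. x \<in> S \<Longrightarrow> \<exists>U. open U \<and> x \<in> U \<and> smooth_on U f"
  shows "smooth_on S f"
proof -
  have "Ck_on k S f" if "\<And>x. x \<in> S \<Longrightarrow> \<exists>U. open U \<and> x \<in> U \<and> smooth_on U f" for k f
    using that
  proof (induction k arbitrary: f)
    case 0
    have "isCont f x" if "x \<in> S" for x
      using 0[OF that] smooth_on_continuous_on by (metis continuous_on_eq_continuous_at)
    then show ?case by (simp add: continuous_at_imp_continuous_on)
  next
    case (Suc k)
    have "f differentiable (at x)" if "x \<in> S" for x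
      using Suc.prems[OF that] smooth_on_differentiable by blast
    moreover have "Ck_on k S (partial i f)" for i
      by (rule Suc.IH) (use Suc.prems smooth_on_partial in blast)
    ultimately show ?case by simp
  qed
  with assms show ?thesis unfolding smooth_on_def[of S] by blast
qed

definition cutoff :: "real \<Rightarrow> real \<Rightarrow> real ^ 'n \<Rightarrow> real" where
  "cutoff a b x = 1 - smooth_step (inverse (b - a) * ((norm x)\<^sup>2 - a))"

lemma cutoff_eq_1: "a < b \<Longrightarrow> (norm x)\<^sup>2 \<le> a \<Longrightarrow> cutoff a b x = 1"
  by (simp add: cutoff_def smooth_step_eq_0 mult_nonneg_nonpos)

lemma cutoff_eq_0: "a < b \<Longrightarrow> b \<le> (norm x)\<^sup>2 \<Longrightarrow> cutoff a b x = 0"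
  by (simp add: cutoff_def smooth_step_eq_1 field_simps)

lemma cutoff_bounds: "0 \<le> cutoff a b x" "cutoff a b x \<le> 1"
  using smooth_step_bounds by (auto simp: cutoff_def)

lemma smooth_on_cutoff:
  fixes a b :: real
  shows "smooth_on (UNIV :: (real ^ 'n) set) (cutoff a b)"
proof -
  have "smooth_on UNIV (\<lambda>x :: real ^ 'n. inverse (b - a) * ((norm x)\<^sup>2 - a))"
    by (rule smooth_on_mult[OF smooth_on_const smooth_on_diff[OF smooth_on_power2_norm smooth_on_const]]) auto
  then have "smooth_on UNIV (\<lambda>x :: real ^ 'n. smooth_step (inverse (b - a) * ((norm x)\<^sup>2 - a)))"
    by (rule smooth_on_compose[OF Ck1_smooth_step[of _ UNIV]]) auto
  from smooth_on_diff[OF smooth_on_const this, of 1] show ?thesis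
    by (simp add: cutoff_def[abs_def])
qed

lemma cutoff_jet:
  assumes "a < b" "0 \<le> M"
  obtains C where "0 \<le> C" "\<And>x :: real ^ 'n. norm x \<le> M \<Longrightarrow> jet_bound x (cutoff a b) C C C"
proof -
  obtain M' where M': "1 \<le> M'" "\<And>(x :: real ^ 'n) f a b c. jet_bound x f a b c \<Longrightarrow>
    jet_bound x (\<lambda>x. smooth_step (f x)) 1 (M' * b) (M' * b\<^sup>2 + M' * c)"
    using jet_bound_smooth_step by metis
  define d where "d = inverse (b - a)"
  have d: "0 \<le> d" using assms by (simp add: d_def)
  define b1 where "b1 = M' * (d * (2 * M))"
  define c1 where "c1 = M' * (d * (2 * M))\<^sup>2 + M' * (d * 2)"
  have nn: "0 \<le> b1" "0 \<le> c1" using M' d assms by (auto simp: b1_def c1_def)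
  show ?thesis
  proof (rule that[of "2 + b1 + c1"])
    fix x :: "real ^ 'n" assume x: "norm x \<le> M"
    have "jet_bound x (\<lambda>x. d * ((norm x)\<^sup>2 - a)) (\<bar>d\<bar> * ((norm x)\<^sup>2 + \<bar>a\<bar>)) (\<bar>d\<bar> * (2 * norm x + 0)) (\<bar>d\<bar> * (2 + 0))"
      by (rule jet_bound_scale[OF jet_bound_diff[OF jet_bound_power2_norm jet_bound_const]])
    then have "jet_bound x (\<lambda>x. d * ((norm x)\<^sup>2 - a)) (\<bar>d\<bar> * ((norm x)\<^sup>2 + \<bar>a\<bar>)) (d * (2 * M)) (d * 2)"
      by (rule jet_bound_mono) (use d x in \<open>simp_all add: mult_left_mono\<close>)
    from jet_bound_diff[OF jet_bound_const M'(2)[OF this], of 1]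
    have "jet_bound x (cutoff a b) (1 + 1) (0 + b1) (0 + c1)"
      by (simp add: cutoff_def[abs_def] d_def b1_def c1_def)
    then show "jet_bound x (cutoff a b) (2 + b1 + c1) (2 + b1 + c1) (2 + b1 + c1)"
      by (rule jet_bound_mono) (use nn in auto)
  qed (use nn in auto)
qed

lemma supp_cutoff_mult:
  assumes "a < b" "0 \<le> R" "b \<le> R\<^sup>2"
  shows "supp (\<lambda>x. cutoff a b x * f x) \<subseteq> cball 0 R"
  unfolding supp_def
proof (rule closure_minimal)
  show "{x. cutoff a b x * f x \<noteq> 0} \<subseteq> cball 0 R"
  proof
    fix x assume "x \<in> {x. cutoff a b x * f x \<noteq> 0}"
    then have "\<not> b \<le> (norm x)\<^sup>2" using cutoff_eq_0[OF assms(1), of x] by auto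
    then have "(norm x)\<^sup>2 < R\<^sup>2" using assms by linarith
    then have "norm x < R" using assms(2) by (rule power2_less_imp_less)
    then show "x \<in> cball 0 R" by simp
  qed
qed simp

subsection \<open>Square integrability of the weights\<close>

lemma L2_fun_inverse_norm:
  "L2_fun (\<lambda>x :: real ^ 3. if norm x \<le> M then inverse (norm x) else 0)"
proof (rule L2_funI_nn_integral)
  let ?f = "\<lambda>x :: real ^ 3. if norm x \<le> M then inverse (norm x) else 0"
  define h where "h s = indicator {-M..M} s * \<bar>s\<bar> powr (-2/3)" for s :: real
  have h0: "0 \<le> h s" for s by (simp add: h_def)
  have hm: "(\<lambda>s. ennreal (h s)) \<in> borel_measurable borel" unfolding h_def by measurable
  show "?f \<in> borel_measurable borel" by measurable
  have "AE x in lborel. \<forall>b\<in>Basis. (x :: real ^ 3) \<bullet> b \<noteq> 0"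
    by (rule AE_finite_allI[OF finite_Basis]) (rule AE_lborel_inner_neq)
  then have "AE x in lborel. ennreal ((?f x)\<^sup>2) \<le> (\<Prod>b\<in>Basis. ennreal (h ((x :: real ^ 3) \<bullet> b)))"
  proof eventually_elim
    case (elim x)
    have "(?f x)\<^sup>2 \<le> (\<Prod>b\<in>Basis. h (x \<bullet> b))"
    proof (cases "norm x \<le> M")
      case True
      have x0: "0 < norm x" using elim by (metis inner_zero_left nonempty_Basis ex_in_conv zero_less_norm_iff)
      have le: "\<bar>x \<bullet> b\<bar> \<le> norm x" if "b \<in> Basis" for b
        using Basis_le_norm[OF that] .
      have "(?f x)\<^sup>2 = (\<Prod>b\<in>(Basis :: (real ^ 3) set). norm x powr (-2/3))"
      proof -
        have "(norm x powr (-2/3)) ^ 3 = norm x powr (-2)"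
          using x0 by (simp add: powr_powr flip: powr_numeral)
        also have "\<dots> = (inverse (norm x))\<^sup>2"
          using x0 by (simp add: powr_minus power_inverse)
        finally show ?thesis using True by simp
      qed
      also have "\<dots> \<le> (\<Prod>b\<in>Basis. h (x \<bullet> b))"
      proof (rule prod_mono)
        fix b :: "real ^ 3" assume b: "b \<in> Basis"
        have "norm x powr (-2/3) \<le> \<bar>x \<bullet> b\<bar> powr (-2/3)"
          using le[OF b] elim b by (intro powr_mono2') auto
        moreover have "x \<bullet> b \<in> {-M..M}" using le[OF b] True by auto
        ultimately show "0 \<le> norm x powr (-2/3) \<and> norm x powr (-2/3) \<le> h (x \<bullet> b)"
          by (simp add: h_def)
      qed
      finally show ?thesis .
    qed (simp add: prod_nonneg h0)
    then show ?case by (simp add: prod_ennreal h0 ennreal_leI)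
  qed
  then have "(\<integral>\<^sup>+x. ennreal ((?f x)\<^sup>2) \<partial>lborel) \<le> (\<integral>\<^sup>+x. (\<Prod>b\<in>Basis. ennreal (h ((x :: real ^ 3) \<bullet> b))) \<partial>lborel)"
    by (rule nn_integral_mono_AE)
  also have "\<dots> = (\<Prod>b\<in>(Basis :: (real ^ 3) set). (\<integral>\<^sup>+s. ennreal (h s) \<partial>lborel))"
    by (rule nn_integral_lborel_prod) (use hm in auto)
  also have "\<dots> < \<infinity>"
    using nn_integral_abs_powr_finite[of "-2/3" M] by (simp add: h_def less_top[symmetric] power_eq_top_ennreal)
  finally show "(\<integral>\<^sup>+x. ennreal ((?f x)\<^sup>2) \<partial>lborel) < \<infinity>" .
qed

lemma emeasure_centered_cbox:
  fixes c :: "real ^ 'n"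
  assumes "\<And>i. 0 \<le> d i"
  shows "emeasure lborel (cbox (\<chi> i. c $ i - d i) (\<chi> i. c $ i + d i)) = ennreal (\<Prod>i\<in>UNIV. 2 * d i)"
proof -
  have "c \<in> cbox (\<chi> i. c $ i - d i) (\<chi> i. c $ i + d i)"
    using assms by (simp add: mem_box_cart)
  then have "cbox (\<chi> i. c $ i - d i) (\<chi> i. c $ i + d i) \<noteq> {}" by blast
  from content_cbox_cart[OF this]
  have "measure lborel (cbox (\<chi> i. c $ i - d i) (\<chi> i. c $ i + d i)) = (\<Prod>i\<in>UNIV. 2 * d i)"
    by simp
  then show ?thesis
    using emeasure_lborel_cbox_finite[of "\<chi> i. c $ i - d i" "\<chi> i. c $ i + d i"]
    by (subst emeasure_eq_ennreal_measure) (auto simp: less_top[symmetric])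
qed

lemma parab_borel[measurable]: "parab \<in> borel_measurable borel"
proof -
  have [measurable]: "smooth_step \<in> borel_measurable borel"
    using Ck1_continuous_on[OF Ck1_smooth_step] by (rule borel_measurable_continuous_onI)
  have [measurable]: "(\<lambda>x :: real ^ 3. x $ 1) \<in> borel_measurable borel"
    by (intro borel_measurable_continuous_onI continuous_intros)
  show ?thesis unfolding parab_def[abs_def] by measurable
qed

lemma slope_weight_borel[measurable]: "slope_weight a \<in> borel_measurable borel"
proof -
  have [measurable]: "(\<lambda>x :: real ^ 3. x $ 1) \<in> borel_measurable borel"
    by (intro borel_measurable_continuous_onI continuous_intros)
  show ?thesis unfolding slope_weight_def[abs_def] log_slope_def by measurable
qed

text \<open>On the dyadic piece \<open>4 / 2\<^sup>k\<^sup>+\<^sup>1 < parab x \<le> 4 / 2\<^sup>k\<close> the region \<open>|x|\<^sup>2 \<le> 4 x\<^sub>1\<close> has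
  volume of order \<open>4\<^sup>-\<^sup>k\<close> while the weight squared is of order \<open>4\<^sup>k k\<^sup>2\<^sup>a\<^sup>-\<^sup>2\<close>; this is where
  \<open>a < 1/2\<close> is needed.\<close>

lemma L2_fun_slope_weight:
  assumes a: "0 < a" "a < 1/2"
  shows "L2_fun (\<lambda>x. if norm x \<le> 5/2 then slope_weight a x else 0)"
proof (rule L2_funI_nn_integral)
  let ?f = "\<lambda>x. if norm x \<le> 5/2 then slope_weight a x else 0"
  define c where "c = min (ln (32/25)) (ln 2 / 2 :: real)"
  have c: "0 < c" "c \<le> ln (32/25)" "2 * c \<le> ln 2" by (auto simp: c_def)
  define d :: "nat \<Rightarrow> 3 \<Rightarrow> real" where "d k i = (if i = 1 then 4 / 2^k else 4 / sqrt (2^k))" for k i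
  define Q where "Q k = cbox (\<chi> i. (0 :: real ^ 3) $ i - d k i) (\<chi> i. (0 :: real ^ 3) $ i + d k i)" for k
  define w where "w k = (c * real (Suc k)) powr (2 * a - 2) * 4^k" for k
  have w0: "0 \<le> w k" for k by (simp add: w_def)
  show "?f \<in> borel_measurable borel" by measurable
  have "ennreal ((?f x)\<^sup>2) \<le> (\<Sum>k. ennreal (w k) * indicator (Q k) x)" for x
  proof (cases "x \<noteq> 0 \<and> norm x \<le> 5/2 \<and> (norm x)\<^sup>2 / 4 \<le> x $ 1")
    case True
    then have x: "x \<noteq> 0" "norm x \<le> 5/2" "(norm x)\<^sup>2 / 4 \<le> x $ 1" by auto
    define q where "q = parab x"
    have q: "0 < q" "q \<le> 25/8" "x $ 1 \<le> q" "0 < x $ 1"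
      using parab_bounds[OF x(1,2)] parab_near[OF x(1,3)] by (auto simp: q_def)
    define y where "y = 4 / q"
    have y: "32/25 \<le> y" using q by (simp add: y_def field_simps)
    define k where "k = nat \<lfloor>log 2 y\<rfloor>"
    have "0 \<le> log 2 y" using y by simp
    then have k: "real k \<le> log 2 y" "log 2 y < real k + 1" unfolding k_def by linarith+
    have k1: "2 ^ k \<le> y" using k(1) y by (simp add: le_log_iff powr_realpow)
    have k2: "y \<le> 2 * 2 ^ k"
    proof -
      have "y < 2 powr (real k + 1)" using k(2) y by (simp add: log_less_iff)
      then show ?thesis by (simp add: powr_add powr_realpow)
    qed
    have L: "c * real (Suc k) \<le> ln y"
    proof (cases k)
      case 0
      have "ln (32/25) \<le> ln y" using y by (intro ln_mono) auto
      then show ?thesis using c 0 by simp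
    next
      case (Suc n)
      have "c * real (Suc k) \<le> 2 * c * real k" using c(1) Suc by simp
      also have "\<dots> \<le> ln 2 * real k" using c by (intro mult_right_mono) auto
      also have "\<dots> = ln (2 ^ k)" by (simp add: ln_realpow)
      also have "\<dots> \<le> ln y" using k1 by (intro ln_mono) auto
      finally show ?thesis .
    qed
    have "(log_slope a q)\<^sup>2 = ln y powr (2 * a - 2)"
      by (simp add: log_slope_def y_def power2_eq_square powr_add[symmetric])
    also have "\<dots> \<le> (c * real (Suc k)) powr (2 * a - 2)"
      using L c a by (intro powr_mono2') auto
    finally have S: "(log_slope a q)\<^sup>2 \<le> (c * real (Suc k)) powr (2 * a - 2)" .
    have "1 / q \<le> 2 ^ k" using k2 q by (simp add: y_def field_simps)
    then have "(1 / q)\<^sup>2 \<le> (2 ^ k)\<^sup>2" using q by (intro power_mono) auto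
    also have "(2 ^ k)\<^sup>2 = (4 :: real) ^ k" by (simp add: power2_eq_square flip: power_mult_distrib)
    finally have "(log_slope a q)\<^sup>2 * (1 / q)\<^sup>2 \<le> w k"
      unfolding w_def using S by (intro mult_mono) auto
    moreover have "?f x = log_slope a q * (1 / q)"
      using x by (simp add: slope_weight_def q_def)
    ultimately have fw: "(?f x)\<^sup>2 \<le> w k" by (simp only: power_mult_distrib)
    have qk: "q \<le> 4 / 2 ^ k" using k1 q by (simp add: y_def field_simps)
    have "x \<in> Q k"
    proof -
      have "\<bar>x $ i\<bar> \<le> d k i" for i
      proof (cases "i = 1")
        case True
        then show ?thesis using q qk by (simp add: d_def)
      next
        case False
        have "(norm x)\<^sup>2 \<le> 16 / 2 ^ k" using x(3) q qk by linarith
        then have "norm x \<le> sqrt (16 / 2 ^ k)" by (rule real_le_rsqrt)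
        also have "\<dots> = d k i" using False by (simp add: d_def real_sqrt_divide)
        finally show ?thesis using component_le_norm_cart[of x i] by linarith
      qed
      then show ?thesis unfolding Q_def by (auto simp: mem_box_cart abs_le_iff minus_le_iff)
    qed
    then have "ennreal ((?f x)\<^sup>2) \<le> ennreal (w k) * indicator (Q k) x"
      using fw by (simp add: ennreal_leI)
    also have "\<dots> \<le> (\<Sum>j. ennreal (w j) * indicator (Q j) x)"
    proof -
      have "F k \<le> suminf F" for F :: "nat \<Rightarrow> ennreal"
        using sum_le_suminf[of F "{k}"] by simp
      then show ?thesis .
    qed
    finally show ?thesis .
  next
    case False
    then have "?f x = 0" by (cases "x = 0") (auto simp: slope_weight_def parab_def)
    then show ?thesis by simp
  qed
  then have "(\<integral>\<^sup>+x. ennreal ((?f x)\<^sup>2) \<partial>lborel) \<le> (\<integral>\<^sup>+x. (\<Sum>k. ennreal (w k) * indicator (Q k) x) \<partial>lborel)"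
    by (intro nn_integral_mono)
  also have "\<dots> = (\<Sum>k. (\<integral>\<^sup>+x. ennreal (w k) * indicator (Q k) x \<partial>lborel))"
    by (rule nn_integral_suminf) (simp add: Q_def)
  also have "\<dots> = (\<Sum>k. ennreal (512 * c powr (2 * a - 2) * real (Suc k) powr (2 * a - 2)))"
  proof (rule suminf_cong)
    fix k
    have d0: "0 \<le> d k i" for i by (simp add: d_def)
    have "(\<integral>\<^sup>+x. ennreal (w k) * indicator (Q k) x \<partial>lborel) = ennreal (w k) * emeasure lborel (Q k)"
      by (rule nn_integral_cmult_indicator) (simp add: Q_def)
    also have "emeasure lborel (Q k) = ennreal (\<Prod>i\<in>UNIV. 2 * d k i)"
      unfolding Q_def by (rule emeasure_centered_cbox[OF d0])
    also have "(\<Prod>i\<in>UNIV. 2 * d k i) = 512 / 4 ^ k"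
    proof -
      have "2 ^ k * (sqrt (2 ^ k) * sqrt (2 ^ k)) = (4 :: real) ^ k"
        by (simp flip: power_mult_distrib)
      moreover have "(\<Prod>i\<in>UNIV. 2 * d k i) = 512 / (2 ^ k * (sqrt (2 ^ k) * sqrt (2 ^ k)))"
        unfolding UNIV_3 by (simp add: d_def)
      ultimately show ?thesis by simp
    qed
    also have "ennreal (w k) * ennreal (512 / 4 ^ k) = ennreal (512 * c powr (2 * a - 2) * real (Suc k) powr (2 * a - 2))"
      using w0[of k] c by (simp add: ennreal_mult[symmetric] w_def powr_mult mult_ac)
    finally show "(\<integral>\<^sup>+x. ennreal (w k) * indicator (Q k) x \<partial>lborel)
      = ennreal (512 * c powr (2 * a - 2) * real (Suc k) powr (2 * a - 2))" .
  qed
  also have "\<dots> < \<infinity>"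
  proof -
    have "summable (\<lambda>k. real k powr (2 * a - 2))" using a by (simp add: summable_real_powr_iff)
    then have "summable (\<lambda>k. real (Suc k) powr (2 * a - 2))"
      using summable_Suc_iff[of "\<lambda>k. real k powr (2 * a - 2)"] by simp
    then have "summable (\<lambda>k. 512 * c powr (2 * a - 2) * real (Suc k) powr (2 * a - 2))"
      by (rule summable_mult)
    then show ?thesis
      by (subst suminf_ennreal2) auto
  qed
  finally show "(\<integral>\<^sup>+x. ennreal ((?f x)\<^sup>2) \<partial>lborel) < \<infinity>" .
qed

lemma Hdot_norm_smooth_off_0:
  fixes f :: "real ^ 'n \<Rightarrow> real"
  assumes two: "\<And>i :: 'n. \<exists>j. i \<noteq> j" and sm: "smooth_on (- {0}) f" "f 0 = 0"
    and W: "L2_fun W" "\<And>x. 0 \<le> W x" and c: "0 \<le> c"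
    and jet: "\<And>x. x \<noteq> 0 \<Longrightarrow> jet_bound x f (c * W x) (c * W x) (c * W x)"
    and k: "k \<le> 2"
  shows "Hdot_norm k UNIV f \<le>
    ennreal (sqrt (card {is :: 'n list. length is = k} * (\<integral>x. (W x)\<^sup>2 \<partial>lborel)) * c)"
proof -
  \<comment> \<open>At \<open>0\<close> the value of \<open>partial i f\<close> is junk and obeys no bound.\<close>
  define g1 where "g1 i x = (if x = 0 then 0 else partial i f x)" for i x
  define g2 where "g2 i j x = (if x = 0 then 0 else partial j (partial i f) x)" for i j x
  have s1: "smooth_on (- {0}) (g1 i)" for i
    by (rule smooth_on_cong[OF smooth_on_partial[OF sm(1), of i]]) (auto simp: g1_def)
  have p2: "g2 i j x = partial j (g1 i) x" if "x \<noteq> 0" for i j x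
    using that partial_cong_open[of "- {0}" x "partial i f" "g1 i" j] by (auto simp: g1_def g2_def)
  have s2: "smooth_on (- {0}) (g2 i j)" for i j
    by (rule smooth_on_cong[OF smooth_on_partial[OF s1, of j i]]) (auto simp: p2)
  have bd: "\<bar>f x\<bar> \<le> c * W x" "\<bar>g1 i x\<bar> \<le> c * W x" "\<bar>g2 i j x\<bar> \<le> c * W x" for x i j
    using jet[of x] sm(2) W(2)[of x] c by (cases "x = 0"; simp add: jet_bound_def g1_def g2_def)+
  have L2: "L2_fun h" if "smooth_on (- {0}) h" "\<And>x. \<bar>h x\<bar> \<le> c * W x" for h
  proof (rule L2_fun_bound[OF L2_fun_scale[OF W(1), of c]])
    show "h \<in> borel_measurable borel"
      using smooth_on_continuous_on[OF that(1)]
      by (intro borel_measurable_continuous_countable_exceptions[of "{0}"]) auto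
    show "\<bar>h x\<bar> \<le> \<bar>c * W x\<bar>" for x using that(2)[of x] by simp
  qed
  note L2s = L2[OF sm(1) bd(1)] L2[OF s1 bd(2)] L2[OF s2 bd(3)]
  have w1: "weak_partial i f (g1 i)" for i
  proof -
    obtain j where "i \<noteq> j" using two by blast
    then have "line_derivative_ae i f (g1 i)"
      by (rule line_derivative_ae_smooth_off_0[OF sm(1)]) (simp add: g1_def)
    then show ?thesis by (rule weak_partialI[OF L2s(1,2)])
  qed
  have w2: "weak_partial j (g1 i) (g2 i j)" for i j
  proof -
    obtain l where "j \<noteq> l" using two by blast
    then have "line_derivative_ae j (g1 i) (g2 i j)"
      by (rule line_derivative_ae_smooth_off_0[OF s1]) (simp add: p2)
    then show ?thesis by (rule weak_partialI[OF L2s(2,3)])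
  qed
  define g where "g is = (case is of [] \<Rightarrow> f | i # js \<Rightarrow> (case js of [] \<Rightarrow> g1 i | j # _ \<Rightarrow> g2 i j))"
    for "is" :: "'n list"
  have wd: "weak_deriv UNIV is f (g is)" if len: "length is = k" for "is"
  proof -
    consider "is = []" | i where "is = [i]" | i j where "is = [i, j]"
      using k len by (cases "is" rule: remdups_adj.cases) auto
    then show ?thesis
    proof cases
      case 1
      then show ?thesis using weak_deriv_Nil[OF L2s(1)] by (simp add: g_def)
    next
      case 2
      then show ?thesis
        using weak_deriv_Cons[OF w1 weak_deriv_Nil[OF L2s(2)] L2s(2)] by (simp add: g_def)
    next
      case 3
      then show ?thesis
        using weak_deriv_Cons[OF w1 weak_deriv_Cons[OF w2 weak_deriv_Nil[OF L2s(3)] L2s(3)] L2s(3)]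
        by (simp add: g_def)
    qed
  qed
  show ?thesis
  proof (rule Hdot_norm_le[OF wd _ W(1) c])
    show "\<bar>g is x\<bar> \<le> c * W x" for "is" x
      using bd by (auto simp: g_def split: list.splits)
  qed
qed

lemma exists_other_3: "\<exists>j :: 3. i \<noteq> j"
  by (metis one_neq_zero num1_eq_iff zero_neq_numeral)

definition log_ext :: "real \<Rightarrow> real \<Rightarrow> real ^ 3 \<Rightarrow> real" where
  "log_ext R a x = cutoff 4 (R\<^sup>2) x * ext_core a x"

definition ext_weight :: "real \<Rightarrow> real ^ 3 \<Rightarrow> real" where
  "ext_weight a x = (if norm x \<le> 5/2 then inverse (norm x) else 0) +
     (if norm x \<le> 5/2 then slope_weight a x else 0)"

lemma slope_weight_nonneg: "0 \<le> slope_weight a x"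
proof (cases "(norm x)\<^sup>2 / 4 \<le> x $ 1 \<and> x \<noteq> 0")
  case True
  then show ?thesis using parab_near[of x] log_slope_nonneg[of a "parab x"]
    by (simp add: slope_weight_def)
qed (auto simp: slope_weight_def parab_def)

lemma ext_weight_nonneg: "0 \<le> ext_weight a x"
  using slope_weight_nonneg by (simp add: ext_weight_def)

lemma L2_fun_ext_weight: "0 < a \<Longrightarrow> a < 1/2 \<Longrightarrow> L2_fun (ext_weight a)"
  unfolding ext_weight_def[abs_def]
  by (rule L2_fun_add[OF L2_fun_inverse_norm L2_fun_slope_weight])

lemma ext_jet:
  assumes a: "0 < a" "a < 1" and R: "2 < R" "R \<le> 5/2"
  obtains C where "0 \<le> C"
    "\<And>x. x \<noteq> 0 \<Longrightarrow> jet_bound x (log_ext R a) (C * ext_weight a x) (C * ext_weight a x) (C * ext_weight a x)"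
proof -
  obtain C where C: "0 \<le> C" "\<And>x. x \<noteq> 0 \<Longrightarrow> norm x \<le> 5/2 \<Longrightarrow>
    jet_bound x (ext_core a) (C * inverse (norm x)) (C * inverse (norm x))
      (C * (inverse (norm x) + slope_weight a x))"
    using ext_core_jet[OF a] by metis
  have R4: "4 < R\<^sup>2" using R power_strict_mono[of 2 R 2] by simp
  obtain D where D: "0 \<le> D" "\<And>x :: real ^ 3. norm x \<le> 5/2 \<Longrightarrow> jet_bound x (cutoff 4 (R\<^sup>2)) D D D"
    using cutoff_jet[OF R4, of "5/2"] by auto
  show ?thesis
  proof (rule that[of "4 * (D * C)"])
    fix x :: "real ^ 3" assume x: "x \<noteq> 0"
    show "jet_bound x (log_ext R a) (4 * (D * C) * ext_weight a x) (4 * (D * C) * ext_weight a x)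
        (4 * (D * C) * ext_weight a x)"
    proof (cases "norm x \<le> 5/2")
      case True
      define v where "v = inverse (norm x)"
      define s where "s = slope_weight a x"
      have vs: "0 \<le> v" "0 \<le> s" using slope_weight_nonneg by (auto simp: v_def s_def)
      have W: "ext_weight a x = v + s" using True by (simp add: ext_weight_def v_def s_def)
      have nn: "0 \<le> D * C * v" "0 \<le> D * C * s" using C D vs by auto
      from jet_bound_mult[OF D(2)[OF True] C(2)[OF x True]]
      have "jet_bound x (log_ext R a) (D * (C * v)) (D * (C * v) + D * (C * v))
          (D * (C * v) + 2 * (D * (C * v)) + D * (C * (v + s)))"
        by (simp add: log_ext_def[abs_def] v_def s_def)
      then show ?thesis
        by (rule jet_bound_mono) (use nn in \<open>simp_all add: W algebra_simps\<close>)
    next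
      case False
      have z: "log_ext R a y = 0" if "5/2 < norm y" for y
      proof -
        have "R\<^sup>2 \<le> (norm y)\<^sup>2" using R that by (intro power_mono) auto
        then show ?thesis using cutoff_eq_0[OF R4, of y] by (simp add: log_ext_def)
      qed
      have "open {y :: real ^ 3. 5/2 < norm y}"
        by (intro open_Collect_less continuous_intros)
      then have "jet_bound x (log_ext R a) \<bar>0\<bar> 0 0"
        by (rule jet_bound_cong[OF jet_bound_const]) (use False z in auto)
      then show ?thesis
        by (rule jet_bound_mono) (use C D ext_weight_nonneg[of a x] in auto)
    qed
  qed (use C D in auto)
qed

lemma smooth_on_ext:
  assumes a: "0 < a" "a < 1" and R: "2 < R" "R \<le> 5/2"
  shows "smooth_on (- {0}) (log_ext R a)"
  using ext_jet[OF assms] by (intro smooth_on_local) (metis ComplD singletonI jet_bound_def)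

lemma ext_eq_log_primitive:
  assumes R: "2 < R" and x: "x \<in> B 0"
  shows "log_ext R a x = log_primitive a (x $ 1)"
proof -
  have n: "(norm x)\<^sup>2 = (x $ 1)\<^sup>2 + (x $ 2)\<^sup>2 + (x $ 3)\<^sup>2"
    unfolding norm_vec_def L2_set_def by (simp add: sum_3)
  then have lt: "(norm x)\<^sup>2 < 2 * x $ 1"
    using x by (simp add: B_def power2_eq_square algebra_simps)
  then have x1: "0 < x $ 1" using zero_le_power2[of "norm x"] by linarith
  have x0: "x \<noteq> 0" using x1 by auto
  have "(norm x)\<^sup>2 < 2 * norm x" using lt component_le_norm_cart[of x 1] by linarith
  then have "norm x < 2" using x0 by (simp add: power2_eq_square)
  then have "(norm x)\<^sup>2 \<le> 2\<^sup>2" by (intro power_mono) auto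
  moreover have "4 < R\<^sup>2" using R power_strict_mono[of 2 R 2] by simp
  ultimately have "cutoff 4 (R\<^sup>2) x = 1" by (intro cutoff_eq_1) auto
  moreover have "parab x = x $ 1"
    using lt x1 by (intro parab_inner[OF x0]) linarith
  ultimately show ?thesis using x1 by (simp add: log_ext_def ext_core_def log_mean_def)
qed

lemma open_B: "open (B t)"
  unfolding B_def by (intro open_Collect_less continuous_intros)

lemma not_smooth_at_0:
  assumes "0 < a" "a \<le> 1" "0 < \<epsilon>" and eq: "\<And>x. x \<in> B 0 \<Longrightarrow> f x = \<epsilon> * log_primitive a (x $ 1)"
  shows "0 \<in> sing_supp f"
proof (rule ccontr)
  assume "0 \<notin> sing_supp f"
  then obtain U where U: "open U" "smooth_on U f" "0 \<in> U"
    unfolding sing_supp_def by blast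
  have "continuous_on U (partial 1 f)"
    by (rule smooth_on_continuous_on[OF smooth_on_partial[OF U(2)]])
  then have "isCont (partial 1 f) 0"
    using U by (simp add: continuous_on_eq_continuous_at)
  moreover have "((\<lambda>s. s *\<^sub>R (axis 1 1 :: real ^ 3)) \<longlongrightarrow> 0 *\<^sub>R axis 1 1) (at_right 0)"
    by (intro tendsto_intros)
  ultimately have lim: "((\<lambda>s. partial 1 f (s *\<^sub>R axis 1 1)) \<longlongrightarrow> partial 1 f 0) (at_right 0)"
    by (intro isCont_tendsto_compose[where g = "partial 1 f"]) auto
  have p: "partial 1 f (s *\<^sub>R axis 1 1) = \<epsilon> * ln (4 / s) powr a" if s: "0 < s" "s < 2" for s
  proof -
    let ?p = "s *\<^sub>R axis 1 1 :: real ^ 3"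
    have "s * s < s * 2" using s by (intro mult_strict_left_mono) auto
    then have pB: "?p \<in> B 0"
      using s by (simp add: B_def axis_def power2_eq_square algebra_simps)
    have "partial 1 f ?p = partial 1 (\<lambda>x. \<epsilon> * log_primitive a (x $ 1)) ?p"
      by (rule partial_cong_open[OF open_B pB eq])
    also have "\<dots> = (\<epsilon> * log_weight a s) * partial 1 (\<lambda>x. x $ 1) ?p"
      using s assms(1,2)
      by (intro partial_compose[where h = "\<lambda>y. \<epsilon> * log_primitive a y"] differentiable_component
          DERIV_cmult log_primitive_has_derivative[THEN DERIV_cong]) (auto simp: axis_def)
    finally show ?thesis using s by (simp add: partial_component log_weight_eq)
  qed
  have "filterlim (\<lambda>s :: real. 4 * inverse s) at_top (at_right 0)"
    by (rule filterlim_tendsto_pos_mult_at_top[OF tendsto_const _ filterlim_inverse_at_top_right]) simp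
  then have "filterlim (\<lambda>s :: real. ln (4 / s)) at_top (at_right 0)"
    unfolding divide_inverse by (rule filterlim_compose[OF ln_at_top])
  then have "((\<lambda>s :: real. ln (4 / s) powr (- a)) \<longlongrightarrow> 0) (at_right 0)"
    using assms(1) by (intro tendsto_neg_powr) auto
  from tendsto_mult[OF lim this]
  have "((\<lambda>s. partial 1 f (s *\<^sub>R axis 1 1) * ln (4 / s) powr (- a)) \<longlongrightarrow> 0) (at_right 0)" by simp
  moreover have "eventually (\<lambda>s. partial 1 f (s *\<^sub>R axis 1 1) * ln (4 / s) powr (- a) = \<epsilon>) (at_right 0)"
    unfolding eventually_at_right_field
  proof (intro exI[of _ 1] conjI allI impI)
    fix s :: real assume s: "0 < s" "s < 1"
    have "ln (4 / s) powr a * ln (4 / s) powr (- a) = 1"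
      using s ln_4_div_pos[of s] by (simp add: powr_add[symmetric])
    then show "partial 1 f (s *\<^sub>R axis 1 1) * ln (4 / s) powr (- a) = \<epsilon>"
      using p[of s] s by (simp add: mult.assoc)
  qed simp
  ultimately have "((\<lambda>s :: real. \<epsilon>) \<longlongrightarrow> 0) (at_right 0)"
    by (rule Lim_transform_eventually)
  then show False using assms(3) by (simp add: tendsto_const_iff)
qed

lemma extension_part1:
  assumes a: "0 < a" "a < 1/2" and R: "2 < R"
  shows "\<exists>C. \<forall>\<epsilon>>0. \<exists>\<Psi> :: real ^ 3 \<Rightarrow> real. \<Psi> \<in> Hsob 2 UNIV \<and>
    (\<forall>x\<in>B 0. \<Psi> x = chi1 \<epsilon> a (x $ 1)) \<and> Hdot_norm 2 UNIV \<Psi> \<le> ennreal (C * \<epsilon>) \<and>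
    supp \<Psi> \<subseteq> {x. norm x \<le> R} \<and> sing_supp \<Psi> = {0}"
proof -
  define r where "r = min R (5/2)"
  have r: "2 < r" "r \<le> 5/2" "r \<le> R" using R by (auto simp: r_def)
  have a1: "0 < a" "a < 1" using a by auto
  obtain D where D: "0 \<le> D" "\<And>x. x \<noteq> 0 \<Longrightarrow>
    jet_bound x (log_ext r a) (D * ext_weight a x) (D * ext_weight a x) (D * ext_weight a x)"
    using ext_jet[OF a1 r(1,2)] by metis
  define N where "N k = sqrt (card {is :: 3 list. length is = k} * (\<integral>x. (ext_weight a x)\<^sup>2 \<partial>lborel))" for k
  show ?thesis
  proof (intro exI[of _ "N 2 * D"] allI impI)
    fix \<epsilon> :: real assume e: "0 < \<epsilon>"
    define \<Psi> where "\<Psi> x = \<epsilon> * log_ext r a x" for x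
    have sm: "smooth_on (- {0}) \<Psi>"
      unfolding \<Psi>_def[abs_def] by (rule smooth_on_mult[OF smooth_on_const smooth_on_ext[OF a1 r(1,2)]]) auto
    have jet: "jet_bound x \<Psi> (\<epsilon> * D * ext_weight a x) (\<epsilon> * D * ext_weight a x) (\<epsilon> * D * ext_weight a x)"
      if "x \<noteq> 0" for x
      using jet_bound_scale[OF D(2)[OF that], of \<epsilon>] e by (simp add: \<Psi>_def[abs_def] mult.assoc)
    have H: "Hdot_norm k UNIV \<Psi> \<le> ennreal (N k * (\<epsilon> * D))" if "k \<le> 2" for k
      unfolding N_def
    proof (rule Hdot_norm_smooth_off_0[OF exists_other_3 sm _ L2_fun_ext_weight[OF a] ext_weight_nonneg _ jet that])
      show "\<Psi> 0 = 0" by (simp add: \<Psi>_def log_ext_def ext_core_def)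
    qed (use e D in auto)
    have "\<Psi> \<in> Hsob 2 UNIV"
      unfolding Hsob_def using H by (auto simp: less_top[symmetric] top_unique dest!: H)
    moreover have eqB: "\<Psi> x = \<epsilon> * log_primitive a (x $ 1)" if "x \<in> B 0" for x
      using ext_eq_log_primitive[OF r(1) that] by (simp add: \<Psi>_def)
    moreover have "Hdot_norm 2 UNIV \<Psi> \<le> ennreal (N 2 * D * \<epsilon>)"
      using H[of 2] by (simp add: mult_ac)
    moreover have "supp \<Psi> \<subseteq> {x. norm x \<le> R}"
    proof -
      have "4 < r\<^sup>2" using r power_strict_mono[of 2 r 2] by simp
      then have "supp (\<lambda>x. cutoff 4 (r\<^sup>2) x * (\<epsilon> * ext_core a x)) \<subseteq> cball 0 r"
        using r by (intro supp_cutoff_mult) auto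
      then have "supp \<Psi> \<subseteq> cball 0 r"
        by (simp add: \<Psi>_def[abs_def] log_ext_def mult.left_commute)
      then show ?thesis using r by auto
    qed
    moreover have "sing_supp \<Psi> = {0}"
    proof
      show "sing_supp \<Psi> \<subseteq> {0}"
        using sm unfolding sing_supp_def by (auto intro!: exI[of _ "- {0}"])
      show "{0} \<subseteq> sing_supp \<Psi>"
        using not_smooth_at_0[of a \<epsilon> \<Psi>] a e eqB by auto
    qed
    ultimately show "\<exists>\<Psi> :: real ^ 3 \<Rightarrow> real. \<Psi> \<in> Hsob 2 UNIV \<and>
      (\<forall>x\<in>B 0. \<Psi> x = chi1 \<epsilon> a (x $ 1)) \<and> Hdot_norm 2 UNIV \<Psi> \<le> ennreal (N 2 * D * \<epsilon>) \<and>
      supp \<Psi> \<subseteq> {x. norm x \<le> R} \<and> sing_supp \<Psi> = {0}"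
      by (intro exI[of _ \<Psi>]) (auto simp: chi1_eq)
  qed
qed

section \<open>The second extension\<close>

lemma test_function_integrable:
  assumes "test_function \<Omega> \<phi>"
  shows "integrable lborel \<phi>"
proof -
  have c: "compact (supp \<phi>)" using assms by (simp add: test_function_def)
  then have "L2_fun (indicator (supp \<phi>) :: _ \<Rightarrow> real)"
    by (intro L2_fun_bounded[of _ 1 "supp \<phi>"] borel_measurable_indicator borel_closed compact_imp_closed) auto
  from L2_fun_mult_integrable[OF this test_function_L2[OF assms]]
  have "integrable lborel (\<lambda>x. indicator (supp \<phi>) x * \<phi> x)" .
  moreover have "indicator (supp \<phi>) x * \<phi> x = \<phi> x" for x
    using closure_subset[of "{x. \<phi> x \<noteq> 0}"] by (auto simp: supp_def indicator_def)
  ultimately show ?thesis by simp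
qed

lemma test_function_mult_smooth:
  assumes "open \<Omega>" "smooth_on \<Omega> f" "test_function \<Omega> \<phi>"
  shows "test_function UNIV (\<lambda>x. indicator \<Omega> x * (f x * \<phi> x))"
proof -
  let ?F = "\<lambda>x. indicator \<Omega> x * (f x * \<phi> x)"
  have \<phi>: "smooth_on UNIV \<phi>" "compact (supp \<phi>)" "supp \<phi> \<subseteq> \<Omega>"
    using assms(3) by (auto simp: test_function_def)
  have z: "\<phi> x = 0" if "x \<notin> supp \<phi>" for x
    using that closure_subset[of "{x. \<phi> x \<noteq> 0}"] unfolding supp_def by blast
  have o: "open (- supp \<phi>)" by (simp add: supp_def open_Compl)
  have "smooth_on \<Omega> ?F"
    by (rule smooth_on_cong[OF smooth_on_mult[OF assms(2) smooth_on_subset[OF \<phi>(1)] assms(1)] assms(1)]) auto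
  moreover have "smooth_on (- supp \<phi>) ?F"
    by (rule smooth_on_cong[OF smooth_on_const[of _ 0] o]) (auto simp: z)
  ultimately have "smooth_on (\<Omega> \<union> - supp \<phi>) ?F"
    by (rule smooth_on_Un[OF _ _ assms(1) o])
  moreover have "\<Omega> \<union> - supp \<phi> = UNIV" using \<phi>(3) by blast
  moreover have "supp ?F \<subseteq> supp \<phi>"
    unfolding supp_def by (rule closure_mono) auto
  then have "supp \<phi> \<inter> supp ?F = supp ?F" by blast
  moreover have "compact (supp \<phi> \<inter> supp ?F)"
    using \<phi>(2) by (intro compact_Int_closed) (simp_all add: supp_def)
  ultimately show ?thesis by (simp add: test_function_def)
qed

lemma smooth_integration_by_parts:
  assumes \<Omega>: "open \<Omega>" and f: "smooth_on \<Omega> f" and \<phi>: "test_function \<Omega> \<phi>"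
  shows "(LINT x:\<Omega>|lebesgue. f x * partial i \<phi> x) = - (LINT x:\<Omega>|lebesgue. partial i f x * \<phi> x)"
proof -
  let ?F = "\<lambda>x. indicator \<Omega> x * (f x * \<phi> x)"
  let ?G = "\<lambda>x. indicator \<Omega> x * (f x * partial i \<phi> x)"
  let ?H = "\<lambda>x. indicator \<Omega> x * (partial i f x * \<phi> x)"
  have F: "test_function UNIV ?F" by (rule test_function_mult_smooth[OF \<Omega> f \<phi>])
  have G: "test_function UNIV ?G" by (rule test_function_mult_smooth[OF \<Omega> f test_function_partial[OF \<phi>]])
  have H: "test_function UNIV ?H" by (rule test_function_mult_smooth[OF \<Omega> smooth_on_partial[OF f] \<phi>])
  note int = test_function_integrable[OF F] test_function_integrable[OF G] test_function_integrable[OF H]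
  have p: "partial i ?F x = ?G x + ?H x" for x
  proof (cases "x \<in> \<Omega>")
    case True
    have "partial i ?F x = partial i (\<lambda>x. f x * \<phi> x) x"
      by (rule partial_cong_open[OF \<Omega> True]) auto
    also have "\<dots> = partial i f x * \<phi> x + f x * partial i \<phi> x"
      using True f \<phi> by (intro partial_mult) (auto simp: test_function_def intro: smooth_on_differentiable)
    finally show ?thesis using True by simp
  next
    case False
    then have x: "x \<notin> supp \<phi>" using \<phi> by (auto simp: test_function_def)
    have "partial i ?F x = partial i (\<lambda>_. 0) x"
      by (rule partial_cong_open[of "- supp \<phi>"])
        (use x closure_subset[of "{x. \<phi> x \<noteq> 0}"] in \<open>auto simp: supp_def\<close>)
    then show ?thesis using False by (simp add: partial_const)
  qed
  have "(\<integral>x. ?G x + ?H x \<partial>lborel) = 0"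
  proof (rule integral_line_derivative_eq_0[OF int(1)])
    have "((\<lambda>s. ?F (x + s *\<^sub>R axis i 1)) has_real_derivative ?G (x + s *\<^sub>R axis i 1) + ?H (x + s *\<^sub>R axis i 1)) (at s)"
      for x s
      unfolding p[symmetric] using F
      by (intro line_derivative smooth_on_differentiable) (auto simp: test_function_def)
    note d = this
    have "continuous_on UNIV (\<lambda>s. ?F (x + s *\<^sub>R axis i 1))" for x
      using d by (intro continuous_at_imp_continuous_on ballI DERIV_isCont)
    with d show "line_derivative_ae i ?F (\<lambda>x. ?G x + ?H x)"
      unfolding line_derivative_ae_def by (intro AE_I2 exI[of _ "{}"]) blast
  qed (use int in auto)
  then have "(\<integral>x. ?G x \<partial>lborel) = - (\<integral>x. ?H x \<partial>lborel)"
    using int by (simp add: Bochner_Integration.integral_add)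
  moreover have "?G \<in> borel_measurable lborel" "?H \<in> borel_measurable lborel"
    using int by auto
  ultimately show ?thesis
    by (simp add: set_lebesgue_integral_def integral_completion)
qed

subsection \<open>Finiteness of the first order norm\<close>

lemma L2_fun_component:
  fixes h :: "real \<Rightarrow> real"
  assumes [measurable]: "h \<in> borel_measurable borel"
    and fin: "(\<integral>\<^sup>+s. ennreal (indicator {-M..M} s * (h s)\<^sup>2) \<partial>lborel) < \<infinity>"
  shows "L2_fun (\<lambda>x :: real ^ 'n. if norm x \<le> M then h (x $ k) else 0)"
proof (rule L2_funI_nn_integral)
  let ?f = "\<lambda>x :: real ^ 'n. if norm x \<le> M then h (x $ k) else 0"
  have [measurable]: "(\<lambda>x :: real ^ 'n. x $ k) \<in> borel_measurable borel"
    by (intro borel_measurable_continuous_onI continuous_intros)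
  show "?f \<in> borel_measurable borel" by measurable
  define F where "F b s = indicator {-M..M} s * (if b = axis k 1 then (h s)\<^sup>2 else 1)" for b :: "real ^ 'n" and s
  have F0: "0 \<le> F b s" for b s by (simp add: F_def)
  have Fm: "(\<lambda>s. ennreal (F b s)) \<in> borel_measurable borel" for b unfolding F_def by measurable
  have "ennreal ((?f x)\<^sup>2) \<le> (\<Prod>b\<in>Basis. ennreal (F b (x \<bullet> b)))" for x
  proof (cases "norm x \<le> M")
    case True
    have "x \<bullet> b \<in> {-M..M}" if "b \<in> Basis" for b
      using Basis_le_norm[OF that, of x] True by auto
    then have "(\<Prod>b\<in>Basis. F b (x \<bullet> b)) = (\<Prod>b\<in>(Basis :: (real ^ 'n) set). if b = axis k 1 then (h (x $ k))\<^sup>2 else 1)"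
      by (intro prod.cong) (auto simp: F_def inner_axis)
    also have "\<dots> = (h (x $ k))\<^sup>2"
      by (simp add: prod.delta axis_in_Basis_iff)
    finally show ?thesis using True by (simp add: prod_ennreal F0)
  qed simp
  then have "(\<integral>\<^sup>+x. ennreal ((?f x)\<^sup>2) \<partial>lborel) \<le> (\<integral>\<^sup>+x. (\<Prod>b\<in>Basis. ennreal (F b (x \<bullet> b))) \<partial>lborel)"
    by (intro nn_integral_mono)
  also have "\<dots> = (\<Prod>b\<in>Basis. (\<integral>\<^sup>+s. ennreal (F b s) \<partial>lborel))"
    by (rule nn_integral_lborel_prod) (use Fm in auto)
  also have "\<dots> < \<infinity>"
  proof -
    have "(\<integral>\<^sup>+s. ennreal (F b s) \<partial>lborel) \<noteq> top" for b
    proof (cases "b = axis k 1")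
      case False
      have "(\<integral>\<^sup>+s. ennreal (F b s) \<partial>lborel) = (\<integral>\<^sup>+s. indicator {-M..M} s \<partial>lborel)"
        using False by (simp add: F_def ennreal_indicator)
      also have "\<dots> = emeasure lborel {-M..M}" by (rule nn_integral_indicator) simp
      also have "\<dots> \<noteq> top" by (simp add: emeasure_lborel_Icc_eq)
      finally show ?thesis .
    qed (use fin in \<open>simp add: F_def less_top[symmetric]\<close>)
    then show ?thesis by (simp add: less_top[symmetric] ennreal_prod_eq_top)
  qed
  finally show "(\<integral>\<^sup>+x. ennreal ((?f x)\<^sup>2) \<partial>lborel) < \<infinity>" .
qed

lemma log_weight_square_finite:
  assumes "0 \<le> a" "a \<le> 1"
  shows "(\<integral>\<^sup>+s. ennreal (indicator {-M..M} s * (log_weight a (s - t))\<^sup>2) \<partial>lborel) < \<infinity>"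
proof -
  define N where "N = max 1 (M + \<bar>t\<bar>)"
  obtain K where K: "0 < K" "\<And>s. s \<noteq> 0 \<Longrightarrow> \<bar>s\<bar> \<le> N \<Longrightarrow> log_weight a s \<le> K * \<bar>s\<bar> powr (-1/4)"
    using log_weight_bound[of a N] assms by (auto simp: N_def)
  define h where "h s = ennreal (indicator {-N..N} s * \<bar>s\<bar> powr (-1/2))" for s :: real
  have hm: "h \<in> borel_measurable borel" unfolding h_def by measurable
  have "ennreal (indicator {-M..M} s * (log_weight a (s - t))\<^sup>2) \<le> ennreal (K\<^sup>2) * h (s - t)" for s
  proof -
    have "indicator {-M..M} s * (log_weight a (s - t))\<^sup>2 \<le> K\<^sup>2 * (indicator {-N..N} (s - t) * \<bar>s - t\<bar> powr (-1/2))"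
    proof (cases "s \<in> {-M..M} \<and> s \<noteq> t")
      case True
      then have N: "\<bar>s - t\<bar> \<le> N" by (auto simp: N_def)
      have "(log_weight a (s - t))\<^sup>2 \<le> (K * \<bar>s - t\<bar> powr (-1/4))\<^sup>2"
        using K(2)[of "s - t"] True N log_weight_nonneg by (intro power_mono) auto
      also have "\<dots> = K\<^sup>2 * \<bar>s - t\<bar> powr (-1/2)"
        by (simp add: power_mult_distrib power2_eq_square powr_add[symmetric])
      finally show ?thesis using True N by (auto simp: abs_le_iff)
    qed (auto simp: log_weight_def indicator_def)
    then show ?thesis by (simp add: h_def ennreal_mult[symmetric] ennreal_leI)
  qed
  then have "(\<integral>\<^sup>+s. ennreal (indicator {-M..M} s * (log_weight a (s - t))\<^sup>2) \<partial>lborel)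
      \<le> (\<integral>\<^sup>+s. ennreal (K\<^sup>2) * h (s - t) \<partial>lborel)"
    by (intro nn_integral_mono)
  also have "\<dots> = ennreal (K\<^sup>2) * (\<integral>\<^sup>+s. h (s - t) \<partial>lborel)"
    using hm by (intro nn_integral_cmult) simp
  also have "(\<integral>\<^sup>+s. h (s - t) \<partial>lborel) = (\<integral>\<^sup>+s. h s \<partial>lborel)"
    using nn_integral_real_affine[OF hm, of 1 "-t"] by simp
  also have "ennreal (K\<^sup>2) * \<dots> < \<infinity>"
    using nn_integral_abs_powr_finite[of "-1/2" N] by (simp add: h_def ennreal_mult_less_top)
  finally show ?thesis .
qed

definition ext2 :: "real \<Rightarrow> real \<Rightarrow> real \<Rightarrow> real ^ 3 \<Rightarrow> real" where
  "ext2 c a t x = c * log_primitive a (x $ 1 - t) * cutoff ((1 + \<bar>1 - t\<bar>)\<^sup>2) ((2 + \<bar>1 - t\<bar>)\<^sup>2) x"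

lemma ext2_radii: "(1 + \<bar>1 - t\<bar>)\<^sup>2 < (2 + \<bar>1 - t\<bar> :: real)\<^sup>2"
  by (intro power_strict_mono) auto

lemma ext2_eq:
  assumes "x \<in> B t"
  shows "ext2 c a t x = c * log_primitive a (x $ 1 - t)"
proof -
  have "(norm (x - axis 1 1))\<^sup>2 = (x $ 1 - 1)\<^sup>2 + (x $ 2)\<^sup>2 + (x $ 3)\<^sup>2"
    unfolding norm_vec_def L2_set_def by (simp add: sum_3 axis_def)
  then have "(norm (x - axis 1 1))\<^sup>2 < \<bar>1 - t\<bar>\<^sup>2" using assms by (simp add: B_def)
  then have "norm (x - axis 1 1) < \<bar>1 - t\<bar>" by (rule power2_less_imp_less) simp
  then have "norm x \<le> 1 + \<bar>1 - t\<bar>"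
    using norm_triangle_ineq[of "x - axis 1 1" "axis 1 1"] by (simp add: norm_axis_1)
  then have "(norm x)\<^sup>2 \<le> (1 + \<bar>1 - t\<bar>)\<^sup>2" by (intro power_mono) auto
  then show ?thesis using cutoff_eq_1[OF ext2_radii, of x t] by (simp add: ext2_def)
qed

lemma log_primitive_line_derivative:
  assumes "0 < a" "a \<le> 1"
  shows "line_derivative_ae i (\<lambda>x :: real ^ 3. c * log_primitive a (x $ 1 - t))
    (\<lambda>x. if i = 1 then c * log_weight a (x $ 1 - t) else 0)"
  unfolding line_derivative_ae_def
proof (intro AE_I2, rule exI[of _ "{t - x $ 1}" for x], intro conjI allI impI)
  fix x :: "real ^ 3"
  have "continuous_on UNIV (\<lambda>s. (x + s *\<^sub>R axis i 1) $ 1 - t)"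
    by (intro continuous_intros)
  then show "continuous_on UNIV (\<lambda>s. c * log_primitive a ((x + s *\<^sub>R axis i 1) $ 1 - t))"
    by (intro continuous_on_mult continuous_on_const
        continuous_on_compose2[OF log_primitive_continuous[OF assms]]) auto
  fix s assume s: "s \<notin> {t - x $ 1}"
  show "((\<lambda>s. c * log_primitive a ((x + s *\<^sub>R axis i 1) $ 1 - t)) has_real_derivative
     (if i = 1 then c * log_weight a ((x + s *\<^sub>R axis i 1) $ 1 - t) else 0)) (at s)"
  proof (cases "i = 1")
    case True
    have "((\<lambda>s. log_primitive a (x $ 1 + s - t)) has_real_derivative log_weight a (x $ 1 + s - t) * 1) (at s)"
      by (rule DERIV_chain2[OF log_primitive_has_derivative[OF assms]])
        (use s in \<open>auto intro!: derivative_eq_intros\<close>)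
    from DERIV_cmult[OF this, of c] show ?thesis using True by (simp add: axis_def)
  qed (simp add: axis_def)
qed simp

lemma ext2_Hdot_1:
  assumes a: "0 < a" "a \<le> 1"
  shows "ext2 c a t \<in> Hdot 1 UNIV"
proof -
  let ?f = "\<lambda>x :: real ^ 3. c * log_primitive a (x $ 1 - t)"
  define f1 where "f1 i x = (if i = 1 then c * log_weight a (x $ 1 - t) else 0)" for i :: 3 and x :: "real ^ 3"
  define R where "R = 2 + \<bar>1 - t\<bar>"
  define \<eta> :: "real ^ 3 \<Rightarrow> real" where "\<eta> = cutoff ((1 + \<bar>1 - t\<bar>)\<^sup>2) (R\<^sup>2)"
  have R: "(1 + \<bar>1 - t\<bar>)\<^sup>2 < R\<^sup>2" "0 \<le> R" using ext2_radii by (auto simp: R_def)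
  have \<eta>: "smooth_on UNIV \<eta>" unfolding \<eta>_def by (rule smooth_on_cutoff)
  define g where "g i x = f1 i x * \<eta> x + ?f x * partial i \<eta> x" for i x
  have e: "ext2 c a t = (\<lambda>x. ?f x * \<eta> x)" by (auto simp: ext2_def \<eta>_def R_def)
  have fc: "continuous_on UNIV ?f"
    by (intro continuous_intros continuous_on_compose2[OF log_primitive_continuous[OF a]]) auto
  have supp_\<eta>: "supp \<eta> \<subseteq> cball 0 R"
    using supp_cutoff_mult[OF R(1,2), of "\<lambda>_. 1"] by (simp add: \<eta>_def)
  have L2c: "L2_fun (\<lambda>x. ?f x * h x)" if "continuous_on UNIV h" "supp h \<subseteq> cball 0 R" for h
  proof (rule L2_fun_continuous)
    show "continuous_on UNIV (\<lambda>x. ?f x * h x)" by (rule continuous_on_mult[OF fc that(1)])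
    have "supp (\<lambda>x. ?f x * h x) \<subseteq> supp h" unfolding supp_def by (rule closure_mono) auto
    then have "cball 0 R \<inter> supp (\<lambda>x. ?f x * h x) = supp (\<lambda>x. ?f x * h x)" using that(2) by blast
    moreover have "compact (cball 0 R \<inter> supp (\<lambda>x. ?f x * h x))"
      by (intro compact_Int_closed) (simp_all add: supp_def)
    ultimately show "compact (supp (\<lambda>x. ?f x * h x))" by simp
  qed
  have L2e: "L2_fun (\<lambda>x. ?f x * \<eta> x)"
    by (rule L2c[OF smooth_on_continuous_on[OF \<eta>] supp_\<eta>])
  have L2f1: "L2_fun (\<lambda>x. f1 i x * \<eta> x)" for i
  proof (rule L2_fun_bound)
    show "L2_fun (\<lambda>x. c * (if norm x \<le> R then log_weight a (x $ 1 - t) else 0))"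
      by (rule L2_fun_scale[OF L2_fun_component[where h = "\<lambda>s. log_weight a (s - t)"]])
        (use a log_weight_square_finite[of a R t] in auto)
    have [measurable]: "(\<lambda>x :: real ^ 3. x $ 1) \<in> borel_measurable borel"
      by (intro borel_measurable_continuous_onI continuous_intros)
    have [measurable]: "\<eta> \<in> borel_measurable borel"
      by (intro borel_measurable_continuous_onI smooth_on_continuous_on[OF \<eta>])
    show "(\<lambda>x. f1 i x * \<eta> x) \<in> borel_measurable borel"
      unfolding f1_def by measurable
    show "\<bar>f1 i x * \<eta> x\<bar> \<le> \<bar>c * (if norm x \<le> R then log_weight a (x $ 1 - t) else 0)\<bar>" for x
    proof (cases "norm x \<le> R")
      case True
      have "\<bar>f1 i x\<bar> * \<bar>\<eta> x\<bar> \<le> \<bar>c * log_weight a (x $ 1 - t)\<bar> * 1"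
        using cutoff_bounds[of _ _ x] by (intro mult_mono) (auto simp: f1_def \<eta>_def)
      then show ?thesis using True by (simp add: abs_mult)
    next
      case False
      then have "R\<^sup>2 \<le> (norm x)\<^sup>2" using R(2) by (intro power_mono) auto
      then show ?thesis using cutoff_eq_0[OF R(1), of x] by (simp add: \<eta>_def)
    qed
  qed
  have L2p: "L2_fun (\<lambda>x. ?f x * partial i \<eta> x)" for i
    using supp_partial[of i \<eta>] supp_\<eta> by (intro L2c smooth_on_continuous_on[OF smooth_on_partial[OF \<eta>]]) auto
  have L2g: "L2_fun (g i)" for i
    unfolding g_def[abs_def] by (rule L2_fun_add[OF L2f1 L2p])
  have w: "weak_partial i (\<lambda>x. ?f x * \<eta> x) (g i)" for i
  proof (rule weak_partialI[OF L2e L2g])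
    show "line_derivative_ae i (\<lambda>x. ?f x * \<eta> x) (g i)"
      using line_derivative_ae_mult[OF log_primitive_line_derivative[OF a, of i c t] \<eta>]
      by (simp add: g_def[abs_def] f1_def)
  qed
  have L2abs: "L2_fun (\<lambda>x. \<bar>g i x\<bar>)" for i
    by (rule L2_fun_bound[OF L2g[of i]]) (use L2g[of i] in \<open>auto simp: L2_fun_def\<close>)
  define W where "W x = \<bar>g 1 x\<bar> + \<bar>g 2 x\<bar> + \<bar>g 3 x\<bar>" for x
  have W: "L2_fun W" unfolding W_def[abs_def] by (intro L2_fun_add L2abs)
  have "Hdot_norm 1 UNIV (ext2 c a t) \<le>
      ennreal (sqrt (card {is :: 3 list. length is = 1} * (\<integral>x. (W x)\<^sup>2 \<partial>lborel)) * 1)"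
  proof (rule Hdot_norm_le[where g = "\<lambda>is. g (hd is)"])
    fix "is" :: "3 list" assume "length is = 1"
    then obtain i where i: "is = [i]" by (auto simp: length_Suc_conv)
    show "weak_deriv UNIV is (ext2 c a t) (g (hd is))"
      unfolding i e using weak_deriv_Cons[OF w weak_deriv_Nil[OF L2g] L2g] by simp
    show "\<bar>g (hd is) x\<bar> \<le> 1 * W x" for x
      using exhaust_3[of i] by (auto simp: i W_def)
  qed (use W in auto)
  then show ?thesis by (auto simp: Hdot_def less_top[symmetric] top_unique)
qed

subsection \<open>Divergence of the second order norm\<close>

lemma smooth_on_prod:
  assumes "\<And>i. i \<in> I \<Longrightarrow> smooth_on U (f i)" "open U"
  shows "smooth_on U (\<lambda>x. \<Prod>i\<in>I. f i x)"
proof (cases "finite I")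
  case True
  then show ?thesis using assms
    by (induction I rule: finite_induct) (auto intro!: smooth_on_mult smooth_on_const)
qed (simp add: smooth_on_const)

definition bump :: "real \<Rightarrow> real" where
  "bump s = smooth_step (2 + s) * smooth_step (2 - s)"

lemma bump_bounds: "0 \<le> bump s" "bump s \<le> 1"
  using smooth_step_bounds[of "2 + s"] smooth_step_bounds[of "2 - s"]
  by (auto simp: bump_def intro: mult_le_one)

lemma bump_eq_1: "\<bar>s\<bar> \<le> 1 \<Longrightarrow> bump s = 1"
  by (simp add: bump_def smooth_step_eq_1)

lemma bump_eq_0: "2 \<le> \<bar>s\<bar> \<Longrightarrow> bump s = 0"
  by (cases "0 \<le> s") (auto simp: bump_def smooth_step_eq_0)

lemma Ck1_bump: "Ck1 k V bump"
  unfolding bump_def[abs_def]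
  by (rule Ck1_mult[OF Ck1_compose[OF Ck1_smooth_step[of _ UNIV] Ck1_add[OF Ck1_const Ck1_ident]]
        Ck1_compose[OF Ck1_smooth_step[of _ UNIV] Ck1_diff[OF Ck1_const Ck1_ident]]]) auto

definition box_bump :: "real ^ 'n \<Rightarrow> ('n \<Rightarrow> real) \<Rightarrow> real ^ 'n \<Rightarrow> real" where
  "box_bump c d x = (\<Prod>i\<in>UNIV. bump (inverse (d i) * (x $ i - c $ i)))"

definition centered_box :: "real ^ 'n \<Rightarrow> ('n \<Rightarrow> real) \<Rightarrow> (real ^ 'n) set" where
  "centered_box c d = cbox (\<chi> i. c $ i - d i) (\<chi> i. c $ i + d i)"

lemma mem_centered_box: "x \<in> centered_box c d \<longleftrightarrow> (\<forall>i. \<bar>x $ i - c $ i\<bar> \<le> d i)"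
  unfolding centered_box_def by (auto simp: mem_box_cart abs_le_iff algebra_simps)

lemma box_bump_bounds: "0 \<le> box_bump c d x" "box_bump c d x \<le> 1"
  unfolding box_bump_def by (intro prod_nonneg prod_le_1 ballI conjI bump_bounds)+

lemma box_bump_eq_1:
  assumes "\<And>i. 0 < d i" "x \<in> centered_box c d"
  shows "box_bump c d x = 1"
proof -
  have "bump (inverse (d i) * (x $ i - c $ i)) = 1" for i
    using assms(1)[of i] assms(2) by (intro bump_eq_1) (auto simp: mem_centered_box abs_mult field_simps)
  then show ?thesis by (simp add: box_bump_def)
qed

lemma box_bump_eq_0:
  assumes "\<And>i. 0 < d i" "x \<notin> centered_box c (\<lambda>i. 2 * d i)"
  shows "box_bump c d x = 0"
proof -
  obtain i where "2 * d i < \<bar>x $ i - c $ i\<bar>" using assms(2) by (auto simp: mem_centered_box not_le)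
  then have "bump (inverse (d i) * (x $ i - c $ i)) = 0"
    using assms(1)[of i] by (intro bump_eq_0) (auto simp: abs_mult field_simps)
  then show ?thesis unfolding box_bump_def by (intro prod_zero) auto
qed

lemma test_function_box_bump:
  fixes c :: "real ^ 'n"
  assumes d: "\<And>i. 0 < d i" and sub: "centered_box c (\<lambda>i. 2 * d i) \<subseteq> \<Omega>"
  shows "test_function \<Omega> (box_bump c d)"
proof -
  have "smooth_on UNIV (\<lambda>x :: real ^ 'n. bump (inverse (d i) * (x $ i - c $ i)))" for i
    by (rule smooth_on_compose[OF Ck1_bump[of _ UNIV]
          smooth_on_mult[OF smooth_on_const smooth_on_diff[OF smooth_on_component smooth_on_const]]]) auto
  then have "smooth_on UNIV (box_bump c d)"
    unfolding box_bump_def[abs_def] by (intro smooth_on_prod) auto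
  moreover have s: "supp (box_bump c d) \<subseteq> centered_box c (\<lambda>i. 2 * d i)"
    unfolding supp_def
  proof (rule closure_minimal)
    show "{x. box_bump c d x \<noteq> 0} \<subseteq> centered_box c (\<lambda>i. 2 * d i)"
      using box_bump_eq_0[of d, OF d] by blast
  qed (simp add: centered_box_def closed_cbox)
  moreover have "compact (supp (box_bump c d))"
  proof -
    have "compact (centered_box c (\<lambda>i. 2 * d i) \<inter> supp (box_bump c d))"
      by (intro compact_Int_closed) (simp_all add: centered_box_def supp_def compact_cbox)
    then show ?thesis using s by (simp add: Int_absorb1)
  qed
  ultimately show ?thesis using sub by (auto simp: test_function_def)
qed

lemma measure_centered_box:
  assumes "\<And>i. 0 < d i"
  shows "measure lebesgue (centered_box c d) = (\<Prod>i\<in>UNIV. 2 * d i)"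
    and "emeasure lebesgue (centered_box c d) < \<infinity>" "centered_box c d \<in> sets borel"
proof -
  have e: "emeasure lborel (centered_box c d) = ennreal (\<Prod>i\<in>UNIV. 2 * d i)"
    unfolding centered_box_def using assms by (intro emeasure_centered_cbox less_imp_le)
  show s: "centered_box c d \<in> sets borel" by (simp add: centered_box_def)
  have e': "emeasure lebesgue (centered_box c d) = ennreal (\<Prod>i\<in>UNIV. 2 * d i)"
    using e s by simp
  show "emeasure lebesgue (centered_box c d) < \<infinity>" unfolding e' by simp
  have "0 \<le> (\<Prod>i\<in>UNIV. 2 * d i)" using assms by (intro prod_nonneg) (auto intro: less_imp_le)
  then show "measure lebesgue (centered_box c d) = (\<Prod>i\<in>UNIV. 2 * d i)"
    by (simp add: measure_def e')
qed

text \<open>Young's inequality \<open>|G| \<le> l G\<^sup>2 / 2 + 1 / (2 l)\<close> with the optimal \<open>l\<close> stands in for the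
  Cauchy--Schwarz inequality.\<close>

lemma nn_integral_square_lower_bound:
  fixes G H :: "real ^ 3 \<Rightarrow> real"
  assumes d: "\<And>i. 0 < d i" and m: "0 < m"
    and sub: "centered_box c (\<lambda>i. 2 * d i) \<subseteq> \<Omega>"
    and G: "set_integrable lebesgue (centered_box c (\<lambda>i. 2 * d i)) G"
    and H: "integrable lebesgue (\<lambda>x. indicator \<Omega> x * (H x * box_bump c d x))"
    and Hm: "\<And>x. x \<in> centered_box c (\<lambda>i. 2 * d i) \<Longrightarrow> H x \<le> - m"
    and eq: "(LINT x:\<Omega>|lebesgue. G x * box_bump c d x) = (LINT x:\<Omega>|lebesgue. H x * box_bump c d x)"
  shows "ennreal (m\<^sup>2 * (\<Prod>i\<in>UNIV. d i)) \<le>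
    (\<integral>\<^sup>+x\<in>centered_box c (\<lambda>i. 2 * d i). ennreal ((G x)\<^sup>2) \<partial>lebesgue)"
proof -
  let ?Q = "centered_box c (\<lambda>i. 2 * d i)"
  let ?q = "centered_box c d"
  let ?\<phi> = "box_bump c d"
  define p where "p = (\<Prod>i\<in>UNIV. d i)"
  have p: "0 < p" unfolding p_def using d by (intro prod_pos) auto
  have qQ: "?q \<subseteq> ?Q"
  proof
    fix x assume "x \<in> ?q"
    then have "\<bar>x $ i - c $ i\<bar> \<le> 2 * d i" for i
      using d[of i] by (simp add: mem_centered_box) (metis add_increasing2 less_imp_le mult_2)
    then show "x \<in> ?Q" by (simp add: mem_centered_box)
  qed
  have d2: "0 < 2 * d i" for i using d[of i] by simp
  have vq: "measure lebesgue ?q = 8 * p" and vQ: "measure lebesgue ?Q = 64 * p"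
    by (simp_all add: measure_centered_box(1)[of d, OF d] measure_centered_box(1)[of "\<lambda>i. 2 * d i", OF d2] p_def prod.distrib)
  have iq: "integrable lebesgue (indicator ?q :: _ \<Rightarrow> real)" "integrable lebesgue (indicator ?Q :: _ \<Rightarrow> real)"
    using measure_centered_box(2,3)[of d, OF d] measure_centered_box(2,3)[of "\<lambda>i. 2 * d i", OF d2]
    by (auto intro!: integrable_real_indicator)
  show ?thesis
  proof (cases "(\<integral>\<^sup>+x\<in>?Q. ennreal ((G x)\<^sup>2) \<partial>lebesgue) = \<infinity>")
    case False
    have Gm: "(\<lambda>x. indicator ?Q x * G x) \<in> borel_measurable lebesgue"
      using G by (simp add: set_integrable_def)
    have sq: "indicator ?Q x * (G x)\<^sup>2 = (indicator ?Q x * G x)\<^sup>2" for x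
      by (simp add: indicator_def)
    have e: "(\<integral>\<^sup>+x\<in>?Q. ennreal ((G x)\<^sup>2) \<partial>lebesgue) = (\<integral>\<^sup>+x. ennreal (indicator ?Q x * (G x)\<^sup>2) \<partial>lebesgue)"
      by (intro nn_integral_cong) (simp add: indicator_def)
    have iG: "integrable lebesgue (\<lambda>x. indicator ?Q x * (G x)\<^sup>2)"
    proof (rule integrableI_nonneg)
      show "(\<lambda>x. indicator ?Q x * (G x)\<^sup>2) \<in> borel_measurable lebesgue"
        unfolding sq using Gm by measurable
      show "(\<integral>\<^sup>+x. ennreal (indicator ?Q x * (G x)\<^sup>2) \<partial>lebesgue) < \<infinity>"
        using False by (simp add: e less_top[symmetric])
    qed auto
    define J where "J = (\<integral>x. indicator ?Q x * (G x)\<^sup>2 \<partial>lebesgue)"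
    define A where "A = m * (8 * p)"
    define l where "l = 64 * p / A"
    have A: "0 < A" using m p by (simp add: A_def)
    have l: "0 < l" using A p by (simp add: l_def)
    have "A = (\<integral>x. m * indicator ?q x \<partial>lebesgue)"
      by (simp add: A_def vq)
    also have "\<dots> \<le> (\<integral>x. - (indicator \<Omega> x * (H x * ?\<phi> x)) \<partial>lebesgue)"
    proof (rule integral_mono)
      show "m * indicator ?q x \<le> - (indicator \<Omega> x * (H x * ?\<phi> x))" for x
      proof (cases "x \<in> ?Q")
        case True
        have "m * indicator ?q x \<le> m * ?\<phi> x"
          using m box_bump_eq_1[of d x c, OF d] box_bump_bounds(1)[of c d x]
          by (intro mult_left_mono) (auto simp: indicator_def)
        also have "\<dots> \<le> (- H x) * ?\<phi> x"
          using Hm[OF True] box_bump_bounds(1)[of c d x] by (intro mult_right_mono) auto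
        finally show ?thesis using True sub by auto
      next
        case False
        then have "x \<notin> ?q" using qQ by blast
        then show ?thesis using box_bump_eq_0[of d x c, OF d False] by simp
      qed
    qed (use iq H in auto)
    also have "\<dots> = (\<integral>x. - (indicator \<Omega> x * (G x * ?\<phi> x)) \<partial>lebesgue)"
      using eq by (simp add: set_lebesgue_integral_def)
    also have "\<dots> \<le> (\<integral>x. l / 2 * (indicator ?Q x * (G x)\<^sup>2) + 1 / (2 * l) * indicator ?Q x \<partial>lebesgue)"
    proof (rule integral_mono')
      have young: "\<bar>y\<bar> \<le> l / 2 * y\<^sup>2 + 1 / (2 * l)" for y :: real
      proof -
        have "0 \<le> (l * \<bar>y\<bar> - 1)\<^sup>2 / (2 * l)" using l by simp
        also have "\<dots> = l / 2 * y\<^sup>2 + 1 / (2 * l) - \<bar>y\<bar>"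
          using l by (simp add: power2_diff power_mult_distrib field_simps power2_eq_square)
        finally show ?thesis by simp
      qed
      show "- (indicator \<Omega> x * (G x * ?\<phi> x)) \<le> l / 2 * (indicator ?Q x * (G x)\<^sup>2) + 1 / (2 * l) * indicator ?Q x" for x
      proof (cases "x \<in> ?Q")
        case True
        have "(- G x) * ?\<phi> x \<le> \<bar>G x\<bar> * ?\<phi> x"
          using box_bump_bounds(1)[of c d x] by (intro mult_right_mono) auto
        also have "\<dots> \<le> \<bar>G x\<bar> * 1"
          using box_bump_bounds[of c d x] by (intro mult_left_mono) auto
        also have "\<dots> \<le> l / 2 * (G x)\<^sup>2 + 1 / (2 * l)" using young by simp
        finally show ?thesis using True sub by auto
      qed (simp add: box_bump_eq_0[of d x c, OF d])
      show "0 \<le> l / 2 * (indicator ?Q x * (G x)\<^sup>2) + 1 / (2 * l) * indicator ?Q x" for x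
        using l by simp
    qed (use iG iq in auto)
    also have "\<dots> = l / 2 * J + 1 / (2 * l) * (64 * p)"
      using iG iq vQ by (simp add: J_def)
    finally have "A \<le> 32 * p / A * J + A / 2"
      using A p by (simp add: l_def field_simps)
    then have "A / 2 * A \<le> (32 * p / A * J) * A"
      using A by (intro mult_right_mono) auto
    then have "A * A \<le> 64 * p * J" using A by simp
    then have "64 * p * (m\<^sup>2 * p) \<le> 64 * p * J"
      by (simp add: A_def power2_eq_square mult_ac)
    then have "m\<^sup>2 * p \<le> J" using p by simp
    moreover have "(\<integral>\<^sup>+x. ennreal (indicator ?Q x * (G x)\<^sup>2) \<partial>lebesgue) = ennreal J"
      unfolding J_def using iG by (intro nn_integral_eq_integral) auto
    ultimately show ?thesis by (simp add: e p_def ennreal_leI)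
  qed simp
qed

lemma smooth_on_ext2:
  assumes a: "0 < a" "a < 1" and t: "0 \<le> t" "t < 1"
  shows "smooth_on (B t) (ext2 c a t)"
    and "\<And>x. x \<in> B t \<Longrightarrow> partial 1 (partial 1 (ext2 c a t)) x = - (c * (a * log_slope a (x $ 1 - t) / (x $ 1 - t)))"
proof -
  have B: "0 < x $ 1 - t" "x $ 1 - t < 4" if "x \<in> B t" for x
  proof -
    have "(x $ 1 - 1)\<^sup>2 < (1 - t)\<^sup>2"
      using that zero_le_power2[of "x $ 2"] zero_le_power2[of "x $ 3"] unfolding B_def mem_Collect_eq by linarith
    then have "\<bar>x $ 1 - 1\<bar>\<^sup>2 < (1 - t)\<^sup>2" by simp
    then have "\<bar>x $ 1 - 1\<bar> < 1 - t" by (rule power2_less_imp_less) (use t in simp)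
    then show "0 < x $ 1 - t" "x $ 1 - t < 4" using t by linarith+
  qed
  have lin: "smooth_on (B t) (\<lambda>x. x $ 1 - t)"
    by (rule smooth_on_diff[OF smooth_on_component smooth_on_const open_B])
  have "smooth_on (B t) (\<lambda>x. log_primitive a (x $ 1 - t))"
    by (rule smooth_on_compose[OF Ck1_log_primitive lin _ open_B]) (use a B in auto)
  from smooth_on_mult[OF smooth_on_const this open_B, of c]
  show "smooth_on (B t) (ext2 c a t)"
    by (rule smooth_on_cong[OF _ open_B]) (simp add: ext2_eq)
  have plin: "partial 1 (\<lambda>x :: real ^ 3. x $ 1 - t) x = 1" if "x \<in> B t" for x
    by (subst partial_eqI[of _ "\<lambda>h. h $ 1"])
      (auto intro!: derivative_eq_intros bounded_linear_imp_has_derivative bounded_linear_vec_nth simp: axis_def)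
  have p1: "partial 1 (ext2 c a t) x = c * log_weight a (x $ 1 - t)" if x: "x \<in> B t" for x
  proof -
    have "partial 1 (ext2 c a t) x = partial 1 (\<lambda>x. c * log_primitive a (x $ 1 - t)) x"
      by (rule partial_cong_open[OF open_B x ext2_eq])
    also have "\<dots> = (c * log_weight a (x $ 1 - t)) * partial 1 (\<lambda>x. x $ 1 - t) x"
      using a B[OF x] smooth_on_differentiable[OF lin x]
      by (intro partial_compose[where h = "\<lambda>y. c * log_primitive a y"] DERIV_cmult log_primitive_has_derivative) auto
    finally show ?thesis by (simp add: plin[OF x])
  qed
  fix x assume x: "x \<in> B t"
  have "partial 1 (partial 1 (ext2 c a t)) x = partial 1 (\<lambda>x. c * log_weight a (x $ 1 - t)) x"
    by (rule partial_cong_open[OF open_B x p1])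
  also have "\<dots> = (c * - (a * log_slope a (x $ 1 - t) / (x $ 1 - t))) * partial 1 (\<lambda>x. x $ 1 - t) x"
    using B[OF x] smooth_on_differentiable[OF lin x]
    by (intro partial_compose[where h = "\<lambda>y. c * log_weight a y"] DERIV_cmult log_weight_has_derivative) auto
  finally show "partial 1 (partial 1 (ext2 c a t)) x = - (c * (a * log_slope a (x $ 1 - t) / (x $ 1 - t)))"
    by (simp add: plin[OF x])
qed

text \<open>The boxes have centres at distance \<open>3 w\<^sub>k\<close> from the plane \<open>x\<^sub>1 = t\<close> and dimensions of
  order \<open>w\<^sub>k\<close> and \<open>\<surd>w\<^sub>k\<close>, so that they just fit into \<open>B t\<close>. Each of them contributes at
  least a multiple of \<open>k\<^sup>2\<^sup>a\<^sup>-\<^sup>2 \<ge> 1/k\<close>, because \<open>a = 2 \<alpha> > 1/2\<close>.\<close>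

lemma second_derivative_not_L2:
  assumes a: "1/2 < a" "a < 1" and c: "0 < c" and t: "0 \<le> t" "t < 1"
    and wd: "weak_deriv (B t) [1, 1] (ext2 c a t) G"
  shows "(\<integral>\<^sup>+x\<in>B t. ennreal ((G x)\<^sup>2) \<partial>lebesgue) = \<infinity>"
proof -
  define r where "r = 1 - t"
  have r: "0 < r" "r \<le> 1" using t by (auto simp: r_def)
  define w where "w k = r / 5 / 8 ^ k" for k :: nat
  define v where "v k = sqrt (r * w k) / 4" for k
  define p where "p k = (\<chi> i. if i = 1 then t + 3 * w k else 0 :: real ^ 3)" for k
  define d :: "nat \<Rightarrow> 3 \<Rightarrow> real" where "d k i = (if i = 1 then w k else v k)" for k i
  define Q where "Q k = centered_box (p k) (\<lambda>i. 2 * d k i)" for k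
  let ?\<Psi> = "ext2 c a t"
  let ?H = "partial 1 (partial 1 ?\<Psi>)"
  have a0: "0 < a" "a < 1" using a by auto
  note sm = smooth_on_ext2(1)[OF a0 t, of c]
  have w: "0 < w k" "5 * w k \<le> r" for k
    using r by (auto simp: w_def field_simps)
  have v: "0 < v k" "8 * (v k)\<^sup>2 = r * w k / 2" for k
    using r w(1)[of k] by (auto simp: v_def power_divide)
  have d: "0 < d k i" for k i using w v by (simp add: d_def)
  have Qx: "w k \<le> x $ 1 - t" "x $ 1 - t \<le> 5 * w k" "\<bar>x $ 2\<bar> \<le> 2 * v k" "\<bar>x $ 3\<bar> \<le> 2 * v k"
    if "x \<in> Q k" for x k
  proof -
    have *: "\<bar>x $ i - p k $ i\<bar> \<le> 2 * d k i" for i using that by (simp add: Q_def mem_centered_box)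
    show "w k \<le> x $ 1 - t" "x $ 1 - t \<le> 5 * w k" using *[of 1] by (auto simp: p_def d_def abs_le_iff)
    show "\<bar>x $ 2\<bar> \<le> 2 * v k" "\<bar>x $ 3\<bar> \<le> 2 * v k" using *[of 2] *[of 3] by (auto simp: p_def d_def)
  qed
  have QB: "Q k \<subseteq> B t" for k
  proof
    fix x assume x: "x \<in> Q k"
    define s where "s = x $ 1 - t"
    have s: "w k \<le> s" "s \<le> r" using Qx[OF x] w(2)[of k] by (auto simp: s_def)
    have "\<bar>x $ 2\<bar>\<^sup>2 \<le> (2 * v k)\<^sup>2" "\<bar>x $ 3\<bar>\<^sup>2 \<le> (2 * v k)\<^sup>2"
      by (rule power_mono[OF Qx(3)[OF x] abs_ge_zero] power_mono[OF Qx(4)[OF x] abs_ge_zero])+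
    then have "(x $ 2)\<^sup>2 + (x $ 3)\<^sup>2 \<le> r * w k / 2"
      using v(2)[of k] by (simp add: power_mult_distrib)
    moreover have "(x $ 1 - 1)\<^sup>2 = r\<^sup>2 - s * r - s * (r - s)"
      by (simp add: s_def r_def power2_eq_square algebra_simps)
    moreover have "w k * r \<le> s * r" using s r by (intro mult_right_mono) auto
    moreover have "0 \<le> s * (r - s)" using s w(1)[of k] by (intro mult_nonneg_nonneg) auto
    moreover have "0 < r * w k" using r w(1)[of k] by simp
    moreover have "w k * r = r * w k" by simp
    ultimately have "(x $ 1 - 1)\<^sup>2 + ((x $ 2)\<^sup>2 + (x $ 3)\<^sup>2) < r\<^sup>2" by argo
    then show "x \<in> B t" by (simp add: B_def r_def add.assoc)
  qed
  define \<kappa> where "\<kappa> = (c * a / 5)\<^sup>2 * r / 16"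
  have \<kappa>: "0 < \<kappa>" using c a r by (simp add: \<kappa>_def)
  define A where "A = ln (20 / r) + ln 8"
  have low: "ennreal (\<kappa> / (A * real (Suc k))) \<le> (\<integral>\<^sup>+x\<in>Q k. ennreal ((G x)\<^sup>2) \<partial>lebesgue)" for k
  proof -
    define L where "L = ln (4 / w k)"
    have "L = ln (20 / r * 8 ^ k)" using r by (simp add: L_def w_def)
    also have "\<dots> = ln (20 / r) + real k * ln 8" using r by (subst ln_mult) (auto simp: ln_realpow)
    finally have Leq: "L = ln (20 / r) + real k * ln 8" .
    have "1 = ln (exp 1 :: real)" by simp
    also have "\<dots> \<le> ln (20 / r)"
    proof (rule ln_mono)
      have "exp 1 \<le> (20 :: real)" using exp_le by linarith
      also have "20 \<le> 20 / r" using r by (simp add: field_simps)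
      finally show "exp 1 \<le> 20 / r" .
    qed (use r in auto)
    finally have l1: "1 \<le> ln (20 / r)" .
    have L1: "1 \<le> L" unfolding Leq using l1 by (simp add: add_increasing2)
    have LA: "L \<le> A * real (Suc k)"
    proof -
      have "0 \<le> real k * ln (20 / r)" using l1 by (intro mult_nonneg_nonneg) auto
      moreover have "0 \<le> ln (8 :: real)" by simp
      ultimately show ?thesis unfolding Leq A_def of_nat_Suc distrib_left distrib_right by (simp add: mult.commute)
    qed
    define m where "m = c * (a * L powr (a - 1) / (5 * w k))"
    have m: "0 < m" using c a w(1)[of k] L1 by (simp add: m_def)
    have test: "test_function (B t) (box_bump (p k) (d k))"
      by (rule test_function_box_bump) (use d QB in \<open>auto simp: Q_def\<close>)
    have "ennreal (m\<^sup>2 * (\<Prod>i\<in>UNIV. d k i)) \<le>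
        (\<integral>\<^sup>+x\<in>centered_box (p k) (\<lambda>i. 2 * d k i). ennreal ((G x)\<^sup>2) \<partial>lebesgue)"
    proof (rule nn_integral_square_lower_bound[where H = ?H and \<Omega> = "B t"])
      show "centered_box (p k) (\<lambda>i. 2 * d k i) \<subseteq> B t" using QB by (simp add: Q_def)
      have "compact (centered_box (p k) (\<lambda>i. 2 * d k i))" by (simp add: centered_box_def compact_cbox)
      then show "set_integrable lebesgue (centered_box (p k) (\<lambda>i. 2 * d k i)) G"
        using wd QB[of k] by (simp add: weak_deriv_def locally_integrable_def Q_def)
      have i: "integrable lborel (\<lambda>x. indicator (B t) x * (?H x * box_bump (p k) (d k) x))"
        by (rule test_function_integrable[OF test_function_mult_smooth[OF open_B smooth_on_partial[OF smooth_on_partial[OF sm]] test]])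
      then show "integrable lebesgue (\<lambda>x. indicator (B t) x * (?H x * box_bump (p k) (d k) x))"
        by (subst integrable_completion) auto
      have "(LINT x:B t|lebesgue. G x * box_bump (p k) (d k) x) =
          (LINT x:B t|lebesgue. ?\<Psi> x * partial 1 (partial 1 (box_bump (p k) (d k))) x)"
        using wd test by (simp add: weak_deriv_def)
      also have "\<dots> = - (LINT x:B t|lebesgue. partial 1 ?\<Psi> x * partial 1 (box_bump (p k) (d k)) x)"
        by (rule smooth_integration_by_parts[OF open_B sm test_function_partial[OF test]])
      also have "\<dots> = (LINT x:B t|lebesgue. ?H x * box_bump (p k) (d k) x)"
        using smooth_integration_by_parts[OF open_B smooth_on_partial[OF sm] test] by simp
      finally show "(LINT x:B t|lebesgue. G x * box_bump (p k) (d k) x) =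
          (LINT x:B t|lebesgue. ?H x * box_bump (p k) (d k) x)" .
      fix x assume "x \<in> centered_box (p k) (\<lambda>i. 2 * d k i)"
      then have x: "x \<in> Q k" by (simp add: Q_def)
      define s where "s = x $ 1 - t"
      have s: "w k \<le> s" "s \<le> 5 * w k" "s \<le> 1" using Qx[OF x] w(2)[of k] r by (auto simp: s_def)
      have s0: "0 < s" using s w(1)[of k] by linarith
      have "ln (4 / s) \<le> L" unfolding L_def using s w(1)[of k] s0 by (intro ln_mono) (auto simp: field_simps)
      then have "L powr (a - 1) \<le> log_slope a s"
        unfolding log_slope_def using ln_4_div_pos[of s] s s0 a by (intro powr_mono2') auto
      then have "a * L powr (a - 1) \<le> a * log_slope a s" using a by (intro mult_left_mono) auto
      then have "a * L powr (a - 1) / (5 * w k) \<le> a * log_slope a s / s"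
        using s s0 a by (intro frac_le) (auto simp: log_slope_nonneg)
      then have "m \<le> c * (a * log_slope a s / s)" unfolding m_def using c by (intro mult_left_mono) auto
      then show "?H x \<le> - m"
        using smooth_on_ext2(2)[OF a0 t subsetD[OF QB x], of c] by (simp add: s_def)
    qed (use d m in auto)
    moreover have "\<kappa> / (A * real (Suc k)) \<le> m\<^sup>2 * (\<Prod>i\<in>UNIV. d k i)"
    proof -
      have "(\<Prod>i\<in>UNIV. d k i) = w k * (v k)\<^sup>2"
        unfolding UNIV_3 by (simp add: d_def power2_eq_square)
      also have "\<dots> = w k * (r * w k / 16)" using v(2)[of k] by simp
      finally have "m\<^sup>2 * (\<Prod>i\<in>UNIV. d k i) = \<kappa> * (L powr (a - 1))\<^sup>2"
        using w(1)[of k] by (simp add: m_def \<kappa>_def power2_eq_square field_simps)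
      also have "(L powr (a - 1))\<^sup>2 = L powr (2 * a - 2)"
        by (simp add: power2_eq_square powr_add[symmetric])
      finally have e: "m\<^sup>2 * (\<Prod>i\<in>UNIV. d k i) = \<kappa> * L powr (2 * a - 2)" .
      have "1 / (A * real (Suc k)) \<le> 1 / L" using L1 LA by (intro divide_left_mono) auto
      also have "\<dots> = L powr (-1)" using L1 by (simp add: powr_minus_divide)
      also have "\<dots> \<le> L powr (2 * a - 2)" using L1 a by (intro powr_mono) auto
      finally have "\<kappa> * (1 / (A * real (Suc k))) \<le> \<kappa> * L powr (2 * a - 2)"
        using \<kappa> by (intro mult_left_mono) auto
      then show ?thesis unfolding e by simp
    qed
    ultimately show ?thesis unfolding Q_def by (meson ennreal_leI order_trans)
  qed
  have A: "0 < A"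
  proof -
    have "0 < ln (20 / r)" using r by simp
    then show ?thesis unfolding A_def by (intro add_pos_pos) auto
  qed
  have Qm: "Q k \<in> sets lebesgue" for k
    using measure_centered_box(3)[of "\<lambda>i. 2 * d k i" "p k"] d by (simp add: Q_def)
  have disj: "disjoint_family_on Q UNIV"
  proof -
    have "Q k \<inter> Q l = {}" if "k < l" for k l
    proof (rule ccontr)
      assume "Q k \<inter> Q l \<noteq> {}"
      then obtain x where x: "x \<in> Q k" "x \<in> Q l" by blast
      have "w k \<le> 5 * w l" using Qx(1)[OF x(1)] Qx(2)[OF x(2)] by linarith
      also have "w l \<le> w (Suc k)"
        unfolding w_def using r that by (intro divide_left_mono power_increasing) auto
      also have "w (Suc k) = w k / 8" by (simp add: w_def)
      finally show False using w(1)[of k] by simp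
    qed
    then show ?thesis unfolding disjoint_family_on_def by (metis Int_commute linorder_neqE_nat)
  qed
  have sum_le: "ennreal (\<Sum>k<n. \<kappa> / (A * real (Suc k))) \<le> (\<integral>\<^sup>+x\<in>B t. ennreal ((G x)\<^sup>2) \<partial>lebesgue)" for n
  proof -
    have Gm: "(\<lambda>x. ennreal ((G x)\<^sup>2) * indicator (Q k) x) \<in> borel_measurable lebesgue" for k
    proof -
      have "compact (Q k)" by (simp add: Q_def centered_box_def compact_cbox)
      then have "set_integrable lebesgue (Q k) G"
        using wd QB by (simp add: weak_deriv_def locally_integrable_def)
      then have [measurable]: "(\<lambda>x. indicator (Q k) x * G x) \<in> borel_measurable lebesgue"
        by (simp add: set_integrable_def)
      have "(\<lambda>x. ennreal ((indicator (Q k) x * G x)\<^sup>2)) \<in> borel_measurable lebesgue" by measurable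
      moreover have "(\<lambda>x. ennreal ((indicator (Q k) x * G x)\<^sup>2)) = (\<lambda>x. ennreal ((G x)\<^sup>2) * indicator (Q k) x)"
        by (auto simp: indicator_def)
      ultimately show ?thesis by simp
    qed
    have "ennreal (\<Sum>k<n. \<kappa> / (A * real (Suc k))) = (\<Sum>k<n. ennreal (\<kappa> / (A * real (Suc k))))"
      using \<kappa> A by (intro sum_ennreal[symmetric]) auto
    also have "\<dots> \<le> (\<Sum>k<n. \<integral>\<^sup>+x\<in>Q k. ennreal ((G x)\<^sup>2) \<partial>lebesgue)"
      by (intro sum_mono low)
    also have "\<dots> = (\<integral>\<^sup>+x. (\<Sum>k<n. ennreal ((G x)\<^sup>2) * indicator (Q k) x) \<partial>lebesgue)"
      using Gm by (intro nn_integral_sum[symmetric]) auto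
    also have "\<dots> \<le> (\<integral>\<^sup>+x\<in>B t. ennreal ((G x)\<^sup>2) \<partial>lebesgue)"
    proof (rule nn_integral_mono)
      fix x
      have "disjoint_family_on Q {..<n}" using disj by (rule disjoint_family_on_mono[rotated]) auto
      then have "(\<Sum>k<n. indicator (Q k) x :: ennreal) = indicator (\<Union>(Q ` {..<n})) x"
        by (simp add: indicator_UN_disjoint)
      also have "\<dots> \<le> indicator (B t) x" using QB by (intro indicator_leI) blast
      finally show "(\<Sum>k<n. ennreal ((G x)\<^sup>2) * indicator (Q k) x) \<le> ennreal ((G x)\<^sup>2) * indicator (B t) x"
        unfolding sum_distrib_left[symmetric] by (rule mult_left_mono) simp
    qed
    finally show ?thesis .
  qed
  show ?thesis
  proof (rule ccontr)
    assume "\<not> ?thesis"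
    then obtain T where T: "0 \<le> T" "(\<integral>\<^sup>+x\<in>B t. ennreal ((G x)\<^sup>2) \<partial>lebesgue) = ennreal T"
      by (cases "\<integral>\<^sup>+x\<in>B t. ennreal ((G x)\<^sup>2) \<partial>lebesgue") auto
    have "(\<Sum>k<n. \<kappa> / (A * real (Suc k))) \<le> T" for n
      using sum_le[of n] T by (simp add: ennreal_le_iff)
    then have "summable (\<lambda>k. \<kappa> / (A * real (Suc k)))"
      using \<kappa> A by (intro summableI_nonneg_bounded) auto
    then have "summable (\<lambda>k. A / \<kappa> * (\<kappa> / (A * real (Suc k))))" by (rule summable_mult)
    moreover have "A / \<kappa> * (\<kappa> / (A * real (Suc k))) = inverse (real (Suc k))" for k
      using \<kappa> A by (simp add: field_simps del: of_nat_Suc)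
    ultimately have "summable (\<lambda>k. inverse (real (Suc k)))" by simp
    then have "summable (\<lambda>k. inverse (real k))"
      using summable_Suc_iff[of "\<lambda>k. inverse (real k)"] by simp
    then show False using not_summable_harmonic[where 'a = real] by simp
  qed
qed

lemma Hdot_norm_ext2:
  assumes a: "1/2 < a" "a < 1" and c: "0 < c" and t: "0 \<le> t" "t < 1"
  shows "Hdot_norm 2 (B t) (ext2 c a t) = \<infinity>"
proof -
  have "ennreal_sqrt (\<Sum>is\<in>{is :: 3 list. length is = 2}. \<integral>\<^sup>+x\<in>B t. ennreal ((g is x)\<^sup>2) \<partial>lebesgue) = top"
    if "\<forall>is. length is = 2 \<longrightarrow> weak_deriv (B t) is (ext2 c a t) (g is)" for g
  proof -
    let ?I = "\<lambda>is. \<integral>\<^sup>+x\<in>B t. ennreal ((g is x)\<^sup>2) \<partial>lebesgue"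
    have fin: "finite {is :: 3 list. length is = 2}"
      using finite_lists_length_eq[of "UNIV :: 3 set" 2] by simp
    have "?I [1, 1] = \<infinity>" using that by (intro second_derivative_not_L2[OF a c t]) simp
    moreover have "?I [1, 1] \<le> (\<Sum>is\<in>{is :: 3 list. length is = 2}. ?I is)"
      by (rule member_le_sum) (use fin in auto)
    ultimately have "(\<Sum>is\<in>{is :: 3 list. length is = 2}. ?I is) = \<infinity>" by (simp add: top_unique)
    then show ?thesis by (simp add: ennreal_sqrt_def)
  qed
  then show ?thesis unfolding Hdot_norm_def by (auto simp: Inf_top_conv)
qed

theorem lemma2p1:
  shows "(\<forall>(\<alpha>::real) (R::real). 0 < \<alpha> \<and> \<alpha> < 1/2 \<and> 2 < R \<longrightarrow>
           (\<exists>C::real. \<forall>\<epsilon>>0. \<exists>\<Psi> :: real ^ 3 \<Rightarrow> real.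
              \<Psi> \<in> Hsob 2 UNIV \<and>
              (\<forall>x\<in>B 0. \<Psi> x = chi1 \<epsilon> \<alpha> (x $ 1)) \<and>
              Hdot_norm 2 UNIV \<Psi> \<le> ennreal (C * \<epsilon>) \<and>
              supp \<Psi> \<subseteq> {x. norm x \<le> R} \<and>
              sing_supp \<Psi> = {0}))
       \<and> (\<forall>(\<alpha>::real) (\<epsilon>::real). 1/4 < \<alpha> \<and> \<alpha> < 1/2 \<and> 0 < \<epsilon> \<longrightarrow>
           (\<forall>x. chi2 \<epsilon> \<alpha> x = 2 * (LBINT s=0..x. \<epsilon>\<^sup>2 * \<bar>ln \<bar>s / 4\<bar>\<bar> powr (2 * \<alpha>))) \<and>
           (\<forall>t::real. \<exists>\<Psi> :: real ^ 3 \<Rightarrow> real.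
              \<Psi> \<in> Hdot 1 UNIV \<and>
              (\<forall>x\<in>B t. \<Psi> x = chi2 \<epsilon> \<alpha> (x $ 1 - t)) \<and>
              (0 \<le> t \<and> t < 1 \<longrightarrow> Hdot_norm 2 (B t) \<Psi> = \<infinity>)))"
proof (rule conjI; intro allI impI)
  fix \<alpha> R :: real assume "0 < \<alpha> \<and> \<alpha> < 1/2 \<and> 2 < R"
  then show "\<exists>C::real. \<forall>\<epsilon>>0. \<exists>\<Psi> :: real ^ 3 \<Rightarrow> real.
      \<Psi> \<in> Hsob 2 UNIV \<and> (\<forall>x\<in>B 0. \<Psi> x = chi1 \<epsilon> \<alpha> (x $ 1)) \<and>
      Hdot_norm 2 UNIV \<Psi> \<le> ennreal (C * \<epsilon>) \<and> supp \<Psi> \<subseteq> {x. norm x \<le> R} \<and> sing_supp \<Psi> = {0}"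
    by (intro extension_part1) auto
next
  fix \<alpha> \<epsilon> :: real assume \<alpha>: "1/4 < \<alpha> \<and> \<alpha> < 1/2 \<and> 0 < \<epsilon>"
  show "(\<forall>x. chi2 \<epsilon> \<alpha> x = 2 * (LBINT s=0..x. \<epsilon>\<^sup>2 * \<bar>ln \<bar>s / 4\<bar>\<bar> powr (2 * \<alpha>))) \<and>
      (\<forall>t::real. \<exists>\<Psi> :: real ^ 3 \<Rightarrow> real. \<Psi> \<in> Hdot 1 UNIV \<and>
        (\<forall>x\<in>B t. \<Psi> x = chi2 \<epsilon> \<alpha> (x $ 1 - t)) \<and>
        (0 \<le> t \<and> t < 1 \<longrightarrow> Hdot_norm 2 (B t) \<Psi> = \<infinity>))"
  proof (intro conjI allI)
    show "chi2 \<epsilon> \<alpha> x = 2 * (LBINT s=0..x. \<epsilon>\<^sup>2 * \<bar>ln \<bar>s / 4\<bar>\<bar> powr (2 * \<alpha>))" for x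
      using \<alpha> by (intro chi2_eq_LBINT) auto
    fix t :: real
    show "\<exists>\<Psi> :: real ^ 3 \<Rightarrow> real. \<Psi> \<in> Hdot 1 UNIV \<and>
        (\<forall>x\<in>B t. \<Psi> x = chi2 \<epsilon> \<alpha> (x $ 1 - t)) \<and>
        (0 \<le> t \<and> t < 1 \<longrightarrow> Hdot_norm 2 (B t) \<Psi> = \<infinity>)"
      using \<alpha> ext2_Hdot_1[of "2 * \<alpha>" "2 * \<epsilon>\<^sup>2" t] Hdot_norm_ext2[of "2 * \<alpha>" "2 * \<epsilon>\<^sup>2" t]
      by (intro exI[of _ "ext2 (2 * \<epsilon>\<^sup>2) (2 * \<alpha>) t"]) (auto simp: ext2_eq chi2_eq)
  qed
qed

end
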